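(* For every outerplanar graph $G$, both the convex obstacle number and the disjoint convex obstacle number of $G$ are at most $5$.
   Context: An obstacle representation of a graph $G$ consists of an injective placement of the vertices of $G$ as points in the plane together with a set of polygons (obstacles), such that the vertex points together with the polygon vertices are in general position (no three collinear), and two vertices $u,v$ are adjacent in $G$ if and only if the straight-line segment $\overline{uv}$ does not meet any obstacle. The convex obstacle number of $G$ is the smallest number of obstacles in an obstacle representation of $G$ in which all obstacles are convex polygons; the disjoint convex obstacle number is the smallest number of obstacles in an obstacle representation in which all obstacles are convex polygons and pairwise disjoint. *)

theory Defs
  imports "HOL-Analysis.Analysis" "HOL-Library.Extended_Nat"
begin

text \<open>
  The Euclidean plane is modelled by the type \<^typ>\<open>complex\<close>, for which the library has the Jordan
  curve theorem; only its real affine and topological structure is used.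
\<close>

definition simple_graph :: "'a set \<Rightarrow> 'a set set \<Rightarrow> bool" where
  "simple_graph V E \<longleftrightarrow> finite V \<and> (\<forall>e\<in>E. e \<subseteq> V \<and> card e = 2)"

text \<open>
  In a drawing, vertices are points and the edge \<open>e\<close> is the Jordan arc \<open>c e\<close>, traversed in either
  direction.
\<close>

definition plane_drawing ::
  "'a set \<Rightarrow> 'a set set \<Rightarrow> ('a \<Rightarrow> complex) \<Rightarrow> ('a set \<Rightarrow> real \<Rightarrow> complex) \<Rightarrow> bool" where
  "plane_drawing V E p c \<longleftrightarrow>
     inj_on p V \<and>
     (\<forall>e\<in>E. arc (c e) \<and> {pathstart (c e), pathfinish (c e)} = p ` e
            \<and> path_image (c e) \<inter> p ` V = p ` e) \<and>
     (\<forall>e\<in>E. \<forall>f\<in>E. e \<noteq> f \<longrightarrow> path_image (c e) \<inter> path_image (c f) \<subseteq> p ` (e \<inter> f))"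

definition drawing_image ::
  "'a set \<Rightarrow> 'a set set \<Rightarrow> ('a \<Rightarrow> complex) \<Rightarrow> ('a set \<Rightarrow> real \<Rightarrow> complex) \<Rightarrow> complex set" where
  "drawing_image V E p c = p ` V \<union> (\<Union>e\<in>E. path_image (c e))"

text \<open>
  For a bounded set \<open>S\<close> in the plane, \<^term>\<open>outside S\<close> is the unique unbounded component of the
  complement of \<open>S\<close>; for a drawing this is the outer face.
\<close>

definition outerplanar :: "'a set \<Rightarrow> 'a set set \<Rightarrow> bool" where
  "outerplanar V E \<longleftrightarrow>
     (\<exists>p c. plane_drawing V E p c \<and> p ` V \<subseteq> frontier (outside (drawing_image V E p c)))"

text \<open>Polygons are solid, closed and non-degenerate; their vertices are their extreme points.\<close>

definition convex_polygon :: "complex set \<Rightarrow> bool" where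
  "convex_polygon P \<longleftrightarrow> polytope P \<and> aff_dim P = 2"

definition polygon_vertices :: "complex set \<Rightarrow> complex set" where
  "polygon_vertices P = {x. x extreme_point_of P}"

definition general_position :: "complex set \<Rightarrow> bool" where
  "general_position S \<longleftrightarrow> (\<forall>T\<subseteq>S. card T = 3 \<longrightarrow> \<not> collinear T)"

definition convex_obstacle_representation ::
  "'a set \<Rightarrow> 'a set set \<Rightarrow> ('a \<Rightarrow> complex) \<Rightarrow> complex set set \<Rightarrow> bool" where
  "convex_obstacle_representation V E p Obs \<longleftrightarrow>
     inj_on p V \<and>
     finite Obs \<and>
     (\<forall>P\<in>Obs. convex_polygon P) \<and>
     general_position (p ` V \<union> (\<Union>P\<in>Obs. polygon_vertices P)) \<and>
     (\<forall>u\<in>V. \<forall>v\<in>V. u \<noteq> v \<longrightarrow>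
        ({u, v} \<in> E \<longleftrightarrow> (\<forall>P\<in>Obs. closed_segment (p u) (p v) \<inter> P = {})))"

text \<open>
  The minima are taken in \<^typ>\<open>enat\<close>, so that they would be \<open>\<infinity>\<close> (and not \<open>0\<close>) if there were
  no representation.
\<close>

definition convex_obstacle_number :: "'a set \<Rightarrow> 'a set set \<Rightarrow> enat" where
  "convex_obstacle_number V E =
     Inf {enat (card Obs) | p Obs. convex_obstacle_representation V E p Obs}"

definition disjoint_convex_obstacle_number :: "'a set \<Rightarrow> 'a set set \<Rightarrow> enat" where
  "disjoint_convex_obstacle_number V E =
     Inf {enat (card Obs) | p Obs. convex_obstacle_representation V E p Obs \<and> pairwise disjnt Obs}"

end

theory Submission imports Defs "HOL-Library.Sublist" begin

text \<open>
  Every vertex of the drawing lies on the outer face, so by the theta lemma for Jordan arcs no three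
  internally disjoint paths with inner vertices join two vertices, and no cycle has crossing chords.
  A longest cycle is therefore Hamiltonian unless the graph splits at a cut vertex, and the vertices
  can be ordered without crossing edges.

  Breadth-first search along such an order, after subdividing an added Hamiltonian path, yields
  layers in which every vertex has at most two parents, neighbours in the previous layer, and only
  consecutive vertices of a layer can be adjacent. Give the vertices integer coordinates so that
  the children of a vertex with coordinate \<open>x\<close> are exactly the vertices of the next layer with
  coordinate at distance at most \<open>M\<close> from \<open>M * x\<close>, and put the even layers on a line, the odd ones
  on a parallel line with reversed orientation. All segments from parents on the left to children
  on the right then pass through one common small gate, all segments from children on the left to
  parents on the right through another one, and no other segment between the lines does; so three
  obstacles forming a wall with these two gates suffice. Bending the two lines into flat convex
  curves allows one more obstacle behind each of them to regulate visibility on that side. All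
  incidences are certified by strict inequalities and hence survive a perturbation into general
  position.
\<close>

text \<open>A segment between two parallel lines meets a small fixed gate exactly when one linear
  expression in its end coordinates is small. So a gate can only realise windows of one common
  radius whose centres are a fixed multiple of the parents' coordinates. This uniformity forces the
  coordinates to grow by the same factor \<open>M\<close> from layer to layer, and it forces the
  windows of two vertices with a common child to touch at an end. The growth pays off elsewhere:
  vertices two or more layers apart miss each other's windows by a wide margin, and so does a parent
  with respect to the window of its child, which matters at the other gate. Integrality separates
  distance at most \<open>M\<close> from distance at least \<open>M + 1\<close>, and the gates open
  to \<open>M + 1 / 2\<close>, so every incidence is strict. Strictness permits degenerate drawings:
  walls may be segments and chains may be almost straight, since curvature and general position are
  both supplied by limit arguments.\<close>

section \<open>Jordan arcs and the theta lemma\<close>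

definition arc_between :: "complex \<Rightarrow> complex \<Rightarrow> (real \<Rightarrow> complex) \<Rightarrow> bool" where
  "arc_between a b g \<longleftrightarrow> arc g \<and> pathstart g = a \<and> pathfinish g = b"

lemma arc_between_distinct: "arc_between a b g \<Longrightarrow> a \<noteq> b"
  using arc_distinct_ends arc_between_def by fastforce

lemma two_arcs_Jordan:
  assumes g: "arc_between a b g" and h: "arc_between a b h"
    and gh: "path_image g \<inter> path_image h = {a, b}"
  defines "J \<equiv> path_image g \<union> path_image h"
  shows "inside J \<noteq> {}" "open (inside J)" "connected (inside J)"
    "frontier (inside J) = J" "open (outside J)" "connected (outside J)" "compact J"
proof -
  let ?c = "g +++ reversepath h"
  have "simple_path ?c"
    using g h gh by (auto simp: arc_between_def intro!: simple_path_join_loop arc_reversepath)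
  moreover have "pathfinish ?c = pathstart ?c" 
    using g h by (auto simp: arc_between_def)
  moreover have "path_image ?c = J"
    using g h by (auto simp: J_def arc_between_def path_image_join)
  ultimately show "inside J \<noteq> {}" "open (inside J)" "connected (inside J)"
    "frontier (inside J) = J" "open (outside J)" "connected (outside J)" "compact J"
    using Jordan_inside_outside[of ?c] compact_simple_path_image[of ?c] by auto
qed

lemma not_in_inside: "x \<in> inside S \<Longrightarrow> x \<notin> S"
  using inside_no_overlap by blast

lemma connected_subset_inside:
  assumes "connected T" "T \<inter> S = {}" "T \<inter> inside S \<noteq> {}"
  shows "T \<subseteq> inside S"
proof
  fix y assume "y \<in> T"
  obtain x where x: "x \<in> T" "x \<in> inside S" using assms by auto
  have "connected_component (- S) x y"
    using assms(1,2) x(1) \<open>y \<in> T\<close> unfolding connected_component_def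
    by (intro exI[of _ T]) auto
  then show "y \<in> inside S" using x(2) inside_same_component by blast
qed

text \<open>Janiszewski's theorem gives the theta lemma: if all three arcs avoided the inside of the
  cycle formed by the other two, then a point inside the second cycle could be joined to
  infinity in the complement of the whole theta.\<close>

lemma theta_one_arc_inside:
  assumes g: "arc_between a b g1" "arc_between a b g2" "arc_between a b g3"
    and i: "path_image g1 \<inter> path_image g2 = {a, b}" "path_image g1 \<inter> path_image g3 = {a, b}"
      "path_image g2 \<inter> path_image g3 = {a, b}"
    and n1: "path_image g1 \<inter> inside (path_image g2 \<union> path_image g3) = {}"
    and n2: "path_image g2 \<inter> inside (path_image g1 \<union> path_image g3) = {}"
  shows "path_image g3 \<inter> inside (path_image g1 \<union> path_image g2) \<noteq> {}"
proof
  assume n3: "path_image g3 \<inter> inside (path_image g1 \<union> path_image g2) = {}"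
  let ?A = "path_image g1" and ?B = "path_image g2" and ?C = "path_image g3"
  have n2': "?B \<inter> inside (?A \<union> ?C) = {}" by (rule n2)
  note J12 = two_arcs_Jordan[OF g(1,2) i(1)]
  note J13 = two_arcs_Jordan[OF g(1,3) i(2)]
  note J23 = two_arcs_Jordan[OF g(2,3) i(3)]
  have cmp: "compact ?A" "compact ?B" "compact ?C" "connected ?A"
    using g compact_arc_image connected_arc_image by (auto simp: arc_between_def)
  obtain z where z: "z \<in> inside (?B \<union> ?C)" using J23(1) by auto
  have zn: "z \<notin> ?A" "z \<notin> ?B" "z \<notin> ?C"
    using z n1 inside_no_overlap[of "?B \<union> ?C"] by blast+
  have ends: "\<exists>x. x \<in> path_image h \<and> x \<noteq> a \<and> x \<noteq> b" if "arc_between a b h" for h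
  proof -
    have "infinite (path_image h)"
      using that arc_between_distinct[OF that] unfolding arc_between_def
      by (metis arc_imp_path connected_finite_iff_sing connected_path_image empty_iff insert_iff pathfinish_in_path_image
          pathstart_in_path_image)
    then have "infinite (path_image h - {a,b})" by simp
    then show ?thesis
      by (metis DiffD1 DiffD2 ex_in_conv finite.emptyI insertCI)
  qed
  \<comment> \<open>If \<open>z\<close> lay inside a cycle through the first arc, then that inside,
    being connected and disjoint from the cycle of the other two arcs, would be contained in the
    inside of the latter. Taking closures pushes the inner points of the first arc into it as well,
    against \<open>n1\<close>.\<close>
  have nested: False
    if "z \<in> inside (X \<union> Y)" "connected (inside (X \<union> Y))" "frontier (inside (X \<union> Y)) = X \<union> Y"
      "inside (X \<union> Y) \<inter> (?B \<union> ?C) = {}" "X = ?A" "X \<inter> (?B \<union> ?C) = {a,b}" for X Y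
  proof -
    have "inside (X \<union> Y) \<subseteq> inside (?B \<union> ?C)"
      using that z by (intro connected_subset_inside) auto
    then have "closure (inside (X \<union> Y)) \<subseteq> closure (inside (?B \<union> ?C))" by (rule closure_mono)
    moreover have "closure (inside (?B \<union> ?C)) \<subseteq> inside (?B \<union> ?C) \<union> (?B \<union> ?C)"
      using J23(4) closure_Un_frontier by blast
    moreover have "X \<subseteq> closure (inside (X \<union> Y))" using that(3) by (auto simp: frontier_def)
    ultimately have "X \<subseteq> inside (?B \<union> ?C) \<union> (?B \<union> ?C)" by auto
    moreover obtain x where x: "x \<in> ?A" "x \<noteq> a" "x \<noteq> b" using ends[OF g(1)] by auto
    moreover have "x \<notin> ?B \<union> ?C" using x i by auto
    ultimately have "x \<in> inside (?B \<union> ?C)" using that(5) by auto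
    then show False using x n1 by auto
  qed
  have o12: "z \<in> outside (?A \<union> ?B)"
  proof (rule ccontr)
    assume "z \<notin> outside (?A \<union> ?B)"
    then have "z \<in> inside (?A \<union> ?B)" using zn inside_outside by auto
    moreover have "inside (?A \<union> ?B) \<inter> (?B \<union> ?C) = {}" "?A \<inter> (?B \<union> ?C) = {a, b}"
      using n3 i by (auto dest: not_in_inside)
    ultimately show False by (rule nested[OF _ J12(3,4) _ refl])
  qed
  have o13: "z \<in> outside (?A \<union> ?C)"
  proof (rule ccontr)
    assume "z \<notin> outside (?A \<union> ?C)"
    then have "z \<in> inside (?A \<union> ?C)" using zn inside_outside by auto
    moreover have "inside (?A \<union> ?C) \<inter> (?B \<union> ?C) = {}" "?A \<inter> (?B \<union> ?C) = {a, b}"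
      using n2 i by (auto dest: not_in_inside)
    ultimately show False by (rule nested[OF _ J13(3,4) _ refl])
  qed
  have "bounded (?A \<union> ?B \<union> ?C)" using cmp by (simp add: compact_imp_bounded)
  then obtain y where y: "y \<in> outside (?A \<union> ?B \<union> ?C)"
    using outside_bounded_nonempty by blast
  have yo: "y \<in> outside S" if "S \<subseteq> ?A \<union> ?B \<union> ?C" for S
    using y outside_mono[OF that] by auto
  have cc: "connected_component (- S) z y"
    if "z \<in> outside S" "y \<in> outside S" "connected (outside S)" for S
  proof -
    have "outside S \<subseteq> - S" using outside_no_overlap[of S] by blast
    then show ?thesis
      using that unfolding connected_component_def by (intro exI[of _ "outside S"]) auto
  qed
  \<comment> \<open>The two cycles through the first arc meet exactly in this connected arc, and
    neither separates \<open>z\<close> from the far point \<open>y\<close>; hence their union does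
    not either.\<close>
  have "connected_component (- ((?A \<union> ?B) \<union> (?A \<union> ?C))) z y"
  proof (rule Janiszewski)
    show "connected ((?A \<union> ?B) \<inter> (?A \<union> ?C))"
    proof -
      have "(?A \<union> ?B) \<inter> (?A \<union> ?C) = ?A" using i by blast
      then show ?thesis using cmp by simp
    qed
    show "connected_component (- (?A \<union> ?B)) z y" by (rule cc[OF o12 yo J12(6)]) auto
    show "connected_component (- (?A \<union> ?C)) z y" by (rule cc[OF o13 yo J13(6)]) auto
  qed (use J12 J13 compact_imp_closed in auto)
  then have "connected_component (- (?B \<union> ?C)) z y"
    by (rule connected_component_of_subset) auto
  then have "y \<in> inside (?B \<union> ?C)" using z inside_same_component by blast
  moreover have "y \<in> outside (?B \<union> ?C)" by (rule yo) auto
  ultimately show False using inside_Int_outside by blast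
qed

text \<open>Without its ends the arc is still connected and avoids the cycle, so a single point
  inside drags all of it along.\<close>

lemma theta_arc_subset_inside:
  assumes "arc_between a b h"
    and "path_image g1 \<inter> path_image h \<subseteq> {a, b}" "path_image g2 \<inter> path_image h \<subseteq> {a, b}"
    and "path_image h \<inter> inside (path_image g1 \<union> path_image g2) \<noteq> {}"
    and "{a, b} \<subseteq> path_image g1"
  shows "path_image h - {a, b} \<subseteq> inside (path_image g1 \<union> path_image g2)"
proof (rule connected_subset_inside)
  show "connected (path_image h - {a, b})"
    using assms(1) connected_simple_path_endless[of h] by (auto simp: arc_between_def arc_imp_simple_path)
  show "(path_image h - {a, b}) \<inter> (path_image g1 \<union> path_image g2) = {}"
    using assms(2,3) by auto
  show "(path_image h - {a, b}) \<inter> inside (path_image g1 \<union> path_image g2) \<noteq> {}"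
    using assms(4,5) not_in_inside[of _ "path_image g1 \<union> path_image g2"] by auto
qed


section \<open>Paths and cycles in outerplanar drawings\<close>

fun list_edges :: "'a list \<Rightarrow> 'a set set" where
  "list_edges (x # y # xs) = insert {x, y} (list_edges (y # xs))"
| "list_edges _ = {}"

lemma list_edges_subset: "e \<in> list_edges xs \<Longrightarrow> e \<subseteq> set xs"
  by (induction xs rule: list_edges.induct) auto

lemma list_edges_Cons: "xs \<noteq> [] \<Longrightarrow> list_edges (x # xs) = insert {x, hd xs} (list_edges xs)"
  by (cases xs) auto

lemma list_edges_append:
  "xs \<noteq> [] \<Longrightarrow> ys \<noteq> [] \<Longrightarrow>
    list_edges (xs @ ys) = list_edges xs \<union> {{last xs, hd ys}} \<union> list_edges ys"
  by (induction xs rule: list_edges.induct) (auto simp: list_edges_Cons)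

lemma list_edges_rev: "list_edges (rev xs) = list_edges xs"
proof (induction xs)
  case (Cons x xs)
  then show ?case
    by (cases "xs = []") (auto simp: list_edges_append list_edges_Cons last_rev insert_commute)
qed simp

lemma Union_list_edges: "length xs \<ge> 2 \<Longrightarrow> \<Union>(list_edges xs) = set xs"
proof (induction xs rule: list_edges.induct)
  case (1 x y xs)
  then show ?case by (cases xs) auto
qed auto

lemma list_edges_split: "list_edges (xs @ y # ys) = list_edges (xs @ [y]) \<union> list_edges (y # ys)"
  by (induction xs rule: list_edges.induct) auto

lemma list_edges_reverse: "list_edges (u # rev B @ [w]) = list_edges (w # B @ [u])"
  using list_edges_rev[of "w # B @ [u]"] by simp

locale outerplane_drawing =
  fixes V :: "'a set" and E :: "'a set set" and p :: "'a \<Rightarrow> complex"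
    and c :: "'a set \<Rightarrow> real \<Rightarrow> complex"
  assumes graph: "simple_graph V E" and drawing: "plane_drawing V E p c"
    and outer: "p ` V \<subseteq> frontier (outside (drawing_image V E p c))"
begin

lemma inj_p: "inj_on p V" and
  edge_arc: "e \<in> E \<Longrightarrow> arc (c e)" and
  edge_ends: "e \<in> E \<Longrightarrow> {pathstart (c e), pathfinish (c e)} = p ` e" and
  edge_vertices: "e \<in> E \<Longrightarrow> path_image (c e) \<inter> p ` V = p ` e" and
  edges_meet: "e \<in> E \<Longrightarrow> f \<in> E \<Longrightarrow> e \<noteq> f \<Longrightarrow> path_image (c e) \<inter> path_image (c f) \<subseteq> p ` (e \<inter> f)"
  using drawing by (auto simp: plane_drawing_def)

lemma edge_subset: "e \<in> E \<Longrightarrow> e \<subseteq> V"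
  using graph by (auto simp: simple_graph_def)

lemma edge_neq: "{x, y} \<in> E \<Longrightarrow> x \<noteq> y"
  using graph by (auto simp: simple_graph_def)

definition walk_image :: "'a list \<Rightarrow> complex set" where
  "walk_image xs = (\<Union>e\<in>list_edges xs. path_image (c e))"

definition is_path :: "'a list \<Rightarrow> bool" where
  "is_path xs \<longleftrightarrow> distinct xs \<and> set xs \<subseteq> V \<and> list_edges xs \<subseteq> E"

lemma edge_arc_between:
  assumes "{x, y} \<in> E"
  shows "\<exists>g. arc_between (p x) (p y) g \<and> path_image g = path_image (c {x, y})"
proof -
  have e: "{pathstart (c {x, y}), pathfinish (c {x, y})} = {p x, p y}"
    using edge_ends[OF assms] by simp
  have "p x \<noteq> p y"
    using edge_neq[OF assms] edge_subset[OF assms] inj_p by (auto simp: inj_on_def)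
  show ?thesis
  proof (cases "pathstart (c {x, y}) = p x")
    case True
    then have "pathfinish (c {x, y}) = p y" using e by (metis \<open>p x \<noteq> p y\<close> doubleton_eq_iff)
    then show ?thesis using True edge_arc[OF assms] unfolding arc_between_def by blast
  next
    case False
    then have "pathstart (c {x, y}) = p y" "pathfinish (c {x, y}) = p x"
      using e by (metis doubleton_eq_iff)+
    then show ?thesis using edge_arc[OF assms] 
      by (intro exI[of _ "reversepath (c {x, y})"]) (auto simp: arc_between_def arc_reversepath)
  qed
qed

lemma walk_images_meet:
  assumes "list_edges xs \<subseteq> E" "list_edges ys \<subseteq> E" "list_edges xs \<inter> list_edges ys = {}"
  shows "walk_image xs \<inter> walk_image ys \<subseteq> p ` (set xs \<inter> set ys)"
proof
  fix z assume "z \<in> walk_image xs \<inter> walk_image ys"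
  then obtain e f where ef: "e \<in> list_edges xs" "f \<in> list_edges ys"
    "z \<in> path_image (c e)" "z \<in> path_image (c f)"
    by (auto simp: walk_image_def)
  then have "z \<in> p ` (e \<inter> f)" using edges_meet[of e f] assms by blast
  then show "z \<in> p ` (set xs \<inter> set ys)" using list_edges_subset ef(1,2) by blast
qed

lemma walk_image_vertices:
  assumes "list_edges xs \<subseteq> E" "length xs \<ge> 2"
  shows "walk_image xs \<inter> p ` V = p ` set xs"
proof -
  have "walk_image xs \<inter> p ` V = (\<Union>e\<in>list_edges xs. path_image (c e) \<inter> p ` V)"
    by (auto simp: walk_image_def)
  also have "\<dots> = (\<Union>e\<in>list_edges xs. p ` e)"
    using assms(1) by (intro SUP_cong refl edge_vertices) auto
  also have "\<dots> = p ` set xs" using Union_list_edges[OF assms(2)] by blast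
  finally show ?thesis .
qed

lemma is_path_arc:
  assumes "is_path xs" "length xs \<ge> 2"
  shows "\<exists>g. arc_between (p (hd xs)) (p (last xs)) g \<and> path_image g = walk_image xs"
  using assms
proof (induction xs rule: list_edges.induct)
  case (1 x y xs)
  then have e: "{x, y} \<in> E" and d: "x \<notin> set (y # xs)" and sub: "list_edges (y # xs) \<subseteq> E"
    by (auto simp: is_path_def)
  obtain g where g: "arc_between (p x) (p y) g" "path_image g = path_image (c {x, y})"
    using edge_arc_between[OF e] by auto
  show ?case
  proof (cases xs)
    case Nil
    then show ?thesis using g by (intro exI[of _ g]) (auto simp: walk_image_def)
  next
    case (Cons z zs)
    have "is_path (y # xs)" "length (y # xs) \<ge> 2" using 1(2) Cons by (auto simp: is_path_def)
    then obtain h where h: "arc_between (p y) (p (last (y # xs))) h"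
      "path_image h = walk_image (y # xs)" using 1(1) by auto
    have "path_image g \<inter> path_image h \<subseteq> {p y}"
    proof -
      have "path_image g = walk_image [x, y]" using g by (simp add: walk_image_def)
      moreover have "{x, y} \<notin> list_edges (y # xs)" using d list_edges_subset by blast
      ultimately have "path_image g \<inter> path_image h \<subseteq> p ` ({x, y} \<inter> set (y # xs))"
        using walk_images_meet[of "[x, y]" "y # xs"] e sub h by simp
      then show ?thesis using d by auto
    qed
    then have "arc_between (p x) (p (last (y # xs))) (g +++ h)"
      using g h by (auto simp: arc_between_def intro!: arc_join)
    moreover have "path_image (g +++ h) = walk_image (x # y # xs)"
      using g h by (subst path_image_join) (auto simp: arc_between_def walk_image_def)
    ultimately show ?thesis by auto
  qed
qed auto

lemma walk_image_subset:
  assumes "list_edges xs \<subseteq> E" shows "walk_image xs \<subseteq> drawing_image V E p c"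
  using assms by (auto simp: walk_image_def drawing_image_def)

text \<open>The place where outerplanarity enters. A vertex is in the closure of the outer face, so
  an open set containing it meets the outer face, which is disjoint from the inside of every part of
  the drawing.\<close>

lemma vertex_not_inside:
  assumes "x \<in> V" "S \<subseteq> drawing_image V E p c" "closed S"
  shows "p x \<notin> inside S"
proof
  assume x: "p x \<in> inside S"
  have "p x \<in> closure (outside (drawing_image V E p c))"
    using outer assms(1) by (auto simp: frontier_def)
  moreover have "open (inside S)" using assms(3) by (rule open_inside)
  ultimately obtain y where "y \<in> inside S" "y \<in> outside (drawing_image V E p c)"
    using x open_Int_closure_eq_empty[of "inside S"] by blast
  then show False
    using outside_mono[OF assms(2)] inside_Int_outside[of S] by blast
qed

text \<open>\<open>A\<close> lists only the inner vertices. An edge is the case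
  \<open>A = []\<close>, so chords and longer paths share one theta argument.\<close>

definition joins :: "'a \<Rightarrow> 'a \<Rightarrow> 'a list \<Rightarrow> bool" where
  "joins u w A \<longleftrightarrow> is_path (u # A @ [w])"

lemma joins_arc:
  assumes "joins u w A"
  shows "\<exists>g. arc_between (p u) (p w) g \<and> path_image g = walk_image (u # A @ [w])"
  using is_path_arc[of "u # A @ [w]"] assms by (auto simp: joins_def)

text \<open>Every edge of a path with inner vertices contains one of them and therefore cannot
  belong to a path that avoids them. With both lists empty the two paths would be the same
  edge.\<close>

lemma joins_arcs_meet:
  assumes "joins u w A" "joins u w B" "set A \<inter> set B = {}" "A \<noteq> []"
  shows "walk_image (u # A @ [w]) \<inter> walk_image (u # B @ [w]) = {p u, p w}"
proof
  have A: "list_edges (u # A @ [w]) \<subseteq> E" "list_edges (u # B @ [w]) \<subseteq> E"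
    "distinct (u # A @ [w])" "distinct (u # B @ [w])"
    using assms by (auto simp: joins_def is_path_def)
  have uw: "\<not> e \<subseteq> {u, w}" if "e \<in> list_edges (u # A @ [w])" for e
  proof -
    have "list_edges (u # A @ [w]) = {{u, hd A}} \<union> (list_edges A \<union> {{last A, w}})"
      using assms(4) by (auto simp: list_edges_Cons list_edges_append)
    moreover have "e \<noteq> {}" if "e \<in> list_edges A" for e
      using that A by (auto dest!: edge_ends simp: list_edges_Cons list_edges_append assms(4)) 
    moreover have "u \<notin> set A" "w \<notin> set A" "hd A \<in> set A" "last A \<in> set A"
      using A assms(4) by auto
    ultimately show ?thesis using that list_edges_subset[of e A] by blast
  qed
  have "list_edges (u # A @ [w]) \<inter> list_edges (u # B @ [w]) = {}"
  proof (rule ccontr)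
    assume "\<not> ?thesis"
    then obtain e where e: "e \<in> list_edges (u # A @ [w])" "e \<in> list_edges (u # B @ [w])" by auto
    then have "e \<subseteq> set (u # A @ [w]) \<inter> set (u # B @ [w])"
      using list_edges_subset by blast
    also have "\<dots> \<subseteq> {u, w}" using assms(3) by auto
    finally show False using uw[OF e(1)] by auto
  qed
  then have "walk_image (u # A @ [w]) \<inter> walk_image (u # B @ [w])
      \<subseteq> p ` (set (u # A @ [w]) \<inter> set (u # B @ [w]))"
    using walk_images_meet A by metis
  also have "\<dots> \<subseteq> {p u, p w}" using assms(3) by auto
  finally show "walk_image (u # A @ [w]) \<inter> walk_image (u # B @ [w]) \<subseteq> {p u, p w}" .
  show "{p u, p w} \<subseteq> walk_image (u # A @ [w]) \<inter> walk_image (u # B @ [w])"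
    using walk_image_vertices[OF A(1)] walk_image_vertices[OF A(2)] by auto
qed

text \<open>The arcs of \<open>A\<close> and \<open>B\<close> carry vertices, which cannot lie
  inside a cycle, so neither is the enclosed arc of the theta. Hence the arc of \<open>C\<close> is,
  and for the same reason it carries no inner vertex. This yields both the absence of three parallel
  paths and the position of chords.\<close>

lemma ear_inside:
  assumes j: "joins u w A" "joins u w B" "joins u w C"
    and ne: "A \<noteq> []" "B \<noteq> []"
    and d: "set A \<inter> set B = {}" "set A \<inter> set C = {}" "set B \<inter> set C = {}"
  shows "C = [] \<and> walk_image (u # C @ [w]) - {p u, p w}
    \<subseteq> inside (walk_image (u # A @ [w]) \<union> walk_image (u # B @ [w]))"
proof -
  let ?W = "\<lambda>A. walk_image (u # A @ [w])"
  obtain f g h where f: "arc_between (p u) (p w) f" "path_image f = ?W A"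
    and g: "arc_between (p u) (p w) g" "path_image g = ?W B"
    and h: "arc_between (p u) (p w) h" "path_image h = ?W C"
    using j[THEN joins_arc] by blast
  have I: "?W A \<inter> ?W B = {p u, p w}" "?W A \<inter> ?W C = {p u, p w}" "?W B \<inter> ?W C = {p u, p w}"
    using joins_arcs_meet j ne d by auto
  have sub: "?W A \<subseteq> drawing_image V E p c" "?W B \<subseteq> drawing_image V E p c" 
    "?W C \<subseteq> drawing_image V E p c"
    using walk_image_subset j by (auto simp: joins_def is_path_def)
  have cl: "closed (?W A)" "closed (?W B)" "closed (?W C)"
    using f g h by (metis arc_between_def arc_imp_path closed_path_image)+
  have no: "path_image k' \<inter> inside S = {}"
    if k: "joins u w K" "K \<noteq> []" "arc_between (p u) (p w) k'" "path_image k' = ?W K"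
      and S: "S = path_image s \<union> path_image t" "S \<subseteq> drawing_image V E p c" "closed S"
        "path_image s \<inter> path_image k' \<subseteq> {p u, p w}" "path_image t \<inter> path_image k' \<subseteq> {p u, p w}"
        "{p u, p w} \<subseteq> path_image s" for K k' s t S
  proof (rule ccontr)
    assume "\<not> ?thesis"
    then have *: "path_image k' - {p u, p w} \<subseteq> inside S"
      using theta_arc_subset_inside[OF k(3) S(4,5) _ S(6)] S(1) by auto
    have K: "hd K \<in> V" "hd K \<noteq> u" "hd K \<noteq> w" "u \<in> V" "w \<in> V"
      "list_edges (u # K @ [w]) \<subseteq> E" "hd K \<in> set (u # K @ [w])"
      using k(1,2) by (auto simp: joins_def is_path_def)
    then have "p (hd K) \<in> ?W K" using walk_image_vertices[OF K(6)] by auto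
    moreover have "p (hd K) \<noteq> p u" "p (hd K) \<noteq> p w"
      using K inj_p by (auto simp: inj_on_def)
    ultimately have "p (hd K) \<in> inside S" using * k(4) by auto
    then show False using vertex_not_inside[OF K(1) S(2,3)] by simp
  qed
  have nA: "path_image f \<inter> inside (path_image g \<union> path_image h) = {}"
    by (rule no[OF j(1) ne(1) f refl, where s = g and t = h])
      (use I sub cl f g h in auto)
  have nB: "path_image g \<inter> inside (path_image f \<union> path_image h) = {}"
    by (rule no[OF j(2) ne(2) g refl, where s = f and t = h])
      (use I sub cl f g h in auto)
  have meet: "path_image h \<inter> inside (path_image f \<union> path_image g) \<noteq> {}"
    by (rule theta_one_arc_inside[OF f(1) g(1) h(1)]) (use I f g h nA nB in auto)
  have "C = []"
  proof (rule ccontr)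
    assume "C \<noteq> []"
    have "path_image h \<inter> inside (path_image f \<union> path_image g) = {}"
      by (rule no[OF j(3) \<open>C \<noteq> []\<close> h refl, where s = f and t = g])
        (use I sub cl f g h in auto)
    then show False using meet by auto
  qed
  moreover have "path_image h - {p u, p w} \<subseteq> inside (path_image f \<union> path_image g)"
    by (rule theta_arc_subset_inside[OF h(1) _ _ meet]) (use I f g h in auto)
  ultimately show ?thesis using f g h by auto
qed

text \<open>Both chords run inside the same cycle, and the one from \<open>u\<close> to
  \<open>w\<close> cuts this inside in two. The other chord is disjoint from it and stays in one
  half; its end on the opposite side of the cycle would be a limit of that half without lying on its
  boundary, so it would be a vertex inside a cycle.\<close>

lemma no_crossing_chords:
  assumes d: "distinct (u # A1 @ s # A2 @ w # B1 @ t # B2)"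
    and V: "set (u # A1 @ s # A2 @ w # B1 @ t # B2) \<subseteq> V"
    and cyc: "list_edges (u # A1 @ s # A2 @ w # B1 @ t # B2 @ [u]) \<subseteq> E"
    and uw: "{u, w} \<in> E" and st: "{s, t} \<in> E"
  shows False
proof -
  let ?P1 = "list_edges (u # A1 @ [s])" and ?P2 = "list_edges (s # A2 @ [w])"
    and ?P3 = "list_edges (w # B1 @ [t])" and ?P4 = "list_edges (t # B2 @ [u])"
  have cyc': "list_edges (u # A1 @ s # A2 @ w # B1 @ t # B2 @ [u]) = ?P1 \<union> ?P2 \<union> ?P3 \<union> ?P4"
    using list_edges_split[of "u # A1" s "A2 @ w # B1 @ t # B2 @ [u]"]
      list_edges_split[of "s # A2" w "B1 @ t # B2 @ [u]"]
      list_edges_split[of "w # B1" t "B2 @ [u]"] by auto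
  have eA: "list_edges (u # (A1 @ s # A2) @ [w]) = ?P1 \<union> ?P2"
    using list_edges_split[of "u # A1" s "A2 @ [w]"] by simp
  have eB: "list_edges (u # rev (B1 @ t # B2) @ [w]) = ?P3 \<union> ?P4"
    unfolding list_edges_reverse using list_edges_split[of "w # B1" t "B2 @ [u]"] by simp
  have eC: "list_edges (s # (A2 @ w # B1) @ [t]) = ?P2 \<union> ?P3"
    using list_edges_split[of "s # A2" w "B1 @ [t]"] by simp
  have eD: "list_edges (s # rev (B2 @ u # A1) @ [t]) = ?P4 \<union> ?P1"
    unfolding list_edges_reverse using list_edges_split[of "t # B2" u "A1 @ [s]"] by simp
  have sub: "?P1 \<subseteq> E" "?P2 \<subseteq> E" "?P3 \<subseteq> E" "?P4 \<subseteq> E" using cyc cyc' by auto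
  let ?W = "\<lambda>u A w. walk_image (u # A @ [w])"
  let ?A = "A1 @ s # A2" and ?B = "rev (B1 @ t # B2)" and ?C = "A2 @ w # B1" and ?D = "rev (B2 @ u # A1)"
  have jA: "joins u w ?A" unfolding joins_def is_path_def eA using d V sub by auto
  have jB: "joins u w ?B" unfolding joins_def is_path_def eB using d V sub by auto
  have juw: "joins u w []" using uw d V by (auto simp: joins_def is_path_def)
  have jC: "joins s t ?C" unfolding joins_def is_path_def eC using d V sub by auto
  have jD: "joins s t ?D" unfolding joins_def is_path_def eD using d V sub by auto
  have jst: "joins s t []" using st d V by (auto simp: joins_def is_path_def)
  have dAB: "set ?A \<inter> set ?B = {}" using d by auto
  have dCD: "set ?C \<inter> set ?D = {}" using d by auto
  have in1: "?W u [] w - {p u, p w} \<subseteq> inside (?W u ?A w \<union> ?W u ?B w)"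
    using ear_inside[OF jA jB juw _ _ dAB] by auto
  have in2: "?W s [] t - {p s, p t} \<subseteq> inside (?W s ?C t \<union> ?W s ?D t)"
    using ear_inside[OF jC jD jst _ _ dCD] by auto
  \<comment> \<open>Each of the two pairs of vertices splits the same cycle into two paths, and
    \<open>inside\<close> depends only on their union.\<close>
  have same: "?W u ?A w \<union> ?W u ?B w = ?W s ?C t \<union> ?W s ?D t"
    unfolding walk_image_def eA eB eC eD by blast
  obtain f g h k where f: "arc_between (p u) (p w) f" "path_image f = ?W u ?A w"
    and g: "arc_between (p u) (p w) g" "path_image g = ?W u ?B w"
    and h: "arc_between (p u) (p w) h" "path_image h = ?W u [] w"
    and k: "arc_between (p s) (p t) k" "path_image k = ?W s [] t"
    using joins_arc[OF jA] joins_arc[OF jB] joins_arc[OF juw] joins_arc[OF jst] by auto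
  let ?F = "path_image f" and ?G = "path_image g" and ?H = "path_image h"
  let ?K = "path_image k - {p s, p t}"
  have I: "?F \<inter> ?G = {p u, p w}" "?F \<inter> ?H = {p u, p w}" "?G \<inter> ?H = {p u, p w}"
    unfolding f(2) g(2) h(2)
    by (rule joins_arcs_meet[OF jA jB dAB] joins_arcs_meet[OF jA juw] joins_arcs_meet[OF jB juw]; simp)+
  have Hin: "?H \<inter> inside (?F \<union> ?G) \<noteq> {}"
  proof -
    have "infinite ?H"
      using arc_between_distinct[OF h(1)] h(1) unfolding arc_between_def
      by (metis arc_imp_path connected_finite_iff_sing connected_path_image empty_iff insert_iff
          pathfinish_in_path_image pathstart_in_path_image)
    then have "?H - {p u, p w} \<noteq> {}" by (metis finite.emptyI finite_Diff2 finite_insert)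
    then obtain x where "x \<in> ?H - {p u, p w}" by blast
    then have "x \<in> ?H" "x \<in> inside (?F \<union> ?G)" using in1 f(2) g(2) h(2) by auto
    then show ?thesis by blast
  qed
  have sp: "simple_path f" "simple_path g" "simple_path h" "p u \<noteq> p w"
    using f(1) g(1) h(1) arc_between_distinct[OF f(1)] by (simp_all add: arc_between_def arc_imp_simple_path)
  obtain split: "inside (?F \<union> ?H) \<inter> inside (?G \<union> ?H) = {}"
    "inside (?F \<union> ?H) \<union> inside (?G \<union> ?H) \<union> (?H - {p u, p w}) = inside (?F \<union> ?G)"
    using split_inside_simple_closed_curve[of f "p u" "p w" g h, OF sp(1) _ _ sp(2) _ _ sp(3) _ _ sp(4) I Hin]
      f(1) g(1) h(1) by (metis arc_between_def)
  have HK: "?H \<inter> path_image k = {}"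
  proof -
    have "{u, w} \<noteq> {s, t}" "{u, w} \<inter> {s, t} = {}" using d by auto
    then have "path_image (c {u, w}) \<inter> path_image (c {s, t}) \<subseteq> {}"
      using edges_meet[OF uw st] by auto
    then show ?thesis using h k by (simp add: walk_image_def)
  qed
  have Kin: "?K \<subseteq> inside (?F \<union> ?H) \<union> inside (?G \<union> ?H)"
  proof -
    have "?K \<subseteq> inside (?F \<union> ?G)" using in2 same f g k by simp
    then show ?thesis using split(2) HK by blast
  qed
  have Kc: "connected ?K"
    using k(1) connected_simple_path_endless[of k] by (auto simp: arc_between_def arc_imp_simple_path)
  have stk: "p s \<in> path_image k" "p t \<in> path_image k"
    using k(1) unfolding arc_between_def by (metis pathstart_in_path_image pathfinish_in_path_image)+
  \<comment> \<open>A connected set with more than one point has no isolated points, so the removed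
    ends are still limits of the rest of the arc.\<close>
  have pK: "x \<in> closure ?K" if "x \<in> path_image k" for x
  proof -
    have "connected (path_image k)" using k(1) by (simp add: arc_between_def connected_arc_image)
    moreover have "p s \<noteq> p t" "p s \<in> path_image k" "p t \<in> path_image k"
      using arc_between_distinct[OF k(1)] stk by auto
    ultimately have "x islimpt path_image k"
      using that by (intro connected_imp_perfect) auto
    moreover have "path_image k \<subseteq> {p s, p t} \<union> ?K" by auto
    ultimately have "x islimpt ({p s, p t} \<union> ?K)" using islimpt_subset by blast
    then have "x islimpt ?K" by (subst (asm) islimpt_Un_finite) auto
    then show ?thesis by (simp add: closure_def)
  qed
  have sub': "?F \<subseteq> drawing_image V E p c" "?G \<subseteq> drawing_image V E p c" "?H \<subseteq> drawing_image V E p c"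
    using walk_image_subset jA jB juw f g h by (auto simp: joins_def is_path_def)
  have cl: "closed ?F" "closed ?G" "closed ?H"
    using f(1) g(1) h(1) by (simp_all add: arc_between_def arc_imp_path closed_path_image)
  have notin: "p x \<notin> walk_image ys" if "x \<in> V" "x \<notin> set ys" "list_edges ys \<subseteq> E" "2 \<le> length ys" for x ys
  proof -
    have "set ys \<subseteq> V" using Union_list_edges[OF that(4)] that(3) edge_subset by blast
    then have "p x \<notin> p ` set ys" using inj_on_image_mem_iff[OF inj_p that(1)] that(2) by blast
    then show ?thesis using walk_image_vertices[OF that(3,4)] that(1) by blast
  qed
  have no: False if X: "X = ?F \<or> X = ?G" and KX: "?K \<subseteq> inside (X \<union> ?H)"
    and fr: "frontier (inside (X \<union> ?H)) = X \<union> ?H" and x: "x = s \<and> X = ?G \<or> x = t \<and> X = ?F" for X x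
  proof -
    have "p x \<in> closure (inside (X \<union> ?H))" using closure_mono[OF KX] pK[OF stk(1)] pK[OF stk(2)] x by blast
    moreover have "p x \<notin> X \<union> ?H"
      using x
    proof
      assume x: "x = s \<and> X = ?G"
      then have "p x \<notin> ?G" unfolding g(2) using d V jB by (intro notin) (auto simp: joins_def is_path_def)
      moreover have "p x \<notin> ?H" unfolding h(2) using x d V juw by (intro notin) (auto simp: joins_def is_path_def)
      ultimately show ?thesis using x by simp
    next
      assume x: "x = t \<and> X = ?F"
      then have "p x \<notin> ?F" unfolding f(2) using d V jA by (intro notin) (auto simp: joins_def is_path_def)
      moreover have "p x \<notin> ?H" unfolding h(2) using x d V juw by (intro notin) (auto simp: joins_def is_path_def)
      ultimately show ?thesis using x by simp
    qed
    moreover have "p x \<notin> inside (X \<union> ?H)"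
      using X sub' cl x V by (intro vertex_not_inside) auto
    ultimately show False using fr closure_Un_frontier by blast
  qed
  note JF = two_arcs_Jordan[OF f(1) h(1) I(2)] and JG = two_arcs_Jordan[OF g(1) h(1) I(3)]
  have "?K \<subseteq> inside (?F \<union> ?H) \<or> ?K \<subseteq> inside (?G \<union> ?H)"
  proof (rule ccontr)
    assume "\<not> ?thesis"
    then have "inside (?F \<union> ?H) \<inter> ?K \<noteq> {}" "inside (?G \<union> ?H) \<inter> ?K \<noteq> {}" using Kin by auto
    moreover have "inside (?F \<union> ?H) \<inter> inside (?G \<union> ?H) \<inter> ?K = {}" using split(1) by auto
    ultimately show False using connectedD[OF Kc JF(2) JG(2)] Kin by metis
  qed
  then show False
  proof
    assume "?K \<subseteq> inside (?F \<union> ?H)"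
    then show False using no[of ?F t] JF(4) by auto
  next
    assume "?K \<subseteq> inside (?G \<union> ?H)"
    then show False using no[of ?G s] JG(4) by auto
  qed
qed

end

section \<open>Circular orders without crossing edges\<close>

text \<open>Two chords of a circle cross exactly when their ends alternate, so this is a circular
  notion although it is stated for a list. Subsequences, rather than positions, make it easy to
  restrict it to a part of the vertices.\<close>

definition crossing_free :: "'a set set \<Rightarrow> 'a list \<Rightarrow> bool" where
  "crossing_free E xs \<longleftrightarrow>
     (\<forall>a b c d. subseq [a, b, c, d] xs \<longrightarrow> \<not> ({a, c} \<in> E \<and> {b, d} \<in> E))"

lemma distinct_subseq:
  assumes "subseq xs ys" "distinct ys" shows "distinct xs"
proof -
  obtain N where "xs = nths ys N" using assms(1) by (auto simp: subseq_conv_nths)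
  then show ?thesis using assms(2) by (simp add: distinct_nthsI)
qed

lemma set_subseq: "subseq xs ys \<Longrightarrow> set xs \<subseteq> set ys"
  using set_nths_subset by (force simp: subseq_conv_nths)

lemma subseq_append_cases4:
  assumes "subseq [a, b, c, d] (xs @ ys)"
  obtains "subseq [a, b, c, d] ys" | "subseq [a] xs" "subseq [b, c, d] ys"
    | "subseq [a, b] xs" "subseq [c, d] ys" | "subseq [a, b, c] xs" "subseq [d] ys"
    | "subseq [a, b, c, d] xs"
proof -
  obtain zs ws where "[a, b, c, d] = zs @ ws" "subseq zs xs" "subseq ws ys"
    using assms by (auto simp: subseq_append_iff)
  then show ?thesis using that by (auto simp: Cons_eq_append_conv)
qed

text \<open>Rotating a quadruple keeps or exchanges the pair of its first and third and the pair of
  its second and fourth entries.\<close>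

lemma crossing_free_rotate:
  assumes "crossing_free E (xs @ ys)" shows "crossing_free E (ys @ xs)"
  unfolding crossing_free_def
proof (intro allI impI)
  fix a b c d assume s: "subseq [a, b, c, d] (ys @ xs)"
  have nc: "\<not> ({a, c} \<in> E \<and> {b, d} \<in> E)"
    if "subseq (us @ vs) (xs @ ys)" "(us @ vs) \<in> {[a, b, c, d], [b, c, d, a], [c, d, a, b], [d, a, b, c]}"
    for us vs
  proof -
    have X: "{x, z} \<notin> E \<or> {y, w} \<notin> E" if "subseq [x, y, z, w] (xs @ ys)" for x y z w
      using assms that unfolding crossing_free_def by blast
    show ?thesis
      using that X[of a b c d] X[of b c d a] X[of c d a b] X[of d a b c] by (auto simp: insert_commute)
  qed
  show "\<not> ({a, c} \<in> E \<and> {b, d} \<in> E)"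
    using s
  proof (cases rule: subseq_append_cases4)
    case 1 show ?thesis by (rule nc[of "[a, b, c, d]" "[]"]) (use 1 in \<open>auto intro: subseq_drop_many\<close>)
  next
    case 2 show ?thesis by (rule nc[of "[b, c, d]" "[a]", OF list_emb_append_mono]) (use 2 in auto)
  next
    case 3 show ?thesis by (rule nc[of "[c, d]" "[a, b]", OF list_emb_append_mono]) (use 3 in auto)
  next
    case 4 show ?thesis by (rule nc[of "[d]" "[a, b, c]", OF list_emb_append_mono]) (use 4 in auto)
  next
    case 5 show ?thesis by (rule nc[of "[]" "[a, b, c, d]", OF list_emb_append_mono]) (use 5 in auto)
  qed
qed

lemma subseq_pair_order:
  assumes "subseq [x, y] (h @ xs @ ys)" "distinct (h @ xs @ ys)" "length h \<le> 1"
  shows "y \<notin> set h" "x \<in> set ys \<Longrightarrow> y \<notin> set xs"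
proof -
  obtain us vs where uv: "h @ xs @ ys = us @ x # vs" "subseq [y] vs"
    using list_emb_ConsD[OF assms(1)] by auto
  then have y: "y \<in> set vs" by (simp add: subseq_singleton_left)
  have d: "distinct (us @ x # vs)" using assms(2) uv(1) by simp
  show "y \<notin> set h"
  proof
    assume "y \<in> set h"
    then have "h = [y]" using assms(3) by (cases h) auto
    then show False using uv(1) y d by (cases us) auto
  qed
  show "y \<notin> set xs" if x: "x \<in> set ys"
  proof
    assume "y \<in> set xs"
    obtain zs ws where "ys = zs @ x # ws" using split_list[OF x] by blast
    then have "(h @ xs @ zs) @ x # ws = us @ x # vs" using uv(1) by simp
    moreover have "distinct ((h @ xs @ zs) @ x # ws)" using calculation d by simp
    ultimately have "us = h @ xs @ zs" using d append_Cons_eq_iff[of x us vs "h @ xs @ zs" ws] by (simp del: append_assoc)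
    then show False using d y \<open>y \<in> set xs\<close> by auto
  qed
qed

text \<open>Here \<open>h\<close> holds the cut vertex, if there is one. Two edges of one part cross
  only if they already cross in the order of that part. Edges of different parts cannot alternate:
  \<open>h\<close> comes first and is never a later end, and all of \<open>xs\<close> precedes all
  of \<open>ys\<close>.\<close>

lemma crossing_free_glue:
  assumes cf: "crossing_free E (h @ xs)" "crossing_free E (h @ ys)"
    and h: "length h \<le> 1" and d: "distinct (h @ xs @ ys)"
    and E: "\<And>a b. {a, b} \<in> E \<Longrightarrow> a \<noteq> b \<Longrightarrow> {a, b} \<subseteq> set (h @ xs @ ys) \<Longrightarrow>
      {a, b} \<subseteq> set (h @ xs) \<or> {a, b} \<subseteq> set (h @ ys)"
  shows "crossing_free E (h @ xs @ ys)"
  unfolding crossing_free_def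
proof (intro allI impI notI, elim conjE)
  fix a b c e assume s: "subseq [a, b, c, e] (h @ xs @ ys)" and ac: "{a, c} \<in> E" and be: "{b, e} \<in> E"
  let ?X = "set (h @ xs)" and ?Y = "set (h @ ys)"
  have dist: "distinct [a, b, c, e]" by (rule distinct_subseq[OF s d])
  have mem: "{a, b, c, e} \<subseteq> set (h @ xs @ ys)" using set_subseq[OF s] by simp
  have pair: "y \<notin> set h \<and> (x \<in> set ys \<longrightarrow> y \<notin> set xs)" if "subseq [x, y] [a, b, c, e]" for x y
    using subseq_pair_order[OF subseq_order.trans[OF that s] d h] by blast
  have fX: "filter (\<lambda>z. z \<in> ?X) (h @ xs @ ys) = h @ xs"
    using d by (auto simp: filter_id_conv filter_empty_conv)
  have fY: "filter (\<lambda>z. z \<in> ?Y) (h @ xs @ ys) = h @ ys"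
    using d by (auto simp: filter_id_conv filter_empty_conv)
  consider "{a, c} \<subseteq> ?X" "{b, e} \<subseteq> ?X" | "{a, c} \<subseteq> ?Y" "{b, e} \<subseteq> ?Y"
    | "{a, c} \<subseteq> ?X" "{b, e} \<subseteq> ?Y" | "{a, c} \<subseteq> ?Y" "{b, e} \<subseteq> ?X"
  proof -
    have "{a, c} \<subseteq> ?X \<or> {a, c} \<subseteq> ?Y" by (rule E[OF ac]) (use dist mem in auto)
    moreover have "{b, e} \<subseteq> ?X \<or> {b, e} \<subseteq> ?Y" by (rule E[OF be]) (use dist mem in auto)
    ultimately show ?thesis using that by blast
  qed
  then show False
  proof cases
    case 1
    then have "subseq [a, b, c, e] (h @ xs)"
      using subseq_filter[OF s, of "\<lambda>z. z \<in> ?X"] fX by simp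
    then show False using cf(1) ac be unfolding crossing_free_def by blast
  next
    case 2
    then have "subseq [a, b, c, e] (h @ ys)"
      using subseq_filter[OF s, of "\<lambda>z. z \<in> ?Y"] fY by simp
    then show False using cf(2) ac be unfolding crossing_free_def by blast
  next
    case 3
    then show False
      using pair[of a c] pair[of b c] pair[of a b] dist by auto
  next
    case 4
    then show False
      using pair[of a e] pair[of c e] pair[of a c] dist by auto
  qed
qed


section \<open>Longest cycles and the existence of the order\<close>

context outerplane_drawing
begin

text \<open>One vertex or one edge counts as a cycle too, so every nonempty vertex set contains a
  cycle and the maximality argument also covers bridges.\<close>

definition is_cycle :: "'a list \<Rightarrow> bool" where
  "is_cycle ys \<longleftrightarrow> ys \<noteq> [] \<and> distinct ys \<and> set ys \<subseteq> V \<and>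
     (2 \<le> length ys \<longrightarrow> list_edges (ys @ [hd ys]) \<subseteq> E)"

lemma is_cycle_rotate:
  assumes "is_cycle (xs @ ys)" shows "is_cycle (ys @ xs)"
proof (cases "xs = [] \<or> ys = []")
  case False
  then have "list_edges ((xs @ ys) @ [hd (xs @ ys)]) = list_edges ((ys @ xs) @ [hd (ys @ xs)])"
    by (auto simp: list_edges_append)
  then show ?thesis using assms by (auto simp: is_cycle_def)
qed (use assms in auto)

lemma is_cycle_crossing_free:
  assumes "is_cycle ys" shows "crossing_free E ys"
  unfolding crossing_free_def
proof (intro allI impI notI, elim conjE)
  fix a b c d assume s: "subseq [a, b, c, d] ys" and E: "{a, c} \<in> E" "{b, d} \<in> E"
  obtain X R1 where 1: "ys = X @ a # R1" "subseq [b, c, d] R1"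
    using list_emb_ConsD[OF s] by auto
  obtain A1 R2 where 2: "R1 = A1 @ b # R2" "subseq [c, d] R2"
    using list_emb_ConsD[OF 1(2)] by auto
  obtain A2 R3 where 3: "R2 = A2 @ c # R3" "subseq [d] R3"
    using list_emb_ConsD[OF 2(2)] by auto
  obtain B1 B2 where 4: "R3 = B1 @ d # B2"
    using list_emb_ConsD[OF 3(2)] by auto
  have "is_cycle ((a # A1 @ b # A2 @ c # B1 @ d # B2) @ X)"
    by (rule is_cycle_rotate) (use assms 1(1) 2(1) 3(1) 4 in simp)
  then have *: "distinct (a # A1 @ b # A2 @ c # B1 @ d # (B2 @ X))"
    "set (a # A1 @ b # A2 @ c # B1 @ d # (B2 @ X)) \<subseteq> V"
    "list_edges (a # A1 @ b # A2 @ c # B1 @ d # (B2 @ X) @ [a]) \<subseteq> E"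
    by (auto simp: is_cycle_def)
  show False by (rule no_crossing_chords[OF * E])
qed

text \<open>If \<open>u\<close> and \<open>w\<close> are neighbours on the cycle, \<open>Q\<close>
  replaces the edge between them. Otherwise \<open>Q\<close> and both arcs of the cycle are three
  parallel paths with inner vertices, which \<open>ear_inside\<close> forbids.\<close>

lemma longer_cycle:
  assumes cyc: "is_cycle (u # A @ w # B)" and Q: "Q \<noteq> []" "distinct Q" "set Q \<subseteq> V"
    "set Q \<inter> set (u # A @ w # B) = {}" "list_edges (u # Q @ [w]) \<subseteq> E"
  shows "\<exists>ys. is_cycle ys \<and> length ys > length (u # A @ w # B) \<and>
    set ys \<subseteq> set (u # A @ w # B) \<union> set Q"
proof -
  have e: "list_edges (u # A @ w # B @ [u]) \<subseteq> E" using cyc by (auto simp: is_cycle_def)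
  have e1: "list_edges (u # A @ w # B @ [u]) = list_edges (u # A @ [w]) \<union> list_edges (w # B @ [u])"
    using list_edges_split[of "u # A" w "B @ [u]"] by simp
  have e2: "list_edges (u # Q @ w # B @ [u]) = list_edges (u # Q @ [w]) \<union> list_edges (w # B @ [u])"
    using list_edges_split[of "u # Q" w "B @ [u]"] by simp
  have e3: "list_edges (u # A @ w # rev Q @ [u]) = list_edges (u # A @ [w]) \<union> list_edges (u # Q @ [w])"
    using list_edges_split[of "u # A" w "rev Q @ [u]"] list_edges_reverse[of w Q u] by simp
  consider "A = []" | "B = []" | "A \<noteq> []" "B \<noteq> []" by blast
  then show ?thesis
  proof cases
    case 1
    have "is_cycle (u # Q @ w # B)"
      unfolding is_cycle_def using cyc Q e e1 e2 by (auto simp: is_cycle_def)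
    then show ?thesis using 1 Q(1) by (intro exI[of _ "u # Q @ w # B"]) auto
  next
    case 2
    have "is_cycle (u # A @ w # rev Q)"
      unfolding is_cycle_def using cyc Q e e1 e3 by (auto simp: is_cycle_def)
    then show ?thesis using 2 Q(1) by (intro exI[of _ "u # A @ w # rev Q"]) auto
  next
    case 3
    have "joins u w A" "joins u w Q" using cyc Q e e1 by (auto simp: is_cycle_def joins_def is_path_def)
    moreover have "joins u w (rev B)"
      using cyc e e1 by (auto simp: is_cycle_def joins_def is_path_def list_edges_reverse)
    ultimately have "Q = []"
      using ear_inside[of u w A "rev B" Q] 3 cyc Q(4) by (auto simp: is_cycle_def)
    then show ?thesis using Q(1) by simp
  qed
qed

lemma path_in_subset:
  assumes "(x, y) \<in> {(a, b). b \<in> U \<and> {a, b} \<in> E}\<^sup>*" "x \<in> U"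
  shows "\<exists>Q. Q \<noteq> [] \<and> hd Q = x \<and> last Q = y \<and> distinct Q \<and> set Q \<subseteq> U \<and> list_edges Q \<subseteq> E"
  using assms(1)
proof (induction rule: rtrancl_induct)
  case base
  then show ?case using assms(2) by (intro exI[of _ "[x]"]) auto
next
  case (step y z)
  then obtain Q where Q: "Q \<noteq> []" "hd Q = x" "last Q = y" "distinct Q" "set Q \<subseteq> U" "list_edges Q \<subseteq> E"
    by auto
  show ?case
  proof (cases "z \<in> set Q")
    case True
    then obtain Q1 Q2 where "Q = Q1 @ z # Q2" by (meson split_list)
    then show ?thesis using Q list_edges_split[of Q1 z Q2]
      by (intro exI[of _ "Q1 @ [z]"]) (auto simp: hd_append split: if_splits)
  next
    case False
    then show ?thesis using Q step(2) by (intro exI[of _ "Q @ [z]"]) (auto simp: list_edges_append)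
  qed
qed

text \<open>If a longest cycle in \<open>W\<close> misses some \<open>x\<close>, the component
  \<open>K\<close> of \<open>x\<close> off the cycle is attached to it by at most one vertex. So
  \<open>W\<close> splits into \<open>K \<union> N\<close> and \<open>W - K\<close>, which overlap
  in \<open>N\<close> only; both are proper subsets, and their orders are rotated to start with
  \<open>N\<close> and glued.\<close>

lemma ex_crossing_free_order:
  assumes "W \<subseteq> V" shows "\<exists>xs. distinct xs \<and> set xs = W \<and> crossing_free E xs"
proof -
  have fin: "finite W" using assms graph finite_subset by (auto simp: simple_graph_def)
  then show ?thesis using assms
  proof (induction W rule: finite_psubset_induct)
    case (psubset W)
    show ?case
    proof (cases "W = {}")
      case True
      then show ?thesis by (auto simp: crossing_free_def)
    next
      case False
      then obtain x0 where x0: "x0 \<in> W" by auto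
      define P where "P ys \<longleftrightarrow> is_cycle ys \<and> set ys \<subseteq> W" for ys
      have P0: "P [x0]" using x0 psubset.prems by (auto simp: P_def is_cycle_def)
      have Pb: "\<forall>ys. P ys \<longrightarrow> length ys < Suc (card W)"
      proof (intro allI impI)
        fix ys assume "P ys"
        then have "length ys = card (set ys)" "set ys \<subseteq> W" 
          by (auto simp: P_def is_cycle_def distinct_card)
        then show "length ys < Suc (card W)" using card_mono[OF psubset.hyps, of "set ys"] by simp
      qed
      obtain ys where ys: "P ys" and max: "\<And>zs. P zs \<Longrightarrow> length zs \<le> length ys"
        using ex_has_greatest_nat[OF P0 Pb] by blast
      have cyc: "is_cycle ys" "set ys \<subseteq> W" using ys by (auto simp: P_def)
      show ?thesis
      proof (cases "set ys = W")
        case True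
        then show ?thesis using cyc is_cycle_crossing_free by (auto simp: is_cycle_def)
      next
        case ysW: False
        then obtain x where x: "x \<in> W - set ys" using cyc by auto
        define r where "r = {(a, b). b \<in> W - set ys \<and> {a, b} \<in> E}"
        define K where "K = {y. (x, y) \<in> r\<^sup>*}"
        define N where "N = {u \<in> set ys. \<exists>z\<in>K. {u, z} \<in> E}"
        have KW: "K \<subseteq> W - set ys"
        proof
          fix y assume "y \<in> K"
          then have "(x, y) \<in> r\<^sup>*" by (simp add: K_def)
          then show "y \<in> W - set ys"
            by cases (use x in \<open>auto simp: r_def\<close>)
        qed
        \<comment> \<open>Two attachment vertices would be joined by a path through
          \<open>K\<close>, and this detour would give a longer cycle.\<close>
        have N1: "u = w" if uw: "u \<in> N" "w \<in> N" for u w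
        proof (rule ccontr)
          assume "u \<noteq> w"
          obtain z1 z2 where z: "z1 \<in> K" "{u, z1} \<in> E" "z2 \<in> K" "{w, z2} \<in> E"
            using uw by (auto simp: N_def)
          have "(y, x) \<in> r\<^sup>*" if "(x, y) \<in> r\<^sup>*" for y
            using that
          proof (induction rule: rtrancl_induct)
            case (step y z)
            then have "y \<in> K" by (auto simp: K_def)
            then have "(z, y) \<in> r" using step(2) KW by (auto simp: r_def insert_commute)
            then show ?case using step(3) by (rule converse_rtrancl_into_rtrancl)
          qed simp
          then have "(z1, z2) \<in> r\<^sup>*" using z(1,3) by (auto simp: K_def intro: rtrancl_trans)
          then obtain Q where Q: "Q \<noteq> []" "hd Q = z1" "last Q = z2" "distinct Q"
            "set Q \<subseteq> W - set ys" "list_edges Q \<subseteq> E"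
            using path_in_subset[of z1 z2 "W - set ys"] z(1) KW unfolding r_def by blast
          obtain X Y where "ys = X @ u # Y" using uw by (auto simp: N_def dest: split_list)
          then have cyc': "is_cycle (u # Y @ X)" "set (u # Y @ X) = set ys" 
            "length (u # Y @ X) = length ys"
            using is_cycle_rotate[of X "u # Y"] cyc by auto
          have "w \<in> set (Y @ X)" using uw \<open>u \<noteq> w\<close> cyc'(2) by (auto simp: N_def)
          then obtain A B where AB: "Y @ X = A @ w # B" by (meson split_list)
          have "list_edges (u # Q @ [w]) \<subseteq> E"
            using Q z by (auto simp: list_edges_Cons list_edges_append insert_commute)
          then obtain zs where "is_cycle zs" "length zs > length ys" "set zs \<subseteq> set ys \<union> set Q"
          proof -
            have "set Q \<subseteq> V" "set Q \<inter> set (u # A @ w # B) = {}"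
              using Q(5) psubset.prems cyc'(2) unfolding AB by auto
            then show ?thesis
              using longer_cycle[of u A w B Q] \<open>list_edges (u # Q @ [w]) \<subseteq> E\<close> Q(1,4) cyc' that
              unfolding AB by metis
          qed
          then show False using max[of zs] Q(5) cyc(2) by (auto simp: P_def)
        qed
        obtain h where h: "set h = N" "length h \<le> 1"
        proof (cases "N = {}")
          case True
          then show ?thesis using that[of "[]"] by auto
        next
          case False
          then obtain u where "N = {u}" using N1 by blast
          then show ?thesis using that[of "[u]"] by auto
        qed
        have dh: "distinct h" using h(2) by (cases h) auto
        have split: "{a, b} \<subseteq> K \<union> N \<or> {a, b} \<subseteq> W - K" if "{a, b} \<in> E" "{a, b} \<subseteq> W" for a b
        proof -
          have "b \<in> K \<union> N" if "a \<in> K" "{a, b} \<in> E" "b \<in> W" for a b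
          proof (cases "b \<in> set ys")
            case True
            then show ?thesis using that by (auto simp: N_def insert_commute)
          next
            case False
            then have "(a, b) \<in> r" using that by (auto simp: r_def)
            then show ?thesis using that(1) by (auto simp: K_def)
          qed
          from this[of a b] this[of b a] that show ?thesis by (auto simp: insert_commute)
        qed
        have NW: "N \<subseteq> W" "N \<inter> K = {}" using cyc(2) KW by (auto simp: N_def)
        have "x \<in> K" by (auto simp: K_def)
        \<comment> \<open>Otherwise the whole cycle is the single vertex of \<open>N\<close>, and
          its edge into \<open>K\<close> would be a longer cycle.\<close>
        have ne: "K \<union> N \<noteq> W"
        proof
          assume KN: "K \<union> N = W"
          then have "set ys \<subseteq> N" using KW cyc(2) by auto
          moreover obtain u where u: "u \<in> set ys" using cyc(1) by (metis is_cycle_def hd_in_set)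
          ultimately have u: "set ys = {u}" "u \<in> N" using N1 by auto
          then obtain z where z: "z \<in> K" "{u, z} \<in> E" by (auto simp: N_def)
          have "length ys = 1" using u cyc(1) by (metis One_nat_def card.empty card_insert_disjoint
              distinct_card empty_iff finite.emptyI is_cycle_def)
          moreover have "P [u, z]"
            using z u KW cyc(2) psubset.prems edge_neq[OF z(2)]
            by (auto simp: P_def is_cycle_def insert_commute)
          ultimately show False using max[of "[u, z]"] by simp
        qed
        obtain xs1 where xs1: "distinct xs1" "set xs1 = K \<union> N" "crossing_free E xs1"
        proof -
          have "K \<union> N \<subset> W" using KW NW ne by blast
          then show ?thesis using psubset.IH[of "K \<union> N"] psubset.prems that by auto
        qed
        obtain xs2 where xs2: "distinct xs2" "set xs2 = W - K" "crossing_free E xs2"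
        proof -
          have "W - K \<subset> W" using \<open>x \<in> K\<close> x by blast
          then show ?thesis using psubset.IH[of "W - K"] psubset.prems that by auto
        qed
        have rot: "\<exists>rs. distinct (h @ rs) \<and> set (h @ rs) = set xs \<and> crossing_free E (h @ rs)"
          if "distinct xs" "N \<subseteq> set xs" "crossing_free E xs" for xs
        proof (cases h)
          case Nil
          then show ?thesis using that by (intro exI[of _ xs]) auto
        next
          case (Cons u t)
          then have "h = [u]" using h(2) by simp
          moreover have "u \<in> set xs" using h that \<open>h = [u]\<close> by auto
          moreover obtain X Y where "xs = X @ u # Y" using \<open>u \<in> set xs\<close> by (meson split_list)
          ultimately show ?thesis using that crossing_free_rotate[of E X "u # Y"]
            by (intro exI[of _ "Y @ X"]) auto
        qed
        obtain rs1 where rs1: "distinct (h @ rs1)" "set (h @ rs1) = K \<union> N" "crossing_free E (h @ rs1)"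
          using rot[of xs1] xs1 by auto
        obtain rs2 where rs2: "distinct (h @ rs2)" "set (h @ rs2) = W - K" "crossing_free E (h @ rs2)"
          using rot[of xs2] xs2 NW by auto
        have "set rs1 = K" using rs1 h NW by auto
        moreover have "set rs2 \<inter> K = {}" using rs2 by auto
        ultimately have d: "distinct (h @ rs1 @ rs2)" using rs1 rs2 by auto
        have s: "set (h @ rs1 @ rs2) = W" using rs1(2) rs2(2) KW NW by auto
        have "crossing_free E (h @ rs1 @ rs2)"
        proof (rule crossing_free_glue[OF rs1(3) rs2(3) h(2) d])
          fix a b assume "{a, b} \<in> E" "{a, b} \<subseteq> set (h @ rs1 @ rs2)"
          then show "{a, b} \<subseteq> set (h @ rs1) \<or> {a, b} \<subseteq> set (h @ rs2)"
            using split[of a b] unfolding s rs1(2) rs2(2) by simp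
        qed
        then show ?thesis using d s by blast
      qed
    qed
  qed
qed

end

section \<open>Breadth-first coordinates\<close>

text \<open>The circular order is cut open to a line, whose first vertex \<open>0\<close> is the
  root. The edges between successive numbers make every vertex reachable from it.\<close>

locale noncrossing_path_graph =
  fixes N :: nat and adj :: "nat \<Rightarrow> nat \<Rightarrow> bool"
  assumes adj_sym: "adj i j \<Longrightarrow> adj j i"
    and adj_irrefl: "\<not> adj i i"
    and adj_le: "adj i j \<Longrightarrow> i \<le> N \<and> j \<le> N"
    and adj_Suc: "j < N \<Longrightarrow> adj j (Suc j)"
    and noncrossing: "a < b \<Longrightarrow> b < c \<Longrightarrow> c < e \<Longrightarrow> adj a c \<Longrightarrow> \<not> adj b e"
begin

section \<open>Breadth-first layers and parents\<close>

fun walk :: "nat \<Rightarrow> nat \<Rightarrow> bool" where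
  "walk 0 v \<longleftrightarrow> v = 0"
| "walk (Suc k) v \<longleftrightarrow> (\<exists>u. walk k u \<and> adj u v)"

definition depth :: "nat \<Rightarrow> nat" where "depth v = (LEAST k. walk k v)"

definition parent :: "nat \<Rightarrow> nat \<Rightarrow> bool" where
  "parent u v \<longleftrightarrow> adj u v \<and> depth v = Suc (depth u)"

lemma walk_self: "v \<le> N \<Longrightarrow> walk v v"
  by (induction v) (use adj_Suc in \<open>auto simp: Suc_le_eq intro: exI\<close>)

lemma walk_depth: "v \<le> N \<Longrightarrow> walk (depth v) v"
  unfolding depth_def using walk_self by (rule LeastI)

lemma depth_le: "walk k v \<Longrightarrow> depth v \<le> k"
  unfolding depth_def by (rule Least_le)

lemma depth_0 [simp]: "depth 0 = 0"
  using depth_le[of 0 0] by simp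

lemma depth_eq_0: "v \<le> N \<Longrightarrow> depth v = 0 \<longleftrightarrow> v = 0"
  using walk_depth[of v] by auto

lemma depth_adj: "adj u v \<Longrightarrow> depth v \<le> Suc (depth u)"
  using walk_depth[of u] adj_le[of u v] by (intro depth_le) auto

lemma depth_adj_cases:
  assumes "adj u v" obtains "depth u = depth v" | "parent u v" | "parent v u"
  using depth_adj[OF assms] depth_adj[OF adj_sym[OF assms]] assms adj_sym[OF assms]
  unfolding parent_def by linarith

lemma ex_parent:
  assumes "v \<le> N" "v \<noteq> 0" shows "\<exists>u. parent u v"
proof -
  obtain k where k: "depth v = Suc k" using depth_eq_0 assms by (metis not0_implies_Suc)
  then obtain u where u: "walk k u" "adj u v" using walk_depth[OF assms(1)] by auto
  then have "depth u = k" using depth_le[OF u(1)] depth_adj[OF u(2)] k by simp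
  then show ?thesis using u(2) k by (auto simp: parent_def)
qed

lemma parent_le: "parent u v \<Longrightarrow> u \<le> N \<and> v \<le> N"
  using adj_le by (auto simp: parent_def)

lemma parent_neq: "parent u v \<Longrightarrow> depth w = depth u \<Longrightarrow> w \<noteq> v"
  by (auto simp: parent_def)

text \<open>A shortest path from a vertex below an edge to the root \<open>0\<close> leaves through an end of the edge.\<close>

lemma depth_below_edge:
  assumes "adj x v" "x < y" "y < v" shows "min (depth x) (depth v) < depth y"
  using assms(2,3)
proof (induction "depth y" arbitrary: y rule: less_induct)
  case less
  have yN: "y \<le> N" using adj_le[OF assms(1)] less.prems by auto
  obtain z where z: "parent z y" using ex_parent[OF yN] less.prems by auto
  have zy: "adj z y" "adj y z" "depth y = Suc (depth z)" 
    using z adj_sym by (auto simp: parent_def)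
  have "x \<le> z"
  proof (rule ccontr)
    assume "\<not> x \<le> z"
    then show False using noncrossing[of z x y v] less.prems zy assms(1) by auto
  qed
  moreover have "z \<le> v"
  proof (rule ccontr)
    assume "\<not> z \<le> v"
    then show False using noncrossing[of x y v z] less.prems zy assms(1) by auto
  qed
  ultimately consider "z = x" | "z = v" | "x < z" "z < v" by linarith
  then show ?case
  proof cases
    case 3
    then show ?thesis using less.hyps[of z] zy by auto
  qed (use zy in auto)
qed

lemma depth_between_parent:
  assumes "parent u v" "u < y \<and> y < v \<or> v < y \<and> y < u" shows "depth u < depth y"
  using assms(2)
proof
  assume "u < y \<and> y < v"
  then show ?thesis using depth_below_edge[of u v y] assms(1) by (auto simp: parent_def)
next
  assume "v < y \<and> y < u"
  then show ?thesis using depth_below_edge[of v u y] assms(1) adj_sym by (auto simp: parent_def)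
qed

text \<open>A vertex between a parent and its child is deeper than the parent. If the parents came
  in the opposite order, one of them would lie between the other and its child, or the two edges
  would cross.\<close>

lemma parent_mono:
  assumes p: "parent u v" "parent u' v'" and d: "depth u = depth u'" and v: "v < v'"
  shows "u \<le> u'"
proof (rule ccontr)
  assume "\<not> u \<le> u'"
  then have less: "u' < u" by simp
  have n: "u' \<noteq> v" "u \<noteq> v" "u \<noteq> v'" using parent_neq p d by auto
  have adj: "adj u' v'" "adj v u" using p adj_sym by (auto simp: parent_def)
  show False
  proof (cases "v < u")
    case True
    have "u' < v" using depth_between_parent[OF p(1), of u'] less d n by linarith
    moreover have "v' < u"
      using depth_between_parent[OF p(2), of u] less d n calculation v by linarith
    ultimately show False using noncrossing[of u' v v' u] adj v by simp
  next
    case False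
    then show False using depth_between_parent[OF p(2), of u] less d n v by linarith
  qed
qed

text \<open>The nearer of two parents on one side would lie below the edge to the farther one,
  although it has the same depth. So a vertex has at most one parent on each side.\<close>

lemma parent_below_unique:
  assumes "parent u v" "parent u' v" "u < v \<and> u' < v \<or> v < u \<and> v < u'" shows "u = u'"
proof -
  have "depth u = depth u'" using assms(1,2) by (auto simp: parent_def)
  then show ?thesis
    using depth_between_parent[OF assms(1), of u'] depth_between_parent[OF assms(2), of u] assms(3)
    by linarith
qed

text \<open>A later child \<open>y\<close> of \<open>u\<close> either puts \<open>u1\<close> between
  \<open>u\<close> and \<open>y\<close>, or precedes \<open>u1\<close>, and then its edge from
  \<open>u\<close> crosses the edge from \<open>v\<close> to \<open>u1\<close>. This is what allows
  a shared child to sit at the end of the window.\<close>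

lemma shared_last:
  assumes "parent u v" "u < v" "parent u1 v" "v < u1" "parent u y" shows "y \<le> v"
proof (rule ccontr)
  assume "\<not> y \<le> v"
  then have y: "v < y" by simp
  have d: "depth u = depth u1" using assms by (auto simp: parent_def)
  have "u1 \<noteq> y" using parent_neq[OF assms(5), of u1] d by auto
  moreover have "\<not> u1 < y" using depth_between_parent[OF assms(5), of u1] assms d by auto
  ultimately have "y < u1" by simp
  then show False using noncrossing[of u v y u1] assms y adj_sym by (auto simp: parent_def)
qed

lemma shared_first:
  assumes "parent u v" "u < v" "parent u1 v" "v < u1" "parent u1 y" shows "v \<le> y"
proof (rule ccontr)
  assume "\<not> v \<le> y"
  then have y: "y < v" by simp
  have d: "depth u = depth u1" using assms by (auto simp: parent_def)
  have "u \<noteq> y" using parent_neq[OF assms(5), of u] d by auto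
  moreover have "\<not> y < u" using depth_between_parent[OF assms(5), of u] assms d by auto
  ultimately have "u < y" by simp
  then show False using noncrossing[of u y v u1] assms y adj_sym by (auto simp: parent_def)
qed

section \<open>Integer coordinates for the layers\<close>

text \<open>There are at most \<open>N + 1\<close> children, so an offset is at most
  \<open>2 * (N + 1) + 1 = M - 7\<close>. The slack keeps the children on the two sides of a vertex
  apart near the centre of its window, and \<open>10 \<le> M\<close> is what the walls need.\<close>

definition M :: int where "M = 2 * int N + 10"

definition shared_right :: "nat \<Rightarrow> bool" where
  "shared_right u \<longleftrightarrow> (\<exists>y u1. parent u y \<and> u < y \<and> parent u1 y \<and> y < u1)"

definition shared_left :: "nat \<Rightarrow> bool" where
  "shared_left u \<longleftrightarrow> (\<exists>y u1. parent u y \<and> y < u \<and> parent u1 y \<and> u1 < y)"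

text \<open>The distance from the upper end of the window. Among the children to the right of
  \<open>u\<close> it is \<open>0\<close> exactly for one shared with a vertex further right.
  Without such a child the last one has offset \<open>1\<close>, and so has the first one at the
  lower end of the next window, which again makes a gap of \<open>2\<close>.\<close>

definition right_offset :: "nat \<Rightarrow> nat \<Rightarrow> int" where
  "right_offset u v = 2 * int (card {y. parent u y \<and> v < y}) + 1 - of_bool (shared_right u)"

definition left_offset :: "nat \<Rightarrow> nat \<Rightarrow> int" where
  "left_offset u v = 2 * int (card {y. parent u y \<and> y < v}) + 1 - of_bool (shared_left u)"

text \<open>The children of \<open>u\<close> occupy the window of radius \<open>M\<close> around \<open>M\<close> times the coordinate of \<open>u\<close>:
  those to the right of \<open>u\<close> are packed with gaps \<open>2\<close> against its upper end, those to the left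
  against its lower end, and a child shared with the next vertex of the layer lies on the common
  end of the two windows.\<close>

fun layer_coord :: "nat \<Rightarrow> nat \<Rightarrow> int" where
  "layer_coord 0 v = 4"
| "layer_coord (Suc k) v =
    (if \<exists>u<v. parent u v
     then (let u = (SOME u. u < v \<and> parent u v) in M * layer_coord k u + M - right_offset u v)
     else (let u = (SOME u. parent u v) in M * layer_coord k u - M + left_offset u v))"

definition coord :: "nat \<Rightarrow> int" where "coord v = layer_coord (depth v) v"

lemma coord_right:
  assumes "parent u v" "u < v" shows "coord v = M * coord u + M - right_offset u v"
proof -
  have "(SOME u. u < v \<and> parent u v) = u"
    using assms parent_below_unique by (intro some_equality) auto
  then show ?thesis using assms by (auto simp: coord_def parent_def)
qed

lemma coord_left:
  assumes "parent u v" "\<And>w. parent w v \<Longrightarrow> v < w"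
  shows "coord v = M * coord u - M + left_offset u v"
proof -
  have "(SOME u. parent u v) = u"
    using assms parent_below_unique by (intro some_equality) auto
  moreover have "\<not> (\<exists>u<v. parent u v)" using assms(2) by (meson not_less_iff_gr_or_eq)
  ultimately show ?thesis using assms(1) by (auto simp: coord_def parent_def)
qed

text \<open>A child with parents on both sides is always attributed to the left one; the second case
  is for vertices all of whose parents come later.\<close>

lemma vertex_cases:
  assumes "v \<le> N" "depth v = Suc k"
  obtains (right) u where "parent u v" "u < v" "depth u = k"
      "coord v = M * coord u + M - right_offset u v"
    | (left) u where "parent u v" "v < u" "depth u = k" "\<And>w. parent w v \<Longrightarrow> v < w"
      "coord v = M * coord u - M + left_offset u v"
proof (cases "\<exists>u<v. parent u v")
  case True
  then show ?thesis using right coord_right assms(2) by (auto simp: parent_def)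
next
  case False
  have "v \<noteq> 0" using assms(2) depth_0 by (metis nat.distinct(1))
  then obtain u where u: "parent u v" using ex_parent assms(1) by auto
  have *: "v < w" if "parent w v" for w
    using False that parent_neq[OF that, of w] by (metis linorder_neqE_nat)
  show ?thesis using left[OF u *[OF u] _ *] coord_left[OF u *] u assms(2) by (auto simp: parent_def)
qed

lemma finite_children [simp]: "finite {y. parent u y \<and> P y}"
  by (rule finite_subset[of _ "{..N}"]) (auto dest: parent_le)

lemma offset_bounds:
  "0 \<le> right_offset u v" "right_offset u v \<le> M - 7" "0 \<le> left_offset u v" "left_offset u v \<le> M - 7"
proof -
  have "card {y. parent u y \<and> P y} \<le> card {..N}" for P
    by (rule card_mono) (auto dest: parent_le)
  then have *: "int (card {y. parent u y \<and> P y}) \<le> int N + 1" for P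
    by (metis card_atMost of_nat_Suc of_nat_le_iff add.commute)
  show "0 \<le> right_offset u v" "right_offset u v \<le> M - 7" "0 \<le> left_offset u v" "left_offset u v \<le> M - 7"
    using *[of "\<lambda>y. v < y"] *[of "\<lambda>y. y < v"]
    by (auto simp: right_offset_def left_offset_def M_def of_bool_def)
qed

lemma right_offset_shared:
  assumes "parent u v" "u < v" "parent u1 v" "v < u1"
  shows "right_offset u v = 0"
proof -
  have "{y. parent u y \<and> v < y} = {}" using shared_last[OF assms] by (auto simp: not_less)
  moreover have "shared_right u" using assms by (auto simp: shared_right_def)
  ultimately show ?thesis by (simp add: right_offset_def)
qed

text \<open>Offset \<open>0\<close> means that \<open>v\<close> is the last child of
  \<open>u\<close> and that \<open>u\<close> shares some child with a later vertex; such a child is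
  always the last one, so it is \<open>v\<close>.\<close>

lemma right_offset_eq_0:
  assumes "parent u v" "u < v" "right_offset u v = 0"
  shows "\<exists>u1. parent u1 v \<and> v < u1"
proof -
  have c: "card {y. parent u y \<and> v < y} = 0" and "shared_right u"
    using assms(3) by (auto simp: right_offset_def of_bool_def split: if_splits)
  then obtain y u1 where y: "parent u y" "u < y" "parent u1 y" "y < u1"
    by (auto simp: shared_right_def)
  have "{y. parent u y \<and> v < y} = {}" using c by simp
  then have "y \<le> v" using y(1) by (auto simp: not_less)
  moreover have "v \<le> y" using shared_last[OF y assms(1)] .
  ultimately show ?thesis using y by auto
qed

text \<open>A child of \<open>u\<close> shared with an earlier vertex is attributed to that vertex.
  It takes offset \<open>0\<close> at the lower end, so the children considered here start at
  \<open>2\<close> in its presence and at \<open>1\<close> otherwise.\<close>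

lemma left_offset_pos:
  assumes "parent u v" "v < u" "\<And>w. parent w v \<Longrightarrow> v < w"
  shows "1 \<le> left_offset u v" "shared_left u \<Longrightarrow> 2 \<le> left_offset u v"
proof -
  have *: "1 \<le> card {y. parent u y \<and> y < v}" if "shared_left u"
  proof -
    obtain y u1 where y: "parent u y" "y < u" "parent u1 y" "u1 < y"
      using \<open>shared_left u\<close> by (auto simp: shared_left_def)
    have "y \<le> v" using shared_first[OF y(3,4,1,2) assms(1)] .
    moreover have "y \<noteq> v" using y assms(3) by force
    ultimately have "y \<in> {y. parent u y \<and> y < v}" using y by auto
    then show ?thesis by (metis One_nat_def Suc_leI card_gt_0_iff empty_iff finite_children)
  qed
  show "1 \<le> left_offset u v" using * by (cases "shared_left u") (auto simp: left_offset_def)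
  show "shared_left u \<Longrightarrow> 2 \<le> left_offset u v" using * by (auto simp: left_offset_def)
qed

lemma right_offset_less:
  assumes "parent u v'" "v < v'" shows "right_offset u v' + 2 \<le> right_offset u v"
proof -
  have "card {y. parent u y \<and> v' < y} < card {y. parent u y \<and> v < y}"
    using assms by (intro psubset_card_mono) auto
  then show ?thesis by (simp add: right_offset_def)
qed

lemma left_offset_less:
  assumes "parent u v" "v < v'" shows "left_offset u v + 2 \<le> left_offset u v'"
proof -
  have "card {y. parent u y \<and> y < v} < card {y. parent u y \<and> y < v'}"
    using assms by (intro psubset_card_mono) auto
  then show ?thesis by (simp add: left_offset_def)
qed

lemma M_ge: "10 \<le> M" by (simp add: M_def)

lemma M_mult_mono: "a + b \<le> c \<Longrightarrow> M * a + M * b \<le> M * c"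
  using mult_left_mono[of "a + b" c M] M_ge by (simp add: distrib_left)

text \<open>Parents at distance at least \<open>2\<close> have windows that meet at most in an end,
  so the critical case is a right child of \<open>u\<close> followed by a left child of
  \<open>u'\<close>. The two offsets then add up to at least \<open>2\<close>, unless the first
  child is shared with a vertex strictly between \<open>u\<close> and \<open>u'\<close>, whose own
  window lies in between.\<close>

lemma coord_gap:
  "v < v' \<Longrightarrow> v' \<le> N \<Longrightarrow> depth v = k \<Longrightarrow> depth v' = k \<Longrightarrow> coord v + 2 \<le> coord v'"
proof (induction k arbitrary: v v')
  case 0
  then show ?case using depth_eq_0 by simp
next
  case (Suc k)
  have vN: "v \<le> N" using Suc.prems by simp
  have gap: "2 * M \<le> M * coord u' - M * coord u" 
    if "u < u'" "u' \<le> N" "depth u = k" "depth u' = k" for u u'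
    using M_mult_mono[OF Suc.IH[OF that]] by (simp add: algebra_simps)
  note b = offset_bounds M_ge
  show ?case
  proof (cases rule: vertex_cases[OF vN Suc.prems(3), case_names right left])
    case v: (right u)
    show ?thesis
    proof (cases rule: vertex_cases[OF Suc.prems(2,4), case_names right left])
      case v': (right u')
      have "u \<le> u'" using parent_mono[OF v(1) v'(1) _ Suc.prems(1)] v(3) v'(3) by simp
      then consider "u = u'" | "u < u'" by linarith
      then show ?thesis
      proof cases
        case 1
        then show ?thesis using right_offset_less[OF v'(1) Suc.prems(1)] v v' by simp
      next
        case 2
        then show ?thesis
          using gap[of u u'] b(1)[of u v] b(2)[of u' v'] M_ge v v' parent_le[OF v'(1)] by linarith
      qed
    next
      case v': (left u')
      have le: "u \<le> u'" using parent_mono[OF v(1) v'(1) _ Suc.prems(1)] v(3) v'(3) by simp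
      moreover have "u \<noteq> u'" using v(2) v'(2) Suc.prems(1) by linarith
      ultimately have g: "2 * M \<le> M * coord u' - M * coord u"
        using gap[of u u'] v v' parent_le[OF v'(1)] by auto
      note l = left_offset_pos[OF v'(1,2,4)]
      show ?thesis
      proof (cases "right_offset u v = 0")
        case True
        then obtain u1 where u1: "parent u1 v" "v < u1" using right_offset_eq_0 v by auto
        have d1: "depth u1 = k" using u1 v by (auto simp: parent_def)
        have "u1 \<le> u'" using parent_mono[OF u1(1) v'(1)] d1 v' Suc.prems by auto
        then consider "u1 = u'" | "u1 < u'" by linarith
        then show ?thesis
        proof cases
          case 1
          then have "shared_left u'" using u1 v by (auto simp: shared_left_def)
          then show ?thesis using l g v(4) v'(5) b(1)[of u v] by linarith
        next
          case 2
          have "2 * M \<le> M * coord u1 - M * coord u" using gap[of u u1] v u1 d1 parent_le[OF u1(1)] by auto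
          moreover have "2 * M \<le> M * coord u' - M * coord u1"
            using gap[of u1 u'] 2 v' d1 parent_le[OF v'(1)] by auto
          ultimately show ?thesis using v(4) v'(5) b(1)[of u v] b(3)[of u' v'] M_ge True by linarith
        qed
      next
        case False
        then show ?thesis using l g v(4) v'(5) b(1)[of u v] by linarith
      qed
    qed
  next
    case v: (left u)
    show ?thesis
    proof (cases rule: vertex_cases[OF Suc.prems(2,4), case_names right left])
      case v': (right u')
      have "u \<le> u'" using parent_mono[OF v(1) v'(1) _ Suc.prems(1)] v(3) v'(3) by simp
      then have "u = u' \<or> 2 * M \<le> M * coord u' - M * coord u"
        using gap[of u u'] v(3) v'(3) parent_le[OF v'(1)] by (metis le_neq_implies_less)
      then show ?thesis using v(5) v'(4) b(4)[of u v] b(2)[of u' v'] M_ge by auto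
    next
      case v': (left u')
      have "u \<le> u'" using parent_mono[OF v(1) v'(1) _ Suc.prems(1)] v(3) v'(3) by simp
      then consider "u = u'" | "u < u'" by linarith
      then show ?thesis
      proof cases
        case 1
        then show ?thesis using left_offset_less[OF v(1) Suc.prems(1)] v(5) v'(5) by simp
      next
        case 2
        then show ?thesis
          using gap[of u u'] b(4)[of u v] b(3)[of u' v'] M_ge v v' parent_le[OF v'(1)] by linarith
      qed
    qed
  qed
qed

lemma right_offset_Suc:
  assumes "parent u v'" "v < v'" "\<And>y. v < y \<Longrightarrow> y < v' \<Longrightarrow> \<not> parent u y"
  shows "right_offset u v = right_offset u v' + 2"
proof -
  have "{y. parent u y \<and> v < y} = insert v' {y. parent u y \<and> v' < y}"
    using assms by (auto simp: not_less_iff_gr_or_eq) (meson linorder_neqE_nat)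
  then show ?thesis by (simp add: right_offset_def)
qed

lemma left_offset_Suc:
  assumes "parent u v" "v < v'" "\<And>y. v < y \<Longrightarrow> y < v' \<Longrightarrow> \<not> parent u y"
  shows "left_offset u v' = left_offset u v + 2"
proof -
  have "{y. parent u y \<and> y < v'} = insert v {y. parent u y \<and> y < v}"
    using assms by auto (meson linorder_neqE_nat)
  then show ?thesis by (simp add: left_offset_def)
qed

text \<open>Needed for shared children: their windows touch only if the parents are at distance
  exactly \<open>2\<close>. The condition that everything in between is deeper passes from children
  to distinct parents. Children of one parent have offsets differing by \<open>2\<close>; for
  distinct parents the offsets at the common end add up to \<open>2\<close>.\<close>

lemma coord_gap_eq:
  "v < v' \<Longrightarrow> v' \<le> N \<Longrightarrow> depth v = k \<Longrightarrow> depth v' = k \<Longrightarrow>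
    (\<And>y. v < y \<Longrightarrow> y < v' \<Longrightarrow> k < depth y) \<Longrightarrow> coord v' = coord v + 2"
proof (induction k arbitrary: v v')
  case 0
  then show ?case using depth_eq_0 by simp
next
  case (Suc k)
  have vN: "v \<le> N" using Suc.prems by simp
  have nb: "w \<le> v \<or> v' \<le> w" if "depth w \<le> Suc k" for w
    using Suc.prems(5)[of w] that by (meson not_le)
  have nc: "\<not> parent w y" if "v < y" "y < v'" "depth w = k" for w y
    using Suc.prems(5)[of y] that by (auto simp: parent_def)
  have out: "w \<notin> {v, v'}" if "depth w = k" for w
    using that Suc.prems(3,4) by (metis insertE n_not_Suc_n singletonD)
  show ?case
  proof (cases rule: vertex_cases[OF vN Suc.prems(3), case_names right left])
    case v: (right u)
    show ?thesis
    proof (cases rule: vertex_cases[OF Suc.prems(2,4), case_names right left])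
      case v': (right u')
      have "u' < v" using nb[of u'] out[of u'] v' by auto
      then have "u = u'"
        using depth_between_parent[OF v(1), of u'] depth_between_parent[OF v'(1), of u] v v' Suc.prems(1)
        by linarith
      then show ?thesis
        using right_offset_Suc[OF _ Suc.prems(1) nc, of u] v v' by simp
    next
      case v': (left u')
      have uu: "u < v" "v < v'" "v' < u'" using v v' Suc.prems by auto
      have adj: "adj u v" "adj v' u'" using v(1) v'(1) adj_sym by (auto simp: parent_def)
      have lay: "k < depth y" if "u < y" "y < u'" for y
      proof -
        consider "y < v" | "y = v" | "v < y" "y < v'" | "y = v'" | "v' < y" by linarith
        then show ?thesis
          using depth_between_parent[OF v(1), of y] depth_between_parent[OF v'(1), of y] that
            Suc.prems(3,4) Suc.prems(5)[of y] v(3) v'(3) by cases auto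
      qed
      have "coord u' = coord u + 2"
        using Suc.IH[of u u'] uu lay v v' parent_le[OF v'(1)] by auto
      then have "M * coord u' = M * coord u + 2 * M" by (simp add: distrib_left)
      \<comment> \<open>Either \<open>v\<close> is also a child of \<open>u'\<close> and the offsets
        are \<open>0\<close> and \<open>2\<close>, or no child is shared at this end and both are
        \<open>1\<close>.\<close>
      moreover have "right_offset u v + left_offset u' v' = 2"
      proof -
        have c: "\<not> parent u y" if "v < y" for y
        proof
          assume y: "parent u y"
          have "v' \<le> y" using nc[OF that _ v(3)] y by (meson not_le)
          moreover have "y \<noteq> v'" using y v'(4)[of u] uu by auto
          ultimately have "v' < y" by simp
          moreover have "y < u'"
          proof (rule ccontr)
            assume "\<not> y < u'"
            moreover have "y \<noteq> u'" using parent_neq[OF y, of u'] v(3) v'(3) by metis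
            ultimately have "u' < y" by simp
            then show False using depth_between_parent[OF y, of u'] uu v(3) v'(3) by simp
          qed
          ultimately show False using noncrossing[of u v' y u'] uu y adj by (auto simp: parent_def)
        qed
        have c': "y = v" if y: "parent u' y" "y < v'" for y
        proof (rule ccontr)
          assume "y \<noteq> v"
          then have "y < v" using nc[OF _ y(2) v'(3)] y(1) by (meson linorder_neqE_nat)
          moreover have "u < y"
          proof (rule ccontr)
            assume "\<not> u < y"
            moreover have "y \<noteq> u" using parent_neq[OF y(1), of u] v(3) v'(3) by metis
            ultimately have "y < u" by simp
            then show False using depth_between_parent[OF y(1), of u] uu v(3) v'(3) by simp
          qed
          ultimately show False using noncrossing[of u y v u'] uu y adj adj_sym by (auto simp: parent_def)
        qed
        have r0: "{y. parent u y \<and> v < y} = {}" using c by auto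
        show ?thesis
        proof (cases "parent u' v")
          case True
          then have "{y. parent u' y \<and> y < v'} = {v}" using True uu(2) by (intro set_eqI iffI) (auto dest: c')
          moreover have "shared_right u" "shared_left u'"
            using True v(1) uu unfolding shared_right_def shared_left_def by (blast intro: less_trans)+
          ultimately show ?thesis using r0 by (simp add: right_offset_def left_offset_def)
        next
          case False
          then have l0: "{y. parent u' y \<and> y < v'} = {}" using False by (auto dest: c')
          have "\<not> shared_right u"
          proof
            assume "shared_right u"
            then obtain y u1 where y: "parent u y" "u < y" "parent u1 y" "y < u1"
              by (auto simp: shared_right_def)
            have d1: "depth u1 = k" using y v by (auto simp: parent_def)
            have "v = y" using shared_last[OF y v(1)] c[of y] y(1) by (meson le_antisym not_le)
            then have "u' < u1" using nb[of u1] out[OF d1] d1 y False lay[of u1] uu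
              by (metis less_irrefl linorder_neqE_nat less_trans)
            then show False using depth_between_parent[OF y(3), of u'] \<open>v = y\<close> uu d1 v' by auto
          qed
          moreover have "\<not> shared_left u'"
          proof
            assume "shared_left u'"
            then obtain y u1 where y: "parent u' y" "y < u'" "parent u1 y" "u1 < y"
              by (auto simp: shared_left_def)
            have "y \<le> v'" using shared_first[OF y(3,4,1,2) v'(1)] .
            moreover have "y \<noteq> v'" using v'(4)[of u1] y by auto
            ultimately show False using c'[of y] y False by auto
          qed
          ultimately show ?thesis unfolding right_offset_def left_offset_def r0 l0 by simp
        qed
      qed
      ultimately show ?thesis using v(4) v'(5) by linarith
    qed
  next
    case v: (left u)
    have "v' < u" using nb[of u] out[of u] v by auto
    show ?thesis
    proof (cases rule: vertex_cases[OF Suc.prems(2,4), case_names right left])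
      case v': (right u')
      have "u' < v" using nb[of u'] out[of u'] v' by auto
      then show ?thesis
        using parent_mono[OF v(1) v'(1)] v v' Suc.prems by auto
    next
      case v': (left u')
      have "u = u'"
        using depth_between_parent[OF v(1), of u'] depth_between_parent[OF v'(1), of u] v v' Suc.prems(1)
          \<open>v' < u\<close> by linarith
      then show ?thesis
        using left_offset_Suc[OF v(1) Suc.prems(1) nc] v v' by simp
    qed
  qed
qed

text \<open>For the parent that defines \<open>coord v\<close> this is the bound on the offset. A
  second parent has a coordinate larger by exactly \<open>2\<close>, and the child, having offset
  \<open>0\<close>, lies on the common end of the two windows.\<close>

lemma coord_parent:
  assumes "parent u v" shows "\<bar>coord v - M * coord u\<bar> \<le> M"
proof -
  have vN: "v \<le> N" "depth v = Suc (depth u)" using assms parent_le by (auto simp: parent_def)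
  note b = offset_bounds M_ge
  show ?thesis
  proof (cases rule: vertex_cases[OF vN, case_names right left])
    case v: (right w)
    show ?thesis
    proof (cases "u < v")
      case True
      then have "w = u" using parent_below_unique v assms by auto
      then show ?thesis using v(4) b(1)[of u v] b(2)[of u v] M_ge by auto
    next
      case False
      then have "v < u" using parent_neq[OF assms, of u] by auto
      then have r: "right_offset w v = 0" using right_offset_shared v assms by auto
      have "w < u" using v \<open>v < u\<close> by auto
      have lay: "depth u < depth y" if "w < y" "y < u" for y
        using depth_between_parent[OF v(1), of y] depth_between_parent[OF assms, of y] that v(3) vN(2)
        by (cases y v rule: linorder_cases) auto
      have "coord u = coord w + 2"
        using coord_gap_eq[OF \<open>w < u\<close> _ v(3) _ lay] assms parent_le by auto
      then have "M * coord u = M * coord w + 2 * M" by (simp add: distrib_left)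
      then show ?thesis using v(4) r M_ge by auto
    qed
  next
    case v: (left w)
    then have "w = u" using parent_below_unique assms by auto
    then show ?thesis using v(5) b(3)[of u v] b(4)[of u v] M_ge by auto
  qed
qed

text \<open>The window of \<open>u\<close> at most touches that of the parent \<open>w\<close>. A
  child off the end of its window keeps an integer distance of at least \<open>1\<close> from it; a
  child on the upper end is shared, and any \<open>u\<close> beyond its second parent is a whole
  window further away.\<close>

lemma coord_non_parent:
  assumes "v \<le> N" "u \<le> N" "depth v = Suc (depth u)" "\<not> adj u v"
  shows "M + 1 \<le> \<bar>coord v - M * coord u\<bar>"
proof -
  have np: "\<not> parent u v" using assms by (auto simp: parent_def)
  have gap: "2 * M \<le> M * coord u' - M * coord u" 
    if "u < u'" "u' \<le> N" "depth u = k" "depth u' = k" for u u' k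
    using M_mult_mono[OF coord_gap[OF that]] by (simp add: algebra_simps)
  note b = offset_bounds M_ge
  show ?thesis
  proof (cases rule: vertex_cases[OF assms(1,3), case_names right left])
    case v: (right w)
    have "w \<noteq> u" using v np by auto
    then consider "u < w" | "w < u" by linarith
    then show ?thesis
    proof cases
      case 1
      then show ?thesis using gap[OF 1 _ refl] v parent_le[OF v(1)] b(2)[of w v] M_ge by force
    next
      case 2
      have g: "2 * M \<le> M * coord u - M * coord w" using gap[OF 2 assms(2) refl] v by auto
      show ?thesis
      proof (cases "right_offset w v = 0")
        case True
        then obtain u1 where u1: "parent u1 v" "v < u1" using right_offset_eq_0 v by auto
        have d1: "depth u1 = depth u" using u1 assms(3) by (auto simp: parent_def)
        have "u \<noteq> u1" using u1 np by auto
        moreover have "\<not> u < u1"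
        proof
          assume "u < u1"
          moreover have "u \<noteq> v" using assms(3) by auto
          ultimately show False
            using depth_between_parent[OF v(1), of u] depth_between_parent[OF u1(1), of u] 2 d1 v(3)
            by linarith
        qed
        ultimately have "u1 < u" by simp
        then have "2 * M \<le> M * coord u - M * coord u1" using gap[OF _ assms(2) d1 refl] by auto
        moreover have "2 * M \<le> M * coord u1 - M * coord w"
          using gap[of w u1] v u1 d1 parent_le[OF u1(1)] by auto
        ultimately show ?thesis using v(4) True M_ge by linarith
      next
        case False
        then show ?thesis using g v(4) b(1)[of w v] by linarith
      qed
    qed
  next
    case v: (left w)
    have l: "1 \<le> left_offset w v" using left_offset_pos(1)[OF v(1,2,4)] .
    have "w \<noteq> u" using v np by auto
    then consider "u < w" | "w < u" by linarith
    then show ?thesis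
    proof cases
      case 1
      then have "2 * M \<le> M * coord w - M * coord u"
        using gap[OF 1 _ refl] v parent_le[OF v(1)] by auto
      then show ?thesis using v(5) l by linarith
    next
      case 2
      then have "2 * M \<le> M * coord u - M * coord w" using gap[OF 2 assms(2) refl] v by auto
      then show ?thesis using v(5) b(4)[of w v] by linarith
    qed
  qed
qed

section \<open>Comparison of different layers\<close>

text \<open>The root coordinate \<open>4\<close> is the only value that both bounds allow at depth
  \<open>0\<close>. Multiplication by \<open>M\<close> turns the slack \<open>2\<close> into
  \<open>2 * M\<close>, and the radius of the window uses up only half of it.\<close>

lemma coord_bounds:
  "v \<le> N \<Longrightarrow> 2 * M ^ depth v + 2 \<le> coord v \<and> coord v \<le> 6 * M ^ depth v - 2"
proof (induction "depth v" arbitrary: v)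
  case 0
  then show ?case using depth_eq_0[of v] by (simp add: coord_def)
next
  case (Suc k)
  then have "v \<noteq> 0" by (metis depth_0 nat.distinct(1))
  then obtain u where u: "parent u v" using ex_parent Suc.prems by auto
  then have d: "depth u = k" "u \<le> N" using Suc.hyps parent_le by (auto simp: parent_def)
  then have "2 * M ^ k + 2 \<le> coord u" "coord u \<le> 6 * M ^ k - 2"
    using Suc.hyps(1)[of u] by auto
  then have "M * (2 * M ^ k + 2) \<le> M * coord u" "M * coord u \<le> M * (6 * M ^ k - 2)"
    using M_ge by (auto intro!: mult_left_mono)
  then show ?case
    using coord_parent[OF u] M_ge Suc.hyps(2)[symmetric] by (auto simp: algebra_simps abs_le_iff)
qed

lemma M_power_mult:
  assumes "i < j" shows "10 * M ^ i \<le> M ^ j"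
proof -
  have "10 * M ^ i \<le> M * M ^ i" using M_ge by (intro mult_right_mono) auto
  also have "\<dots> = M ^ Suc i" by simp
  also have "\<dots> \<le> M ^ j" using assms M_ge by (intro power_increasing) auto
  finally show ?thesis .
qed

text \<open>For \<open>k = 0\<close> this orders the layers, and for \<open>k = 1\<close> it puts a
  vertex two or more layers deeper above the window of \<open>u\<close>. The second conclusion puts
  \<open>u\<close> below the window of the deeper vertex. All rests on the growth of the coordinate
  ranges by a factor of at least \<open>10\<close>.\<close>

lemma coord_later:
  assumes "u \<le> N" "v \<le> N" "depth u + k < depth v" "k \<le> 1"
  shows "M ^ k * coord u + M + 1 \<le> coord v" "M + 1 \<le> M * coord v - coord u"
proof -
  have p: "1 \<le> M ^ j" for j using M_ge by simp
  have c: "2 * M ^ depth v + 2 \<le> coord v" "coord u \<le> 6 * M ^ depth u - 2" 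
    using coord_bounds assms by auto
  have "M ^ k * coord u \<le> M ^ k * (6 * M ^ depth u - 2)"
    using c(2) M_ge by (intro mult_left_mono) auto
  also have "\<dots> = 6 * M ^ (depth u + k) - 2 * M ^ k" by (simp add: algebra_simps power_add)
  finally have 1: "M ^ k * coord u \<le> 6 * M ^ (depth u + k) - 2 * M ^ k" .
  have 2: "10 * M ^ (depth u + k) \<le> M ^ depth v" using M_power_mult assms(3) .
  have "M = M ^ 1" by simp
  also have "\<dots> \<le> M ^ depth v" using assms(3) M_ge by (intro power_increasing) auto
  finally have 3: "M \<le> M ^ depth v" .
  show "M ^ k * coord u + M + 1 \<le> coord v"
    using 1 2 3 c p[of k] p[of "depth u + k"] by linarith
  have "10 * M ^ depth u \<le> M ^ depth v" using M_power_mult assms(3) by simp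
  then have "coord u + M \<le> coord v" using c 3 p[of "depth v"] by linarith
  moreover have "0 \<le> coord v" using c p[of "depth v"] by linarith
  then have "10 * coord v \<le> M * coord v" using M_ge by (intro mult_right_mono) auto
  ultimately show "M + 1 \<le> M * coord v - coord u" using M_ge c p[of "depth v"] by linarith
qed

definition side :: "nat \<Rightarrow> bool" where "side v \<longleftrightarrow> even (depth v)"

lemma coord_ge: "v \<le> N \<Longrightarrow> 4 \<le> coord v"
  using coord_bounds[of v] one_le_power[of M "depth v"] M_ge by linarith

text \<open>Each alternative stands for one gate: its first inequality keeps the segment inside that
  gate, its second keeps it on the right side of the middle wall at the other one.\<close>

lemma coord_edge_across:
  assumes "adj u v" "side u \<noteq> side v"
  shows "\<bar>coord v - M * coord u\<bar> \<le> M \<and> coord u - M * coord v \<le> - (M + 1) \<or>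
    \<bar>coord u - M * coord v\<bar> \<le> M \<and> coord v - M * coord u \<le> - (M + 1)"
proof -
  have *: "\<bar>coord v - M * coord u\<bar> \<le> M \<and> coord u - M * coord v \<le> - (M + 1)" if "parent u v" for u v
    using coord_parent[OF that] coord_later(2)[of u v 0] parent_le[OF that] that by (auto simp: parent_def)
  show ?thesis
    using assms(1) by (cases rule: depth_adj_cases) (use assms(2) * in \<open>auto simp: side_def\<close>)
qed

text \<open>With \<open>u\<close> on the left, the alternatives stand for the low, the high and the
  middle wall blocking the segment. A non-child in the next layer misses the window above or below,
  a deeper vertex always above.\<close>

lemma coord_non_edge_across:
  assumes "u \<le> N" "v \<le> N" "\<not> adj u v" "side u \<noteq> side v"
  shows "M + 1 \<le> coord v - M * coord u \<or> M + 1 \<le> coord u - M * coord v \<or>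
    coord v - M * coord u \<le> - (M + 1) \<and> coord u - M * coord v \<le> - (M + 1)"
proof -
  have *: "M + 1 \<le> coord v - M * coord u \<or>
    coord v - M * coord u \<le> - (M + 1) \<and> coord u - M * coord v \<le> - (M + 1)"
    if "u \<le> N" "v \<le> N" "\<not> adj u v" "depth u < depth v" "side u \<noteq> side v" for u v
  proof (cases "depth v = Suc (depth u)")
    case True
    then show ?thesis 
      using coord_non_parent[OF that(2,1) True that(3)] coord_later(2)[of u v 0] that by auto
  next
    case False
    then have "depth u + 1 < depth v" using that by simp
    then show ?thesis using coord_later(1)[OF that(1,2), of 1] by simp
  qed
  have "depth u \<noteq> depth v" using assms(4) by (auto simp: side_def)
  then consider "depth u < depth v" | "depth v < depth u" by linarith
  then show ?thesis
  proof cases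
    case 1
    then show ?thesis using *[OF assms(1,2,3) 1 assms(4)] by auto
  next
    case 2
    have "\<not> adj v u" using adj_sym assms(3) by blast
    then show ?thesis using *[OF assms(2,1) _ 2] assms(4) by auto
  qed
qed

lemma coord_less_iff:
  assumes "u \<le> N" "v \<le> N" "side u = side v"
  shows "coord u < coord v \<longleftrightarrow> depth u < depth v \<or> depth u = depth v \<and> u < v"
    and "u \<noteq> v \<Longrightarrow> 2 \<le> \<bar>coord u - coord v\<bar>"
proof -
  have *: "coord u + 2 \<le> coord v" 
    if "u \<le> N" "v \<le> N" "depth u < depth v \<or> depth u = depth v \<and> u < v" for u v
    using that(3)
  proof
    assume "depth u < depth v"
    then show ?thesis using coord_later(1)[of u v 0] that M_ge by auto
  qed (use coord_gap that in auto)
  have t: "depth u < depth v \<or> depth u = depth v \<and> u < v \<or> u = v \<or>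
    depth v < depth u \<or> depth v = depth u \<and> v < u" by linarith
  show "coord u < coord v \<longleftrightarrow> depth u < depth v \<or> depth u = depth v \<and> u < v"
    using *[OF assms(1,2)] *[OF assms(2,1)] t by fastforce
  show "u \<noteq> v \<Longrightarrow> 2 \<le> \<bar>coord u - coord v\<bar>"
    using *[OF assms(1,2)] *[OF assms(2,1)] t by fastforce
qed

lemma coord_edge_consecutive:
  assumes "adj u v" "side u = side v" "w \<le> N" "side w = side u"
    and "coord u < coord w" "coord w < coord v"
  shows False
proof -
  have N: "u \<le> N" "v \<le> N" using adj_le[OF assms(1)] by auto
  have d: "depth u = depth v"
    using assms(1) by (cases rule: depth_adj_cases) (use assms(2) in \<open>auto simp: side_def parent_def\<close>)
  have "depth w = depth u" "u < w" "w < v"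
    using coord_less_iff(1)[OF N(1) assms(3)] coord_less_iff(1)[OF assms(3) N(2)] assms d by auto
  then show False using depth_below_edge[OF assms(1), of w] d by simp
qed

end

section \<open>Certificates for visibility that survive perturbation\<close>

text \<open>Twice the signed area of the triangle.\<close>

definition cross :: "complex \<Rightarrow> complex \<Rightarrow> complex \<Rightarrow> real" where
  "cross a b c = (Re b - Re a) * (Im c - Im a) - (Im b - Im a) * (Re c - Re a)"

definition lin :: "real \<Rightarrow> real \<Rightarrow> complex \<Rightarrow> real" where
  "lin \<alpha> \<beta> q = \<alpha> * Re q + \<beta> * Im q"

definition separated :: "complex set \<Rightarrow> complex set \<Rightarrow> bool" where
  "separated A B \<longleftrightarrow> (\<exists>\<alpha> \<beta> \<gamma>. (\<forall>x\<in>A. \<gamma> < lin \<alpha> \<beta> x) \<and> (\<forall>x\<in>B. lin \<alpha> \<beta> x < \<gamma>))"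

text \<open>A proper crossing with a segment between two points of \<open>S\<close>. It implies that
  the segment meets the hull of \<open>S\<close> and, unlike that, it is an open condition on
  finitely many points.\<close>

definition crossed :: "complex \<Rightarrow> complex \<Rightarrow> complex set \<Rightarrow> bool" where
  "crossed u v S \<longleftrightarrow>
     (\<exists>q\<in>S. \<exists>r\<in>S. cross u v q * cross u v r < 0 \<and> cross q r u * cross q r v < 0)"

lemma lin_add: "lin \<alpha> \<beta> (x + y) = lin \<alpha> \<beta> x + lin \<alpha> \<beta> y" 
  and lin_scaleR: "lin \<alpha> \<beta> (c *\<^sub>R x) = c * lin \<alpha> \<beta> x"
  by (simp_all add: lin_def algebra_simps)

lemma lin_uminus: "lin (- \<alpha>) (- \<beta>) x = - lin \<alpha> \<beta> x"
  by (simp add: lin_def)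

lemma linear_lin: "linear (lin \<alpha> \<beta>)"
  by (intro linearI) (simp_all add: lin_add lin_scaleR)

lemma separated_sym: "separated A B \<Longrightarrow> separated B A"
  unfolding separated_def
  by (elim exE conjE, rule_tac x = "- \<alpha>" in exI, rule_tac x = "- \<beta>" in exI, rule_tac x = "- \<gamma>" in exI)
    (auto simp: lin_uminus)

text \<open>Finiteness of \<open>B\<close> leaves room below \<open>c\<close>, so equality may hold
  on \<open>A\<close>; thus a line through two vertices can itself be the separating line.\<close>

lemma separatedI:
  assumes "finite B" "\<And>x. x \<in> A \<Longrightarrow> c \<le> lin \<alpha> \<beta> x" "\<And>x. x \<in> B \<Longrightarrow> lin \<alpha> \<beta> x < c"
  shows "separated A B"
proof -
  obtain \<gamma> where "\<gamma> < c" "\<And>x. x \<in> B \<Longrightarrow> lin \<alpha> \<beta> x < \<gamma>"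
  proof (cases "B = {}")
    case True
    then show ?thesis using that[of "c - 1"] by auto
  next
    case False
    define m where "m = Max (lin \<alpha> \<beta> ` B)"
    have "m < c" unfolding m_def using assms False by simp
    moreover have "lin \<alpha> \<beta> x \<le> m" if "x \<in> B" for x unfolding m_def using assms that by simp
    ultimately show ?thesis using that[of "(m + c) / 2"] by force
  qed
  then show ?thesis unfolding separated_def using assms(2) by (meson less_le_trans)
qed

lemma separated_disjoint:
  assumes "separated A B" shows "convex hull A \<inter> convex hull B = {}"
proof -
  obtain \<alpha> \<beta> \<gamma> where *: "\<And>x. x \<in> A \<Longrightarrow> \<gamma> < lin \<alpha> \<beta> x" "\<And>x. x \<in> B \<Longrightarrow> lin \<alpha> \<beta> x < \<gamma>"
    using assms unfolding separated_def by blast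
  have "{x. \<gamma> < lin \<alpha> \<beta> x} = lin \<alpha> \<beta> -` {\<gamma><..}" "{x. lin \<alpha> \<beta> x < \<gamma>} = lin \<alpha> \<beta> -` {..<\<gamma>}" by auto
  then have cv: "convex {x. \<gamma> < lin \<alpha> \<beta> x}" "convex {x. lin \<alpha> \<beta> x < \<gamma>}"
    using convex_linear_vimage[OF linear_lin] by (metis convex_real_interval(3), metis convex_real_interval(4))
  have "A \<subseteq> {x. \<gamma> < lin \<alpha> \<beta> x}" "B \<subseteq> {x. lin \<alpha> \<beta> x < \<gamma>}" using * by auto
  with cv have "convex hull A \<subseteq> {x. \<gamma> < lin \<alpha> \<beta> x}" "convex hull B \<subseteq> {x. lin \<alpha> \<beta> x < \<gamma>}"
    by (simp_all only: hull_minimal)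
  then show ?thesis by force
qed

lemma cross_affine: "cross a b ((1 - s) *\<^sub>R x + s *\<^sub>R y) = (1 - s) * cross a b x + s * cross a b y"
  by (simp add: cross_def algebra_simps)

lemma cross_eq_0_imp_on_line:
  assumes "cross u v x = 0" "u \<noteq> v" shows "\<exists>s. x = (1 - s) *\<^sub>R u + s *\<^sub>R v"
proof -
  have eq: "(Re v - Re u) * (Im x - Im u) = (Im v - Im u) * (Re x - Re u)"
    using assms(1) by (simp add: cross_def)
  obtain s where s: "Re x - Re u = s * (Re v - Re u)" "Im x - Im u = s * (Im v - Im u)"
  proof (cases "Re u = Re v")
    case False
    show ?thesis
    proof (rule that)
      show 1: "Re x - Re u = (Re x - Re u) / (Re v - Re u) * (Re v - Re u)" using False by simp
      show "Im x - Im u = (Re x - Re u) / (Re v - Re u) * (Im v - Im u)"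
        using False eq by (simp add: field_simps)
    qed
  next
    case True
    then have im: "Im u \<noteq> Im v" using assms(2) by (simp add: complex_eq_iff)
    show ?thesis
    proof (rule that)
      show "Re x - Re u = (Im x - Im u) / (Im v - Im u) * (Re v - Re u)" using True im eq by simp
      show "Im x - Im u = (Im x - Im u) / (Im v - Im u) * (Im v - Im u)" using im by simp
    qed
  qed
  then show ?thesis
    by (intro exI[of _ s]) (simp add: complex_eq_iff algebra_simps)
qed

lemma opposite_signs_zero:
  fixes a b :: real assumes "a * b < 0" obtains s where "0 < s" "s < 1" "(1 - s) * a + s * b = 0"
proof
  have "a \<noteq> b" using assms by (metis not_square_less_zero)
  show "(1 - a / (a - b)) * a + a / (a - b) * b = 0" using \<open>a \<noteq> b\<close> by (simp add: field_simps)
  show "0 < a / (a - b)" "a / (a - b) < 1"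
    using assms by (auto simp: mult_less_0_iff field_simps)
qed

lemma crossed_meets:
  assumes "crossed u v S" shows "closed_segment u v \<inter> convex hull S \<noteq> {}"
proof -
  obtain q r where qr: "q \<in> S" "r \<in> S" and c: "cross u v q * cross u v r < 0" "cross q r u * cross q r v < 0"
    using assms by (auto simp: crossed_def)
  obtain t where t: "0 < t" "t < 1" "(1 - t) * cross u v q + t * cross u v r = 0"
    using opposite_signs_zero[OF c(1)] by auto
  define x where "x = (1 - t) *\<^sub>R q + t *\<^sub>R r"
  have "cross u v x = 0" unfolding x_def cross_affine using t by simp
  moreover have "u \<noteq> v" using c(1) by (auto simp: cross_def)
  ultimately obtain s where s: "x = (1 - s) *\<^sub>R u + s *\<^sub>R v" using cross_eq_0_imp_on_line by blast
  have "cross q r q = 0" "cross q r r = 0" by (simp_all add: cross_def)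
  then have "cross q r x = 0" unfolding x_def cross_affine by simp
  then have "(1 - s) * cross q r u + s * cross q r v = 0" unfolding s cross_affine .
  \<comment> \<open>The two values of \<open>cross q r\<close> have opposite signs. For
    \<open>s\<close> outside the unit interval, multiplying the equation by one of them leaves a
    nonnegative and a positive term with sum zero.\<close>
  moreover have "0 \<le> s \<and> s \<le> 1"
  proof (rule ccontr)
    assume s: "\<not> ?thesis"
    let ?c = "cross q r u" and ?d = "cross q r v"
    have "((1 - s) * ?c + s * ?d) * ?c = 0" "((1 - s) * ?c + s * ?d) * ?d = 0"
      using \<open>(1 - s) * ?c + s * ?d = 0\<close> by simp_all
    then have *: "(1 - s) * ?c\<^sup>2 + s * (?c * ?d) = 0" "(1 - s) * (?c * ?d) + s * ?d\<^sup>2 = 0"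
      by (simp_all add: algebra_simps power2_eq_square)
    show False
    proof (cases "s < 0")
      case True
      then have "0 < s * (?c * ?d)" using c(2) by (simp add: mult_neg_neg)
      moreover have "0 \<le> (1 - s) * ?c\<^sup>2" using True by simp
      ultimately show False using *(1) by linarith
    next
      case False
      then have "0 < (1 - s) * (?c * ?d)" using s c(2) by (intro mult_neg_neg) auto
      moreover have "0 \<le> s * ?d\<^sup>2" using False by simp
      ultimately show False using *(2) by linarith
    qed
  qed
  ultimately have "x \<in> closed_segment u v" using s by (auto simp: closed_segment_def)
  moreover have "x \<in> convex hull S"
  proof -
    have "x \<in> closed_segment q r" using t by (auto simp: closed_segment_def x_def)
    moreover have "closed_segment q r \<subseteq> convex hull S"
      using qr by (simp add: closed_segment_subset_convex_hull hull_inc)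
    ultimately show ?thesis by auto
  qed
  ultimately show ?thesis by blast
qed

section \<open>Perturbation into general position\<close>

text \<open>Points are moved one at a time. The lines through earlier points, including the
  degenerate ones that are single points, form a null set and cannot fill a ball.\<close>

lemma ex_general_position_near:
  assumes "finite S" "0 < e"
  shows "\<exists>g. (\<forall>x\<in>S. dist (g x) x < e) \<and> inj_on g S \<and> general_position (g ` S)"
  using assms(1)
proof (induction S rule: finite_induct)
  case empty
  then show ?case by (auto simp: general_position_def)
next
  case (insert x S)
  then obtain g where g: "\<forall>x\<in>S. dist (g x) x < e" "inj_on g S" "general_position (g ` S)" by auto
  define F where "F = (\<Union>a\<in>g ` S. \<Union>b\<in>g ` S. affine hull {a, b})"
  have "negligible (affine hull {a, b})" for a b :: complex
  proof -
    have "card {a, b} \<le> 2" by (cases "a = b") auto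
    then have "interior (affine hull {a, b}) = {}"
      by (intro empty_interior_affine_hull) auto
    then have "affine hull {a, b} \<subseteq> frontier (affine hull {a, b})"
      by (auto simp: frontier_def intro: subsetD[OF closure_subset])
    then show ?thesis
      using negligible_convex_frontier[OF affine_imp_convex[OF affine_affine_hull]] negligible_subset by blast
  qed
  then have "negligible F" unfolding F_def using insert.hyps(1) by (auto intro!: negligible_Union)
  moreover have "\<not> negligible (ball x e)" using assms(2) by (intro open_not_negligible) auto
  ultimately obtain z where z: "z \<in> ball x e" "z \<notin> F" using negligible_subset by blast
  have aff: "z \<notin> affine hull {a, b}" if "a \<in> g ` S" "b \<in> g ` S" for a b
    using z(2) that by (auto simp: F_def)
  then have zS: "z \<notin> g ` S" by (metis hull_inc insertI1)
  define g' where "g' = g(x := z)"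
  have im: "g' ` insert x S = insert z (g ` S)" using insert.hyps(2) by (auto simp: g'_def)
  have "general_position (insert z (g ` S))"
    unfolding general_position_def
  proof (intro allI impI)
    fix T assume T: "T \<subseteq> insert z (g ` S)" "card T = 3"
    show "\<not> collinear T"
    proof (cases "z \<in> T")
      case False
      then show ?thesis using T g(3) by (auto simp: general_position_def)
    next
      case True
      have "card (T - {z}) = 2" using T(2) True by (simp add: card.infinite)
      then obtain a b where ab: "T - {z} = {a, b}" "a \<noteq> b" by (auto simp: card_2_iff)
      then have "a \<in> g ` S" "b \<in> g ` S" "T = {a, b, z}" using T(1) True by auto
      then show ?thesis using aff collinear_3_affine_hull[OF ab(2)] by auto
    qed
  qed
  moreover have "\<forall>y\<in>insert x S. dist (g' y) y < e" using g z insert.hyps(2) by (auto simp: g'_def dist_commute)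
  moreover have "inj_on g' (insert x S)"
    using g(2) zS insert.hyps(2) by (auto simp: g'_def inj_on_def)
  ultimately show ?case using im by metis
qed

lemma general_position_sequence:
  assumes "finite S"
  obtains g :: "nat \<Rightarrow> complex \<Rightarrow> complex"
  where "\<And>n. inj_on (g n) S" "\<And>n. general_position (g n ` S)" "\<And>x. x \<in> S \<Longrightarrow> (\<lambda>n. g n x) \<longlonglongrightarrow> x"
proof -
  have "\<forall>n. \<exists>g. (\<forall>x\<in>S. dist (g x) x < inverse (real (Suc n))) \<and> inj_on g S \<and> general_position (g ` S)"
    using ex_general_position_near[OF assms] by simp
  then obtain g where g: "\<And>n x. x \<in> S \<Longrightarrow> dist (g n x) x < inverse (real (Suc n))"
    "\<And>n. inj_on (g n) S" "\<And>n. general_position (g n ` S)" by metis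
  have "(\<lambda>n. g n x) \<longlonglongrightarrow> x" if "x \<in> S" for x
  proof (rule metric_tendsto_imp_tendsto[OF LIMSEQ_inverse_real_of_nat])
    show "\<forall>\<^sub>F n in sequentially. dist (g n x) x \<le> dist (inverse (real (Suc n))) 0"
      using g(1)[OF that] by (intro always_eventually) (auto intro: less_imp_le)
  qed
  then show ?thesis using g that by blast
qed

lemma tendsto_cross [tendsto_intros]:
  assumes "(f \<longlongrightarrow> a) F" "(g \<longlongrightarrow> b) F" "(h \<longlongrightarrow> c) F"
  shows "((\<lambda>n. cross (f n) (g n) (h n)) \<longlongrightarrow> cross a b c) F"
  unfolding cross_def by (intro tendsto_intros assms)

lemma eventually_separated:
  assumes "separated A B" "finite A" "finite B" "\<And>x. x \<in> A \<union> B \<Longrightarrow> ((\<lambda>n. g n x) \<longlongrightarrow> x) F"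
  shows "\<forall>\<^sub>F n in F. separated (g n ` A) (g n ` B)"
proof -
  obtain \<alpha> \<beta> \<gamma> where *: "\<And>x. x \<in> A \<Longrightarrow> \<gamma> < lin \<alpha> \<beta> x" "\<And>x. x \<in> B \<Longrightarrow> lin \<alpha> \<beta> x < \<gamma>"
    using assms(1) unfolding separated_def by blast
  have t: "((\<lambda>n. lin \<alpha> \<beta> (g n x)) \<longlongrightarrow> lin \<alpha> \<beta> x) F" if "x \<in> A \<union> B" for x
    unfolding lin_def by (intro tendsto_intros assms(4)[OF that])
  have "\<forall>\<^sub>F n in F. \<forall>x\<in>A. \<gamma> < lin \<alpha> \<beta> (g n x)"
    using assms(2) by (intro eventually_ball_finite ballI order_tendstoD(1)[OF t] *) auto
  moreover have "\<forall>\<^sub>F n in F. \<forall>x\<in>B. lin \<alpha> \<beta> (g n x) < \<gamma>"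
    using assms(3) by (intro eventually_ball_finite ballI order_tendstoD(2)[OF t] *) auto
  ultimately show ?thesis
    by eventually_elim (auto simp: separated_def)
qed

lemma eventually_crossed:
  assumes "crossed u v S" "(f \<longlongrightarrow> u) F" "(h \<longlongrightarrow> v) F" "\<And>x. x \<in> S \<Longrightarrow> ((\<lambda>n. g n x) \<longlongrightarrow> x) F"
  shows "\<forall>\<^sub>F n in F. crossed (f n) (h n) (g n ` S)"
proof -
  obtain q r where qr: "q \<in> S" "r \<in> S" and c: "cross u v q * cross u v r < 0" "cross q r u * cross q r v < 0"
    using assms(1) by (auto simp: crossed_def)
  note t = assms(2,3) assms(4)[OF qr(1)] assms(4)[OF qr(2)]
  have "\<forall>\<^sub>F n in F. cross (f n) (h n) (g n q) * cross (f n) (h n) (g n r) < 0"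
    by (rule order_tendstoD(2)[OF _ c(1)]) (intro tendsto_intros t)
  moreover have "\<forall>\<^sub>F n in F. cross (g n q) (g n r) (f n) * cross (g n q) (g n r) (h n) < 0"
    by (rule order_tendstoD(2)[OF _ c(2)]) (intro tendsto_intros t)
  ultimately show ?thesis
    by eventually_elim (use qr in \<open>auto simp: crossed_def\<close>)
qed

text \<open>Obstacles may be given by degenerate, even collinear, point sets, as long as each has
  three points: after the perturbation three points in general position span a polygon. Both kinds
  of certificates hold eventually along perturbations that tend to the identity.\<close>

lemma representation_from_strict_incidences:
  fixes P :: "'v \<Rightarrow> complex"
  assumes V: "finite V" "inj_on P V"
    and S: "finite \<S>" "\<And>S. S \<in> \<S> \<Longrightarrow> finite S \<and> 3 \<le> card S"
    and disj: "\<And>S S'. S \<in> \<S> \<Longrightarrow> S' \<in> \<S> \<Longrightarrow> S \<noteq> S' \<Longrightarrow> separated S S'"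
    and edge: "\<And>u v S. u \<in> V \<Longrightarrow> v \<in> V \<Longrightarrow> u \<noteq> v \<Longrightarrow> {u, v} \<in> E \<Longrightarrow> S \<in> \<S> \<Longrightarrow> separated {P u, P v} S"
    and non_edge: "\<And>u v. u \<in> V \<Longrightarrow> v \<in> V \<Longrightarrow> u \<noteq> v \<Longrightarrow> {u, v} \<notin> E \<Longrightarrow> \<exists>S\<in>\<S>. crossed (P u) (P v) S"
  shows "\<exists>p Obs. convex_obstacle_representation V E p Obs \<and> pairwise disjnt Obs \<and> card Obs \<le> card \<S>"
proof -
  define X where "X = P ` V \<union> \<Union>\<S>"
  have "finite X" using V S by (auto simp: X_def)
  then obtain g where g: "\<And>n. inj_on (g n) X" "\<And>n. general_position (g n ` X)"
    "\<And>x. x \<in> X \<Longrightarrow> (\<lambda>n. g n x) \<longlonglongrightarrow> x"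
    using general_position_sequence by blast
  have X: "S \<subseteq> X" if "S \<in> \<S>" for S using that by (auto simp: X_def)
  have gS: "(\<lambda>n. g n x) \<longlonglongrightarrow> x" if "S \<in> \<S>" "x \<in> S" for S x
    using g(3) X that by blast
  have PX: "P v \<in> X" if "v \<in> V" for v using that by (auto simp: X_def)
  have e1: "\<forall>\<^sub>F n in sequentially. \<forall>S\<in>\<S>. \<forall>S'\<in>\<S>. S \<noteq> S' \<longrightarrow> separated (g n ` S) (g n ` S')"
    using disj S gS
    by (intro eventually_ball_finite ballI) (auto intro!: eventually_separated simp: eventually_conj_iff)
  have e2: "\<forall>\<^sub>F n in sequentially. \<forall>u\<in>V. \<forall>v\<in>V. \<forall>S\<in>\<S>. u \<noteq> v \<and> {u, v} \<in> E \<longrightarrow>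
      separated (g n ` {P u, P v}) (g n ` S)"
    using edge S V g(3) gS PX
    by (intro eventually_ball_finite ballI) (auto intro!: eventually_separated simp del: image_insert)
  have e3: "\<forall>\<^sub>F n in sequentially. \<forall>u\<in>V. \<forall>v\<in>V. u \<noteq> v \<and> {u, v} \<notin> E \<longrightarrow>
      (\<exists>S\<in>\<S>. crossed (g n (P u)) (g n (P v)) (g n ` S))"
  proof (intro eventually_ball_finite ballI V(1))
    fix u v assume uv: "u \<in> V" "v \<in> V"
    show "\<forall>\<^sub>F n in sequentially. u \<noteq> v \<and> {u, v} \<notin> E \<longrightarrow>
      (\<exists>S\<in>\<S>. crossed (g n (P u)) (g n (P v)) (g n ` S))"
    proof (cases "u \<noteq> v \<and> {u, v} \<notin> E")
      case True
      then obtain S where S': "S \<in> \<S>" "crossed (P u) (P v) S" using non_edge uv by blast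
      have "\<forall>\<^sub>F n in sequentially. crossed (g n (P u)) (g n (P v)) (g n ` S)"
        by (rule eventually_crossed[OF S'(2)]) (use g(3) PX uv X[OF S'(1)] in auto)
      then show ?thesis by eventually_elim (use S'(1) in auto)
    qed auto
  qed
  have "\<exists>n. (\<forall>S\<in>\<S>. \<forall>S'\<in>\<S>. S \<noteq> S' \<longrightarrow> separated (g n ` S) (g n ` S')) \<and>
      (\<forall>u\<in>V. \<forall>v\<in>V. \<forall>S\<in>\<S>. u \<noteq> v \<and> {u, v} \<in> E \<longrightarrow> separated (g n ` {P u, P v}) (g n ` S)) \<and>
      (\<forall>u\<in>V. \<forall>v\<in>V. u \<noteq> v \<and> {u, v} \<notin> E \<longrightarrow> (\<exists>S\<in>\<S>. crossed (g n (P u)) (g n (P v)) (g n ` S)))"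
    by (rule eventually_happens'[OF sequentially_bot eventually_conj[OF e1 eventually_conj[OF e2 e3]]])
  then obtain n where n0: "(\<forall>S\<in>\<S>. \<forall>S'\<in>\<S>. S \<noteq> S' \<longrightarrow> separated (g n ` S) (g n ` S')) \<and>
      (\<forall>u\<in>V. \<forall>v\<in>V. \<forall>S\<in>\<S>. u \<noteq> v \<and> {u, v} \<in> E \<longrightarrow> separated (g n ` {P u, P v}) (g n ` S)) \<and>
      (\<forall>u\<in>V. \<forall>v\<in>V. u \<noteq> v \<and> {u, v} \<notin> E \<longrightarrow> (\<exists>S\<in>\<S>. crossed (g n (P u)) (g n (P v)) (g n ` S)))"
    by (rule exE)
  have n: "\<And>S S'. S \<in> \<S> \<Longrightarrow> S' \<in> \<S> \<Longrightarrow> S \<noteq> S' \<Longrightarrow> separated (g n ` S) (g n ` S')"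
    "\<And>u v S. u \<in> V \<Longrightarrow> v \<in> V \<Longrightarrow> S \<in> \<S> \<Longrightarrow> u \<noteq> v \<Longrightarrow> {u, v} \<in> E \<Longrightarrow> separated (g n ` {P u, P v}) (g n ` S)"
    "\<And>u v. u \<in> V \<Longrightarrow> v \<in> V \<Longrightarrow> u \<noteq> v \<Longrightarrow> {u, v} \<notin> E \<Longrightarrow> \<exists>S\<in>\<S>. crossed (g n (P u)) (g n (P v)) (g n ` S)"
    using conjunct1[OF n0] apply blast
    using conjunct1[OF conjunct2[OF n0]] apply blast
    using conjunct2[OF conjunct2[OF n0]] by blast
  define Obs where "Obs = (\<lambda>S. convex hull (g n ` S)) ` \<S>"
  have poly: "convex_polygon (convex hull (g n ` S))" if "S \<in> \<S>" for S
  proof -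
    have "inj_on (g n) S" using g(1) X[OF that] inj_on_subset by blast
    then have "3 \<le> card (g n ` S)" using S(2)[OF that] by (simp add: card_image)
    then obtain T where T: "T \<subseteq> g n ` S" "card T = 3" by (meson obtain_subset_with_card_n)
    then have "T \<subseteq> g n ` X" using X[OF that] by blast
    then have "\<not> collinear T" using g(2)[of n] T(2) by (auto simp: general_position_def)
    then have "\<not> aff_dim T \<le> 1" by (simp add: collinear_aff_dim)
    then have "2 \<le> aff_dim (g n ` S)" using aff_dim_subset[OF T(1)] by simp
    moreover have "aff_dim (g n ` S) \<le> 2" using aff_dim_le_DIM[of "g n ` S"] by simp
    ultimately show ?thesis
      using S(2)[OF that] by (auto simp: convex_polygon_def aff_dim_convex_hull intro: polytope_convex_hull)
  qed
  have "convex_obstacle_representation V E (g n \<circ> P) Obs"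
    unfolding convex_obstacle_representation_def
  proof (intro conjI ballI impI)
    show "inj_on (g n \<circ> P) V"
      using V(2) g(1)[of n] PX by (intro comp_inj_on) (auto intro: inj_on_subset)
    show "finite Obs" using S by (simp add: Obs_def)
    show "convex_polygon O'" if "O' \<in> Obs" for O' using that poly by (auto simp: Obs_def)
    have "(g n \<circ> P) ` V \<union> \<Union> (polygon_vertices ` Obs) \<subseteq> g n ` X"
      using PX X by (force simp: Obs_def polygon_vertices_def dest: extreme_point_of_convex_hull)
    then show "general_position ((g n \<circ> P) ` V \<union> \<Union> (polygon_vertices ` Obs))"
      using g(2)[of n] by (meson general_position_def order_trans)
    fix u v assume uv: "u \<in> V" "v \<in> V" "u \<noteq> v"
    show "({u, v} \<in> E) = (\<forall>Q\<in>Obs. closed_segment ((g n \<circ> P) u) ((g n \<circ> P) v) \<inter> Q = {})"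
    proof
      assume "{u, v} \<in> E"
      then show "\<forall>Q\<in>Obs. closed_segment ((g n \<circ> P) u) ((g n \<circ> P) v) \<inter> Q = {}"
        using n(2)[OF uv(1,2) _ uv(3)] separated_disjoint by (fastforce simp: Obs_def segment_convex_hull)
    next
      assume "\<forall>Q\<in>Obs. closed_segment ((g n \<circ> P) u) ((g n \<circ> P) v) \<inter> Q = {}"
      then show "{u, v} \<in> E"
        using n(3)[OF uv] crossed_meets by (fastforce simp: Obs_def)
    qed
  qed
  moreover have "pairwise disjnt Obs"
    using n(1) separated_disjoint by (fastforce simp: pairwise_def disjnt_def Obs_def)
  moreover have "card Obs \<le> card \<S>" using S(1) by (simp add: Obs_def card_image_le)
  ultimately show ?thesis by blast
qed

section \<open>A convex chain with its obstacle\<close>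

definition left_point :: "real \<Rightarrow> real \<Rightarrow> complex" where
  "left_point e y = Complex (- e * y\<^sup>2) y"

definition consecutive :: "real set \<Rightarrow> real \<Rightarrow> real \<Rightarrow> bool" where
  "consecutive Y a b \<longleftrightarrow> a \<in> Y \<and> b \<in> Y \<and> a < b \<and> (\<forall>y\<in>Y. \<not> (a < y \<and> y < b))"

text \<open>The obstacle vertex for a consecutive pair lies next to the midpoint of the chord, to its left
  if the pair should see each other and to its right otherwise.\<close>

definition chord_mark :: "real \<Rightarrow> (real \<Rightarrow> real \<Rightarrow> bool) \<Rightarrow> real \<Rightarrow> real \<Rightarrow> complex" where
  "chord_mark e R a b =
     Complex (- e * (a\<^sup>2 + b\<^sup>2) / 2 + (if R a b then - e / 2 else e / 2)) ((a + b) / 2)"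

text \<open>The translate of a mark by \<open>-1\<close> lies behind every chord that the mark has
  to block. The points \<open>-1\<close>, \<open>-2\<close>, \<open>-3\<close> guarantee three
  points even if \<open>Y\<close> has at most one element.\<close>

definition chain_obstacle :: "real \<Rightarrow> real set \<Rightarrow> (real \<Rightarrow> real \<Rightarrow> bool) \<Rightarrow> complex set" where
  "chain_obstacle e Y R = {- 1, - 2, - 3} \<union>
     (\<Union>(a, b)\<in>{(a, b) \<in> Y \<times> Y. consecutive Y a b}. {chord_mark e R a b, chord_mark e R a b - 1})"

lemma finite_chain_obstacle [simp]:
  assumes "finite Y" shows "finite (chain_obstacle e Y R)"
proof -
  have *: "finite {(a, b) \<in> Y \<times> Y. consecutive Y a b}"
    by (rule finite_subset[of _ "Y \<times> Y"]) (use assms in auto)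
  have "finite (\<Union>x\<in>{(a, b) \<in> Y \<times> Y. consecutive Y a b}.
      case x of (a, b) \<Rightarrow> {chord_mark e R a b, chord_mark e R a b - 1})"
    by (rule finite_UN_I[OF *]) (auto split: prod.splits)
  then show ?thesis unfolding chain_obstacle_def by (rule finite_UnI[rotated]) simp
qed

lemma card_chain_obstacle: "finite Y \<Longrightarrow> 3 \<le> card (chain_obstacle e Y R)"
proof -
  assume "finite Y"
  have "card {- 1, - 2, - 3 :: complex} = 3" by simp
  moreover have "card {- 1, - 2, - 3 :: complex} \<le> card (chain_obstacle e Y R)"
    by (rule card_mono[OF finite_chain_obstacle[OF \<open>finite Y\<close>]]) (auto simp: chain_obstacle_def)
  ultimately show ?thesis by simp
qed

lemma chain_obstacle_cases:
  assumes "q \<in> chain_obstacle e Y R"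
  obtains k where "q = - of_real k" "1 \<le> k"
    | a b k where "consecutive Y a b" "q = chord_mark e R a b - of_real k" "0 \<le> k"
proof -
  consider "q = -1" | "q = -2" | "q = -3" 
    | a b where "consecutive Y a b" "q = chord_mark e R a b"
    | a b where "consecutive Y a b" "q = chord_mark e R a b - 1"
    using assms by (auto simp: chain_obstacle_def)
  then show ?thesis
  proof cases
    case 1 then show ?thesis using that(1)[of 1] by simp
  next
    case 2 then show ?thesis using that(1)[of 2] by simp
  next
    case 3 then show ?thesis using that(1)[of 3] by simp
  next
    case (4 a b) then show ?thesis using that(2)[of a b 0] by simp
  next
    case (5 a b) then show ?thesis using that(2)[of a b 1] by simp
  qed
qed

text \<open>By \<open>spaced\<close> the parabola bulges by at least \<open>e\<close> beyond the
  midpoint of a chord, twice the displacement \<open>e / 2\<close> of a mark. By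
  \<open>small\<close> a mark is less than \<open>1\<close> in front of any chord that it blocks,
  and \<open>pos\<close> keeps the points \<open>-1\<close>, \<open>-2\<close>, \<open>-3\<close>
  behind all chords and tangents.\<close>

locale convex_chain =
  fixes Y :: "real set" and R :: "real \<Rightarrow> real \<Rightarrow> bool" and e :: real
  assumes fin: "finite Y" and pos: "\<And>y. y \<in> Y \<Longrightarrow> 0 < y" and e: "0 < e"
    and spaced: "\<And>a b. a \<in> Y \<Longrightarrow> b \<in> Y \<Longrightarrow> a \<noteq> b \<Longrightarrow> 2 \<le> \<bar>a - b\<bar>"
    and small: "\<And>a b. a \<in> Y \<Longrightarrow> b \<in> Y \<Longrightarrow> e * ((a - b)\<^sup>2 + 1) < 1"
begin

text \<open>\<open>chord a b q\<close> is negative, zero or positive according to whether \<open>q\<close> lies to the left of, on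
  or to the right of the line through the chain points of heights \<open>a\<close> and \<open>b\<close>; for \<open>a = b\<close> this
  is the tangent.\<close>

definition chord :: "real \<Rightarrow> real \<Rightarrow> complex \<Rightarrow> real" where
  "chord a b q = Re q + e * ((a + b) * Im q - a * b)"

lemma chord_left_point: "chord a b (left_point e y) = - e * (y - a) * (y - b)"
  by (simp add: chord_def left_point_def algebra_simps power2_eq_square)

lemma chord_mark: "chord a b (chord_mark e R y z) =
    - e * ((y - a) * (y - b) + (z - a) * (z - b)) / 2 + (if R y z then - e / 2 else e / 2)"
  by (simp add: chord_def chord_mark_def field_simps power2_eq_square)

lemma chord_mark_neg:
  assumes "1 < (y - a) * (y - b) + (z - a) * (z - b)"
  shows "chord a b (chord_mark e R y z) < 0"
proof -
  define S where "S = (y - a) * (y - b) + (z - a) * (z - b)"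
  have "e * 1 < e * S" using assms e unfolding S_def by (intro mult_strict_left_mono)
  moreover have "(if R y z then - e / 2 else e / 2) \<le> e / 2" using e by simp
  moreover have "- e * S = - (e * S)" by simp
  ultimately show ?thesis unfolding chord_mark S_def[symmetric] by linarith
qed

lemma chord_diff: "chord a b (q - of_real k) = chord a b q - k"
  by (simp add: chord_def)

lemma gap: "a \<in> Y \<Longrightarrow> b \<in> Y \<Longrightarrow> a < b \<Longrightarrow> 2 \<le> b - a"
  using spaced[of a b] by auto

lemma separated_by_chord:
  assumes ab: "0 < a" "0 < b" and A: "\<And>x. x \<in> A \<Longrightarrow> 0 \<le> chord a b x"
    and m: "\<And>y z. consecutive Y y z \<Longrightarrow> chord a b (chord_mark e R y z) < 0"
  shows "separated A (chain_obstacle e Y R)"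
proof (rule separatedI)
  show "finite (chain_obstacle e Y R)" using fin by simp
  have eq: "chord a b x = lin 1 (e * (a + b)) x - e * a * b" for x
    by (simp add: chord_def lin_def algebra_simps)
  show "e * a * b \<le> lin 1 (e * (a + b)) x" if "x \<in> A" for x using A[OF that] eq[of x] by simp
  fix x assume "x \<in> chain_obstacle e Y R"
  then have "chord a b x < 0"
  proof (cases rule: chain_obstacle_cases)
    case (1 k)
    have "0 < e * (a * b)" using ab e by simp
    then show ?thesis using 1 by (simp add: chord_def)
  next
    case (2 y z k)
    then show ?thesis using m[OF 2(1)] by (simp add: chord_diff)
  qed
  then show "lin 1 (e * (a + b)) x < e * a * b" using eq[of x] by simp
qed

text \<open>The tangent at height \<open>y\<close> separates. Two heights at distance at least
  \<open>2\<close> have squared distances from \<open>y\<close> with sum at least \<open>2\<close>,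
  which outweighs the displacement of their mark.\<close>

lemma separated_from_chain:
  assumes "y \<in> Y" "0 < chord y y q"
  shows "separated {left_point e y, q} (chain_obstacle e Y R)"
proof (rule separated_by_chord[of y y])
  fix a b assume ab: "consecutive Y a b"
  then have "2 \<le> b - a" using gap by (auto simp: consecutive_def)
  then have "4 \<le> (b - a)\<^sup>2" using power_mono[of 2 "b - a" 2] by simp
  moreover have "(b - a)\<^sup>2 \<le> 2 * ((a - y)\<^sup>2 + (b - y)\<^sup>2)"
    using zero_le_power2[of "(a - y) + (b - y)"] by (simp add: power2_eq_square algebra_simps)
  ultimately have "2 \<le> (a - y) * (a - y) + (b - y) * (b - y)" by (simp add: power2_eq_square)
  then show "chord y y (chord_mark e R a b) < 0" by (intro chord_mark_neg) simp
qed (use assms pos in \<open>auto simp: chord_left_point\<close>)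

text \<open>The chord itself separates: its own mark was moved to the left, and outside the heights
  between \<open>a\<close> and \<open>b\<close> the parabola turns to the left of the line, taking
  the other marks with it.\<close>

lemma consecutive_visible:
  assumes "consecutive Y a b" "R a b"
  shows "separated {left_point e a, left_point e b} (chain_obstacle e Y R)"
proof (rule separated_by_chord[of a b])
  have ab: "a \<in> Y" "b \<in> Y" "a < b" using assms(1) by (auto simp: consecutive_def)
  show "0 < a" "0 < b" using ab pos by auto
  fix y z assume yz: "consecutive Y y z"
  show "chord a b (chord_mark e R y z) < 0"
  proof (cases "y = a \<and> z = b")
    case True
    then show ?thesis using assms(2) e by (simp add: chord_mark)
  next
    case False
    have "b \<le> y \<or> z \<le> a"
      using yz assms(1) False by (force simp: consecutive_def not_less)
    moreover have "2 \<le> z - y" "2 \<le> b - a" using yz ab gap by (auto simp: consecutive_def)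
    ultimately have "4 \<le> (y - a) * (y - b) + (z - a) * (z - b)"
    proof (elim disjE)
      assume 1: "b \<le> y"
      have "2 * 2 \<le> (z - a) * (z - b)" using 1 \<open>2 \<le> z - y\<close> \<open>2 \<le> b - a\<close> by (intro mult_mono) auto
      moreover have "0 \<le> (y - a) * (y - b)" using 1 \<open>2 \<le> b - a\<close> by (intro mult_nonneg_nonneg) auto
      ultimately show ?thesis by simp
    next
      assume 1: "z \<le> a"
      have "2 * 2 \<le> (a - y) * (b - y)" using 1 \<open>2 \<le> z - y\<close> \<open>2 \<le> b - a\<close> by (intro mult_mono) auto
      moreover have "(a - y) * (b - y) = (y - a) * (y - b)" by (simp add: algebra_simps)
      moreover have "0 \<le> (z - a) * (z - b)" using 1 \<open>2 \<le> b - a\<close> by (intro mult_nonpos_nonpos) auto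
      ultimately show ?thesis by simp
    qed
    then show ?thesis by (intro chord_mark_neg) simp
  qed
qed (auto simp: chord_left_point)

lemma cross_left_points: "cross (left_point e a) (left_point e b) q = - (b - a) * chord a b q"
  by (simp add: cross_def left_point_def chord_def algebra_simps power2_eq_square)

lemma cross_horizontal: "cross q (q - 1) u = Im q - Im u"
  by (simp add: cross_def)

lemma hidden_by_mark:
  assumes "consecutive Y y z" "a < b" "0 < chord a b (chord_mark e R y z)"
    "chord a b (chord_mark e R y z) < 1" "a < (y + z) / 2" "(y + z) / 2 < b"
  shows "crossed (left_point e a) (left_point e b) (chain_obstacle e Y R)"
proof -
  let ?q = "chord_mark e R y z"
  have "?q \<in> chain_obstacle e Y R" "?q - 1 \<in> chain_obstacle e Y R"
    using assms(1) by (auto simp: chain_obstacle_def consecutive_def)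
  moreover have "cross (left_point e a) (left_point e b) ?q < 0"
    unfolding cross_left_points using assms by (intro mult_neg_pos) auto
  moreover have "0 < cross (left_point e a) (left_point e b) (?q - 1)"
    unfolding cross_left_points using assms chord_diff[of a b ?q 1] by (intro mult_neg_neg) auto
  moreover have "0 < cross ?q (?q - 1) (left_point e a)" "cross ?q (?q - 1) (left_point e b) < 0"
    unfolding cross_horizontal using assms by (simp_all add: chord_mark_def left_point_def)
  ultimately show ?thesis
    unfolding crossed_def by (meson mult_neg_pos mult_pos_neg)
qed

lemma ex_consecutive:
  assumes "a \<in> Y" "b \<in> Y" "a < b" shows "\<exists>z. consecutive Y a z \<and> z \<le> b"
proof -
  let ?Z = "{y \<in> Y. a < y}"
  have Z: "finite ?Z" "b \<in> ?Z" using fin assms by auto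
  then have "Min ?Z \<in> ?Z" by (intro Min_in) auto
  moreover have "Min ?Z \<le> y" if "y \<in> ?Z" for y using Z that by simp
  ultimately show ?thesis using assms Z(2) by (intro exI[of _ "Min ?Z"]) (force simp: consecutive_def)
qed

text \<open>The mark of the consecutive pair starting at \<open>a\<close> suffices. If the pair ends
  at \<open>b\<close>, its mark was moved to the right of the chord. If it ends at an earlier
  \<open>z\<close>, the midpoint of its chord is at least \<open>2 * e\<close> to the right of the
  chord from \<open>a\<close> to \<open>b\<close>, more than a mark can be displaced.\<close>

lemma non_edges_hidden:
  assumes ab: "a \<in> Y" "b \<in> Y" "a < b" and n: "\<not> (consecutive Y a b \<and> R a b)"
  shows "crossed (left_point e a) (left_point e b) (chain_obstacle e Y R)"
proof -
  obtain z where z: "consecutive Y a z" "z \<le> b" using ex_consecutive[OF ab] by auto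
  then have zY: "z \<in> Y" "a < z" by (auto simp: consecutive_def)
  have c: "chord a b (chord_mark e R a z) = e * ((z - a) * (b - z)) / 2 + (if R a z then - e / 2 else e / 2)"
    unfolding chord_mark by (simp add: algebra_simps)
  have "(z - a) * (b - z) \<le> (b - a) * (b - a)" using zY z(2) by (intro mult_mono) auto
  define K where "K = e * ((z - a) * (b - z))"
  have "K \<le> e * (b - a)\<^sup>2"
    unfolding K_def power2_eq_square using \<open>_ \<le> (b - a) * (b - a)\<close> e by (intro mult_left_mono) auto
  moreover have "e * (b - a)\<^sup>2 + e < 1" using small[OF ab(2,1)] by (simp add: distrib_left)
  moreover have "0 \<le> e * (b - a)\<^sup>2" using e by simp
  ultimately have "K / 2 + e / 2 < 1" using e by linarith
  then have up: "chord a b (chord_mark e R a z) < 1"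
    unfolding c K_def[symmetric] using e by (cases "R a z") auto
  show ?thesis
  proof (cases "z = b")
    case True
    then have "\<not> R a b" using n z by simp
    then have "0 < chord a b (chord_mark e R a z)" unfolding c using True e by simp
    then show ?thesis using hidden_by_mark[OF z(1) ab(3) _ up] True ab(3) by simp
  next
    case False
    then have "2 \<le> b - z" "2 \<le> z - a" using gap zY ab z(2) by auto
    then have "2 * 2 \<le> (z - a) * (b - z)" by (intro mult_mono) auto
    then have "e * 4 \<le> K" unfolding K_def using e by (intro mult_left_mono) auto
    then have "0 < chord a b (chord_mark e R a z)"
      unfolding c K_def[symmetric] using e by (cases "R a z") auto
    moreover have "a < (a + z) / 2" "(a + z) / 2 < b" using zY z(2) by auto
    ultimately show ?thesis using hidden_by_mark[OF z(1) ab(3) _ up] by simp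
  qed
qed

lemma Re_chain_obstacle:
  assumes "q \<in> chain_obstacle e Y R" shows "Re q \<le> e / 2"
  using assms
proof (cases rule: chain_obstacle_cases)
  case (2 a b k)
  have "0 \<le> e * (a\<^sup>2 + b\<^sup>2)" using e by simp
  moreover have "(if R a b then - e / 2 else e / 2) \<le> e / 2" using e by simp
  moreover have "Re q = - e * (a\<^sup>2 + b\<^sup>2) / 2 + (if R a b then - e / 2 else e / 2) - k"
    using 2(2) by (simp add: chord_mark_def)
  ultimately show ?thesis using 2(3) by linarith
qed (use e in auto)

end


section \<open>Three walls with two gates\<close>

text \<open>The half turn about \<open>1 / 2\<close> preserves orientation and exchanges the chains
  and the outer walls, so statements about the right side are obtained from those about the
  left.\<close>

definition reflect :: "complex \<Rightarrow> complex" where "reflect q = 1 - q"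

definition right_point :: "real \<Rightarrow> real \<Rightarrow> complex" where
  "right_point e z = reflect (left_point e z)"

lemma reflect_simps [simp]: "Re (reflect q) = 1 - Re q" "Im (reflect q) = - Im q" 
    "reflect (reflect q) = q"
  by (simp_all add: reflect_def)

lemma inj_reflect: "inj reflect" by (metis injI reflect_simps(3))

lemma cross_reflect: "cross (reflect a) (reflect b) (reflect c) = cross a b c"
  by (simp add: cross_def algebra_simps)

lemma crossed_reflect: "crossed u v S \<Longrightarrow> crossed (reflect u) (reflect v) (reflect ` S)"
  unfolding crossed_def by (auto simp: cross_reflect)

lemma separated_reflect: "separated A B \<Longrightarrow> separated (reflect ` A) (reflect ` B)"
  unfolding separated_def
proof (elim exE conjE)
  fix \<alpha> \<beta> \<gamma> assume *: "\<forall>x\<in>A. \<gamma> < lin \<alpha> \<beta> x" "\<forall>x\<in>B. lin \<alpha> \<beta> x < \<gamma>"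
  have "lin (- \<alpha>) (- \<beta>) (reflect x) = lin \<alpha> \<beta> x - \<alpha>" for x
    by (simp add: lin_def algebra_simps)
  then show "\<exists>\<alpha> \<beta> \<gamma>. (\<forall>x\<in>reflect ` A. \<gamma> < lin \<alpha> \<beta> x) \<and> (\<forall>x\<in>reflect ` B. lin \<alpha> \<beta> x < \<gamma>)"
    using * by (intro exI[of _ "- \<alpha>"] exI[of _ "- \<beta>"] exI[of _ "\<gamma> - \<alpha>"]) auto
qed

lemma tendsto_left_point: "((\<lambda>e. left_point e y) \<longlongrightarrow> left_point 0 y) (at_right 0)"
  unfolding left_point_def by (intro tendsto_intros)

lemma tendsto_right_point: "((\<lambda>e. right_point e y) \<longlongrightarrow> right_point 0 y) (at_right 0)"
  unfolding right_point_def reflect_def by (intro tendsto_intros tendsto_left_point)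

text \<open>For \<open>e = 0\<close> the vertices are on two straight lines and the sign condition
  is strict, so it persists for small \<open>e\<close>. The line through the two vertices then
  separates them from \<open>S\<close>.\<close>

lemma eventually_one_side:
  assumes "finite S" "(\<forall>g\<in>S. 0 < cross (left_point 0 y) (right_point 0 z) g) \<or>
    (\<forall>g\<in>S. cross (left_point 0 y) (right_point 0 z) g < 0)"
  shows "\<forall>\<^sub>F e in at_right 0. separated {left_point e y, right_point e z} S"
proof -
  have t: "((\<lambda>e. cross (left_point e y) (right_point e z) g) \<longlongrightarrow>
      cross (left_point 0 y) (right_point 0 z) g) (at_right 0)" for g
    by (intro tendsto_intros tendsto_left_point tendsto_right_point)
  have "\<forall>\<^sub>F e in at_right 0. (\<forall>g\<in>S. 0 < cross (left_point e y) (right_point e z) g) \<or>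
    (\<forall>g\<in>S. cross (left_point e y) (right_point e z) g < 0)"
    using assms(2)
  proof
    assume "\<forall>g\<in>S. 0 < cross (left_point 0 y) (right_point 0 z) g"
    then have "\<forall>\<^sub>F e in at_right 0. \<forall>g\<in>S. 0 < cross (left_point e y) (right_point e z) g"
      by (intro eventually_ball_finite assms(1) ballI order_tendstoD(1)[OF t]) auto
    then show ?thesis by eventually_elim simp
  next
    assume "\<forall>g\<in>S. cross (left_point 0 y) (right_point 0 z) g < 0"
    then have "\<forall>\<^sub>F e in at_right 0. \<forall>g\<in>S. cross (left_point e y) (right_point e z) g < 0"
      by (intro eventually_ball_finite assms(1) ballI order_tendstoD(2)[OF t]) auto
    then show ?thesis by eventually_elim simp
  qed
  then show ?thesis
  proof eventually_elim
    case (elim e)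
    define u v where "u = left_point e y" and "v = right_point e z"
    define k where "k = (Re v - Re u) * Im u - (Im v - Im u) * Re u"
    have eq: "cross u v x = lin (- (Im v - Im u)) (Re v - Re u) x - k"
      "cross u v x = - k - lin (Im v - Im u) (- (Re v - Re u)) x" for x
      by (simp_all add: cross_def lin_def k_def algebra_simps)
    have "cross u v u = 0" "cross u v v = 0" by (simp_all add: cross_def)
    then have uv: "lin (- (Im v - Im u)) (Re v - Re u) x = k" "lin (Im v - Im u) (- (Re v - Re u)) x = - k"
      if "x \<in> {u, v}" for x
    proof -
      have "cross u v x = 0" using that \<open>cross u v u = 0\<close> \<open>cross u v v = 0\<close> by auto
      then show "lin (- (Im v - Im u)) (Re v - Re u) x = k" "lin (Im v - Im u) (- (Re v - Re u)) x = - k"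
        using eq[of x] by linarith+
    qed
    have "separated {u, v} S"
      using elim unfolding u_def[symmetric] v_def[symmetric]
    proof
      assume *: "\<forall>g\<in>S. 0 < cross u v g"
      show ?thesis
      proof (rule separatedI[OF assms(1), of _ "- k" "Im v - Im u" "- (Re v - Re u)"])
        show "- k \<le> lin (Im v - Im u) (- (Re v - Re u)) x" if "x \<in> {u, v}" for x using uv[OF that] by simp
        show "lin (Im v - Im u) (- (Re v - Re u)) x < - k" if "x \<in> S" for x
          using * that eq(2)[of x] by force
      qed
    next
      assume *: "\<forall>g\<in>S. cross u v g < 0"
      show ?thesis
      proof (rule separatedI[OF assms(1), of _ k "- (Im v - Im u)" "Re v - Re u"])
        show "k \<le> lin (- (Im v - Im u)) (Re v - Re u) x" if "x \<in> {u, v}" for x using uv[OF that] by simp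
        show "lin (- (Im v - Im u)) (Re v - Re u) x < k" if "x \<in> S" for x
          using * that eq(1)[of x] by force
      qed
    qed
    then show ?case by (simp add: u_def v_def)
  qed
qed

lemma eventually_wall_crossed:
  assumes "crossed (left_point 0 y) (right_point 0 z) S"
  shows "\<forall>\<^sub>F e in at_right 0. crossed (left_point e y) (right_point e z) S"
  using eventually_crossed[OF assms tendsto_left_point tendsto_right_point, of "\<lambda>_ x. x"] by simp

text \<open>The gates are at height \<open>0\<close> on the vertical lines through \<open>d\<close> and \<open>1 - d\<close>. A segment from
  \<open>(0, y)\<close> to \<open>(1, - z)\<close> meets them at heights \<open>d (m y - z)\<close> and \<open>d (y - m z)\<close>, so passing through the
  first gate means that \<open>z\<close> is close to \<open>m y\<close>, and through the second one that \<open>y\<close> is close to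
  \<open>m z\<close>.\<close>

locale gates =
  fixes m d w H :: real
  assumes m: "10 \<le> m" and d: "d = 1 / (m + 1)" and w: "w = m + 1 / 2" and H: "1 < H"
begin

text \<open>All three walls are segments; the third point lies on the same line and is there so that
  the perturbed wall becomes a triangle.\<close>

definition wall_low :: "complex set" where
  "wall_low = {Complex d (- d * w), Complex d (- H), Complex d (- H - 1)}"

definition wall_mid :: "complex set" where
  "wall_mid = {Complex d (d * w), Complex (1 - d) (- d * w), Complex (1 / 2) 0}"

definition wall_high :: "complex set" where
  "wall_high = {Complex (1 - d) (d * w), Complex (1 - d) H, Complex (1 - d) (H + 1)}"

text \<open>The choice of \<open>d\<close> makes \<open>(1 - d) / d\<close> equal to
  \<open>m\<close>, so the gates see the same factor as the windows. The number \<open>w\<close>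
  lies halfway between \<open>m\<close> and \<open>m + 1\<close>, the integer bounds for edges and
  non-edges.\<close>

lemma d_bounds: "0 < d" "d < 1 / 2" and dm: "d * m = 1 - d" and dw: "0 < d * w" "d * w < 1"
  using m by (auto simp: d w field_simps)

lemma wall_reflect:
  "reflect ` wall_low = wall_high" "reflect ` wall_high = wall_low" "reflect ` wall_mid = wall_mid"
  by (auto simp: wall_low_def wall_high_def wall_mid_def complex_eq_iff image_iff)

lemma walls_finite: "finite wall_low" "finite wall_mid" "finite wall_high"
  by (simp_all add: wall_low_def wall_mid_def wall_high_def)

lemma walls_card: "card wall_low = 3" "card wall_mid = 3" "card wall_high = 3"
  using d_bounds dw H by (auto simp: wall_low_def wall_mid_def wall_high_def complex_eq_iff card_insert_if)

lemma walls_Re: "q \<in> wall_low \<union> wall_mid \<union> wall_high \<Longrightarrow> d \<le> Re q \<and> Re q \<le> 1 - d"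
  using d_bounds by (auto simp: wall_low_def wall_mid_def wall_high_def)

lemma separated_low_high: "separated wall_high wall_low"
  by (rule separatedI[of _ _ "1 / 2" 1 0])
    (use d_bounds in \<open>auto simp: wall_low_def wall_high_def lin_def\<close>)

text \<open>The separating line is parallel to the middle wall and passes through
  \<open>(d, 0)\<close>, the centre of the first gate.\<close>

lemma separated_mid_low: "separated wall_mid wall_low"
proof (rule separatedI[of _ _ "2 * (d * w) * d" "2 * (d * w)" "1 - 2 * d"])
  define k where "k = d * w"
  have k: "0 < k" "k < H" "0 < k * (1 - 2 * d)" "0 < 1 - 2 * d"
    using d_bounds dw H by (auto simp: k_def)
  show "2 * (d * w) * d \<le> lin (2 * (d * w)) (1 - 2 * d) x" if "x \<in> wall_mid" for x
    using that k(3) unfolding wall_mid_def minus_mult_left[symmetric] k_def[symmetric]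
    by (auto simp: lin_def algebra_simps)
  fix x assume "x \<in> wall_low"
  then have x: "Re x = d" "Im x < 0"
    using k H unfolding wall_low_def minus_mult_left[symmetric] k_def[symmetric] by auto
  have "(1 - 2 * d) * Im x < 0" using x(2) k(4) by (rule mult_pos_neg[rotated])
  then show "lin (2 * (d * w)) (1 - 2 * d) x < 2 * (d * w) * d" using x(1) by (simp add: lin_def)
qed (simp add: walls_finite)

lemma walls_separated:
  "separated wall_low wall_mid" "separated wall_low wall_high" "separated wall_mid wall_low"
  "separated wall_mid wall_high" "separated wall_high wall_low" "separated wall_high wall_mid"
  using separated_low_high separated_mid_low separated_reflect[OF separated_mid_low]
  by (simp_all add: wall_reflect separated_sym)

text \<open>The ends are at horizontal distance \<open>1\<close>, so \<open>cross\<close> is the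
  signed vertical distance of \<open>q\<close> from the line through them, positive above
  it.\<close>

lemma cross_segment:
  "cross (left_point 0 y) (right_point 0 z) q = Im q - (1 - Re q) * y + Re q * z"
  by (simp add: cross_def left_point_def right_point_def algebra_simps)

lemma cross_segment_low:
  "cross (left_point 0 y) (right_point 0 z) (Complex d h) = h + d * (z - m * y)"
proof -
  have "(1 - d) * y = d * m * y" by (simp add: dm)
  then show ?thesis by (simp add: cross_segment algebra_simps)
qed

lemma cross_segment_high:
  "cross (left_point 0 y) (right_point 0 z) (Complex (1 - d) h) = h - d * (y - m * z)"
proof -
  have "(1 - d) * z = d * m * z" by (simp add: dm)
  then show ?thesis by (simp add: cross_segment algebra_simps)
qed

lemma cross_segment_middle:
  "cross (left_point 0 y) (right_point 0 z) (Complex (1 / 2) 0) =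
    (cross (left_point 0 y) (right_point 0 z) (Complex d (d * w)) +
     cross (left_point 0 y) (right_point 0 z) (Complex (1 - d) (- d * w))) / 2"
  by (simp add: cross_segment algebra_simps)

lemma scale: "a < b \<Longrightarrow> d * a < d * b" using d_bounds by simp

text \<open>The first hypothesis settles the wall points on the vertical line through
  \<open>d\<close>, the second those on the line through \<open>1 - d\<close>; the midpoint of
  \<open>wall_mid\<close> follows by averaging.\<close>

lemma first_gate:
  assumes "\<bar>z - m * y\<bar> < w" "y - m * z < - w"
  shows "\<forall>q\<in>wall_low. cross (left_point 0 y) (right_point 0 z) q < 0"
    "\<forall>q\<in>wall_mid. 0 < cross (left_point 0 y) (right_point 0 z) q"
    "\<forall>q\<in>wall_high. 0 < cross (left_point 0 y) (right_point 0 z) q"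
proof -
  have *: "d * (z - m * y) < d * w" "d * - w < d * (z - m * y)" "d * (y - m * z) < d * - w"
    by (rule scale, use assms in linarith)+
  have neg: "d * - w = - (d * w)" "- d * w = - (d * w)" by simp_all
  show "\<forall>q\<in>wall_low. cross (left_point 0 y) (right_point 0 z) q < 0"
    unfolding wall_low_def using * dw H neg by (simp add: cross_segment_low)
  have mid: "0 < cross (left_point 0 y) (right_point 0 z) (Complex d (d * w))"
     "0 < cross (left_point 0 y) (right_point 0 z) (Complex (1 - d) (- d * w))"
    unfolding cross_segment_low cross_segment_high using * neg by linarith+
  then show "\<forall>q\<in>wall_mid. 0 < cross (left_point 0 y) (right_point 0 z) q"
    unfolding wall_mid_def using cross_segment_middle[of y z] by simp
  show "\<forall>q\<in>wall_high. 0 < cross (left_point 0 y) (right_point 0 z) q"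
    unfolding wall_high_def using * dw H neg by (simp add: cross_segment_high)
qed

lemma second_gate:
  assumes "\<bar>y - m * z\<bar> < w" "z - m * y < - w"
  shows "\<forall>q\<in>wall_low. cross (left_point 0 y) (right_point 0 z) q < 0"
    "\<forall>q\<in>wall_mid. cross (left_point 0 y) (right_point 0 z) q < 0"
    "\<forall>q\<in>wall_high. 0 < cross (left_point 0 y) (right_point 0 z) q"
proof -
  have *: "d * (y - m * z) < d * w" "d * - w < d * (y - m * z)" "d * (z - m * y) < d * - w"
    by (rule scale, use assms in linarith)+
  have neg: "d * - w = - (d * w)" "- d * w = - (d * w)" by simp_all
  show "\<forall>q\<in>wall_low. cross (left_point 0 y) (right_point 0 z) q < 0"
    unfolding wall_low_def using * dw H neg by (simp add: cross_segment_low)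
  have mid: "cross (left_point 0 y) (right_point 0 z) (Complex d (d * w)) < 0"
     "cross (left_point 0 y) (right_point 0 z) (Complex (1 - d) (- d * w)) < 0"
    unfolding cross_segment_low cross_segment_high using * neg by linarith+
  then show "\<forall>q\<in>wall_mid. cross (left_point 0 y) (right_point 0 z) q < 0"
    unfolding wall_mid_def using cross_segment_middle[of y z] by simp
  show "\<forall>q\<in>wall_high. 0 < cross (left_point 0 y) (right_point 0 z) q"
    unfolding wall_high_def using * dw H neg by (simp add: cross_segment_high)
qed

text \<open>As \<open>z\<close> is below \<open>H\<close>, the segment cannot escape under the
  wall.\<close>

lemma blocked_low:
  assumes "0 < y" "0 < z" "z < H" "w < z - m * y"
  shows "crossed (left_point 0 y) (right_point 0 z) wall_low"
proof -
  let ?u = "left_point 0 y" and ?v = "right_point 0 z"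
  let ?q = "Complex d (- d * w)" and ?r = "Complex d (- H)"
  have "d * w < d * (z - m * y)" by (rule scale) (use assms in linarith)
  then have "0 < cross ?u ?v ?q" unfolding cross_segment_low by simp
  moreover have "d * (z - m * y) < H"
  proof -
    have "d * (z - m * y) < d * z" using assms m d_bounds by (intro scale) simp
    moreover have "d * z < 1 * z" using d_bounds assms by (intro mult_strict_right_mono) auto
    ultimately show ?thesis using assms by linarith
  qed
  then have "cross ?u ?v ?r < 0" unfolding cross_segment_low by simp
  moreover have "0 < H - d * w" using dw H by simp
  then have "cross ?q ?r ?u < 0" "0 < cross ?q ?r ?v"
    using d_bounds by (simp_all add: cross_def left_point_def right_point_def mult_less_0_iff zero_less_mult_iff)
  ultimately show ?thesis
    unfolding crossed_def wall_low_def by (meson insertI1 insertI2 mult_pos_neg mult_neg_pos)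
qed

lemma crossed_commute: "crossed u v S \<Longrightarrow> crossed v u S"
proof -
  have "cross v u q = - cross u v q" for q by (simp add: cross_def algebra_simps)
  then show "crossed u v S \<Longrightarrow> crossed v u S" unfolding crossed_def by (simp add: mult.commute)
qed

lemma blocked_high:
  assumes "0 < y" "0 < z" "y < H" "w < y - m * z"
  shows "crossed (left_point 0 y) (right_point 0 z) wall_high"
  using crossed_commute[OF crossed_reflect[OF blocked_low[OF assms(2,1,3,4)]]]
  by (simp add: wall_reflect right_point_def)

text \<open>The inequalities put the ends of the wall on different sides of the segment; the lower
  bound \<open>4\<close> puts the vertices on different sides of the line through the wall.\<close>

lemma blocked_mid:
  assumes "4 \<le> y" "4 \<le> z" "z - m * y < - w" "y - m * z < - w"
  shows "crossed (left_point 0 y) (right_point 0 z) wall_mid"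
proof -
  let ?u = "left_point 0 y" and ?v = "right_point 0 z"
  let ?q = "Complex d (d * w)" and ?r = "Complex (1 - d) (- d * w)"
  have *: "d * (z - m * y) < d * - w" "d * (y - m * z) < d * - w"
    by (rule scale, use assms in linarith)+
  have neg: "d * - w = - (d * w)" "- d * w = - (d * w)" by simp_all
  have "cross ?u ?v ?q < 0" "0 < cross ?u ?v ?r"
    unfolding cross_segment_low cross_segment_high using * neg by linarith+
  moreover have eq: "cross ?q ?r ?u = (1 - 2 * d) * y - d * w" "cross ?q ?r ?v = d * w - (1 - 2 * d) * z"
    by (simp_all add: cross_def left_point_def right_point_def algebra_simps)
  have "d \<le> 1 / 11" using m by (simp add: d field_simps)
  then have "1 < (1 - 2 * d) * x" if "4 \<le> x" for x
    using mult_mono[of "1 / 2" "1 - 2 * d" 4 x] that by simp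
  then have "0 < cross ?q ?r ?u" "cross ?q ?r ?v < 0"
    unfolding eq using assms(1,2) dw(2) by (smt (verit))+
  ultimately show ?thesis
    unfolding crossed_def wall_mid_def by (meson insertI1 insertI2 mult_pos_neg mult_neg_pos)
qed

end

lemma separated_Re:
  assumes "finite B" "\<And>x. x \<in> A \<Longrightarrow> c \<le> Re x" "\<And>x. x \<in> B \<Longrightarrow> Re x < c"
  shows "separated A B"
  by (rule separatedI[OF assms(1), of _ c 1 0]) (use assms in \<open>auto simp: lin_def\<close>)

section \<open>The five obstacles\<close>

text \<open>\<open>ed\<close> keeps the chain obstacles behind the lines of the gates.
  \<open>ahead\<close> spells out \<open>0 < chord y y (right_point e z)\<close>, so the tangent at
  a vertex passes behind the vertices across; the union of both sides makes it invariant under the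
  half turn.\<close>

locale five_obstacles = gates m d w H + L: convex_chain Y R e + R: convex_chain Y' R' e
  for m d w H e :: real and Y Y' :: "real set" and R R' :: "real \<Rightarrow> real \<Rightarrow> bool" +
  assumes ed: "e < d"
    and ahead: "\<And>y z. y \<in> Y \<union> Y' \<Longrightarrow> z \<in> Y \<union> Y' \<Longrightarrow> 0 < 1 + e * z\<^sup>2 + e * (y * (- 2 * z) - y\<^sup>2)"
begin

definition obstacles :: "complex set set" where
  "obstacles = {chain_obstacle e Y R, wall_low, wall_mid, wall_high, reflect ` chain_obstacle e Y' R'}"

lemma finite_obstacles: "finite obstacles" "card obstacles \<le> 5"
  by (simp_all add: obstacles_def card_insert_if)

lemma obstacle_size: "S \<in> obstacles \<Longrightarrow> finite S \<and> 3 \<le> card S"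
proof -
  have "card (reflect ` chain_obstacle e Y' R') = card (chain_obstacle e Y' R')"
    by (rule card_image) (rule inj_on_subset[OF inj_reflect subset_UNIV])
  then show "S \<in> obstacles \<Longrightarrow> finite S \<and> 3 \<le> card S"
    using card_chain_obstacle[OF L.fin, of e R] card_chain_obstacle[OF R.fin, of e R'] L.fin R.fin
      walls_finite walls_card
    by (auto simp: obstacles_def)
qed

lemma Re_left_chain: "q \<in> chain_obstacle e Y R \<Longrightarrow> Re q < d"
  using L.Re_chain_obstacle[of q] L.e ed by force

lemma Re_right_chain: "q \<in> reflect ` chain_obstacle e Y' R' \<Longrightarrow> 1 - d < Re q"
  using R.Re_chain_obstacle L.e ed by force

lemma left_chain_separated:
  "S \<in> {wall_low, wall_mid, wall_high, reflect ` chain_obstacle e Y' R'} \<Longrightarrow>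
    separated S (chain_obstacle e Y R)"
  by (rule separated_Re[of _ _ d])
    (use Re_left_chain Re_right_chain walls_Re L.fin d_bounds in force)+

lemma right_chain_separated:
  assumes "S \<in> {wall_low, wall_mid, wall_high}"
  shows "separated S (reflect ` chain_obstacle e Y' R')"
proof (rule separated_sym, rule separated_Re)
  show "finite S" using assms walls_finite by auto
  \<comment> \<open>Walls may touch the line through \<open>1 - d\<close>, and
    \<open>separated_Re\<close> needs the strict inequality on their side; hence the threshold is
    the minimum over the chain obstacle.\<close>
  let ?c = "Min (Re ` (reflect ` chain_obstacle e Y' R'))"
  have fin: "finite (Re ` reflect ` chain_obstacle e Y' R')" using R.fin by simp
  then show "?c \<le> Re x" if "x \<in> reflect ` chain_obstacle e Y' R'" for x using that by simp
  have "chain_obstacle e Y' R' \<noteq> {}" by (simp add: chain_obstacle_def)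
  then have "?c \<in> Re ` reflect ` chain_obstacle e Y' R'" using fin by (intro Min_in) auto
  then obtain x where x: "?c = Re x" "x \<in> reflect ` chain_obstacle e Y' R'" by (rule imageE)
  then have "1 - d < ?c" using Re_right_chain[OF x(2)] by (simp only:)
  then show "Re x < ?c" if "x \<in> S" for x using that assms walls_Re[of x] by auto
qed

lemma obstacles_separated:
  assumes "S \<in> obstacles" "S' \<in> obstacles" "S \<noteq> S'" shows "separated S S'"
proof -
  note * = left_chain_separated left_chain_separated[THEN separated_sym]
    right_chain_separated right_chain_separated[THEN separated_sym] walls_separated
  show ?thesis
    using assms unfolding obstacles_def
    by (elim insertE emptyE; simp only: *  insert_iff simp_thms; fastforce intro: *)
qed

lemma Re_left_point: "Re (left_point e y) \<le> 0"
  using L.e by (simp add: left_point_def)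

lemma left_edge:
  assumes "consecutive Y a b" "R a b" "S \<in> obstacles"
  shows "separated {left_point e a, left_point e b} S"
proof (cases "S = chain_obstacle e Y R")
  case True
  then show ?thesis using L.consecutive_visible[OF assms(1,2)] by simp
next
  case False
  have "separated S {left_point e a, left_point e b}"
  proof (rule separated_Re)
    show "d \<le> Re x" if "x \<in> S" for x
      using that False assms(3) walls_Re[of x] Re_right_chain[of x] d_bounds by (auto simp: obstacles_def)
    show "Re x < d" if "x \<in> {left_point e a, left_point e b}" for x
      using that Re_left_point[of a] Re_left_point[of b] d_bounds by auto
  qed simp
  then show ?thesis by (rule separated_sym)
qed

lemma left_non_edge:
  assumes "a \<in> Y" "b \<in> Y" "a < b" "\<not> (consecutive Y a b \<and> R a b)"
  shows "\<exists>S\<in>obstacles. crossed (left_point e a) (left_point e b) S"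
  using L.non_edges_hidden[OF assms] by (auto simp: obstacles_def)

lemma left_chain_ahead:
  assumes "y \<in> Y" "z \<in> Y'"
  shows "separated {left_point e y, right_point e z} (chain_obstacle e Y R)"
proof (rule L.separated_from_chain[OF assms(1)])
  show "0 < L.chord y y (right_point e z)"
    using ahead[of y z] assms
    by (simp add: L.chord_def right_point_def left_point_def power2_eq_square algebra_simps)
qed

lemma five_obstacles_reflected: "five_obstacles m d w H e Y' Y"
proof -
  have "five_obstacles_axioms d e Y' Y" by unfold_locales (use ed ahead in \<open>auto simp: Un_commute\<close>)
  then show ?thesis
    by (intro five_obstacles.intro gates_axioms L.convex_chain_axioms R.convex_chain_axioms)
qed

lemma obstacles_reflected: "five_obstacles.obstacles d w H e Y' Y R' R = (`) reflect ` obstacles"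
proof -
  interpret O: five_obstacles m d w H e Y' Y R' R by (rule five_obstacles_reflected)
  show ?thesis
    by (auto simp: O.obstacles_def obstacles_def wall_reflect image_image)
qed

lemma right_edge:
  assumes "consecutive Y' a b" "R' a b" "S \<in> obstacles"
  shows "separated {right_point e a, right_point e b} S"
proof -
  interpret O: five_obstacles m d w H e Y' Y R' R by (rule five_obstacles_reflected)
  have "reflect ` S \<in> O.obstacles" using assms(3) by (simp add: obstacles_reflected)
  then have "separated {left_point e a, left_point e b} (reflect ` S)"
    by (rule O.left_edge[OF assms(1,2)])
  then show ?thesis
    using separated_reflect by (fastforce simp: right_point_def image_image)
qed

lemma right_non_edge:
  assumes "a \<in> Y'" "b \<in> Y'" "a < b" "\<not> (consecutive Y' a b \<and> R' a b)"
  shows "\<exists>S\<in>obstacles. crossed (right_point e a) (right_point e b) S"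
  using crossed_reflect[OF R.non_edges_hidden[OF assms]] by (auto simp: obstacles_def right_point_def)

lemma right_chain_ahead:
  assumes "y \<in> Y" "z \<in> Y'"
  shows "separated {left_point e y, right_point e z} (reflect ` chain_obstacle e Y' R')"
proof -
  interpret O: five_obstacles m d w H e Y' Y R' R by (rule five_obstacles_reflected)
  show ?thesis
    using separated_reflect[OF O.left_chain_ahead[OF assms(2,1)]] by (simp add: right_point_def insert_commute)
qed

end

section \<open>Assembly of the obstacles for given coordinates\<close>

text \<open>The curvature \<open>e\<close> is the only free parameter. Each requirement on it is
  strict and holds for all small positive \<open>e\<close>, and there are finitely many, so one
  value satisfies them all.\<close>

lemma two_gate_representation:
  fixes t :: "'v \<Rightarrow> real" and side :: "'v \<Rightarrow> bool" and m :: real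
  assumes V: "finite V" and m: "10 \<le> m"
    and t: "\<And>v. v \<in> V \<Longrightarrow> 4 \<le> t v"
    and spaced: "\<And>u v. u \<in> V \<Longrightarrow> v \<in> V \<Longrightarrow> u \<noteq> v \<Longrightarrow> side u = side v \<Longrightarrow> 2 \<le> \<bar>t u - t v\<bar>"
    and same: "\<And>u v x. u \<in> V \<Longrightarrow> v \<in> V \<Longrightarrow> x \<in> V \<Longrightarrow> {u, v} \<in> E \<Longrightarrow> side u = side v \<Longrightarrow> side x = side u \<Longrightarrow>
      t u < t x \<Longrightarrow> t x < t v \<Longrightarrow> False"
    and across: "\<And>u v. u \<in> V \<Longrightarrow> v \<in> V \<Longrightarrow> {u, v} \<in> E \<Longrightarrow> side u \<Longrightarrow> \<not> side v \<Longrightarrow>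
      \<bar>t v - m * t u\<bar> \<le> m \<and> t u - m * t v \<le> - (m + 1) \<or> \<bar>t u - m * t v\<bar> \<le> m \<and> t v - m * t u \<le> - (m + 1)"
    and non_across: "\<And>u v. u \<in> V \<Longrightarrow> v \<in> V \<Longrightarrow> {u, v} \<notin> E \<Longrightarrow> side u \<Longrightarrow> \<not> side v \<Longrightarrow>
      m + 1 \<le> t v - m * t u \<or> m + 1 \<le> t u - m * t v \<or>
      t v - m * t u \<le> - (m + 1) \<and> t u - m * t v \<le> - (m + 1)"
  shows "\<exists>p Obs. convex_obstacle_representation V E p Obs \<and> pairwise disjnt Obs \<and> card Obs \<le> 5"
proof -
  define Y where "Y s = t ` {v \<in> V. side v = s}" for s
  \<comment> \<open>Adjacency in terms of heights; by \<open>spaced\<close> a height determines the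
    vertex on its side.\<close>
  define R where "R s a b \<longleftrightarrow> (\<exists>u v. u \<in> V \<and> v \<in> V \<and> side u = s \<and> side v = s \<and> t u = a \<and> t v = b \<and> {u, v} \<in> E)"
    for s a b
  have finY: "finite (Y s)" for s using V by (simp add: Y_def)
  have YI: "t v \<in> Y s" if "v \<in> V" "side v = s" for v s using that by (auto simp: Y_def)
  have Y4: "4 \<le> y" if "y \<in> Y s" for y s using that t by (auto simp: Y_def)
  define H where "H = 1 + Max (insert 1 (Y True \<union> Y False))"
  have Hmax: "x \<le> Max (insert 1 (Y True \<union> Y False))" if "x \<in> insert 1 (Y True \<union> Y False)" for x
    using that finY by (intro Max_ge) auto
  have H1: "1 < H" using Hmax[of 1] by (simp add: H_def)
  have below_H: "y < H" if "y \<in> Y True \<union> Y False" for y using Hmax[of y] that by (auto simp: H_def)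
  define d where "d = 1 / (m + 1)"
  define w where "w = m + 1 / 2"
  interpret gates m d w H by unfold_locales (use m H1 in \<open>auto simp: d_def w_def\<close>)
  let ?walls = "{wall_low, wall_mid, wall_high}"
  have inj: "u = v" if "u \<in> V" "v \<in> V" "side u = side v" "t u = t v" for u v
    using spaced[OF that(1,2)] that(3,4) by force
  have e1: "\<forall>\<^sub>F e in at_right 0. 0 < e \<and> e < d"
    using eventually_at_right_real[OF d_bounds(1)] by eventually_elim simp
  have e2: "\<forall>\<^sub>F e in at_right 0. \<forall>a\<in>Y True \<union> Y False. \<forall>b\<in>Y True \<union> Y False. e * ((a - b)\<^sup>2 + 1) < 1"
  proof (intro eventually_ball_finite ballI)
    fix a b :: real
    have "((\<lambda>e. e * ((a - b)\<^sup>2 + 1)) \<longlongrightarrow> 0 * ((a - b)\<^sup>2 + 1)) (at_right 0)" by (intro tendsto_intros)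
    then show "\<forall>\<^sub>F e in at_right 0. e * ((a - b)\<^sup>2 + 1) < 1" by (rule order_tendstoD(2)) simp
  qed (use finY in auto)
  have e3: "\<forall>\<^sub>F e in at_right 0. \<forall>y\<in>Y True \<union> Y False. \<forall>z\<in>Y True \<union> Y False.
      0 < 1 + e * z\<^sup>2 + e * (y * (- 2 * z) - y\<^sup>2)"
  proof (intro eventually_ball_finite ballI)
    fix y z :: real
    have "((\<lambda>e. 1 + e * z\<^sup>2 + e * (y * (- 2 * z) - y\<^sup>2)) \<longlongrightarrow>
        1 + 0 * z\<^sup>2 + 0 * (y * (- 2 * z) - y\<^sup>2)) (at_right 0)" by (intro tendsto_intros)
    then show "\<forall>\<^sub>F e in at_right 0. 0 < 1 + e * z\<^sup>2 + e * (y * (- 2 * z) - y\<^sup>2)"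
      by (rule order_tendstoD(1)) simp
  qed (use finY in auto)
  have e4: "\<forall>\<^sub>F e in at_right 0. \<forall>u\<in>V. \<forall>v\<in>V. \<forall>S\<in>?walls. {u, v} \<in> E \<and> side u \<and> \<not> side v \<longrightarrow>
      separated {left_point e (t u), right_point e (t v)} S"
  proof (intro eventually_ball_finite V ballI)
    fix u v S assume uv: "u \<in> V" "v \<in> V" and S: "S \<in> ?walls"
    show "\<forall>\<^sub>F e in at_right 0. {u, v} \<in> E \<and> side u \<and> \<not> side v \<longrightarrow>
      separated {left_point e (t u), right_point e (t v)} S"
    proof (cases "{u, v} \<in> E \<and> side u \<and> \<not> side v")
      case True
      then have "\<bar>t v - m * t u\<bar> < w \<and> t u - m * t v < - w \<or> \<bar>t u - m * t v\<bar> < w \<and> t v - m * t u < - w"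
        using across[OF uv] unfolding w_def by linarith
      then have "(\<forall>g\<in>S. 0 < cross (left_point 0 (t u)) (right_point 0 (t v)) g) \<or>
          (\<forall>g\<in>S. cross (left_point 0 (t u)) (right_point 0 (t v)) g < 0)"
        using S first_gate[of "t v" "t u"] second_gate[of "t u" "t v"] by blast
      moreover have "finite S" using S walls_finite by auto
      ultimately have "\<forall>\<^sub>F e in at_right 0. separated {left_point e (t u), right_point e (t v)} S"
        by (intro eventually_one_side)
      then show ?thesis by eventually_elim simp
    next
      case False
      then show ?thesis by (intro always_eventually allI) blast
    qed
  qed simp
  have e5: "\<forall>\<^sub>F e in at_right 0. \<forall>u\<in>V. \<forall>v\<in>V. {u, v} \<notin> E \<and> side u \<and> \<not> side v \<longrightarrow>
      (\<exists>S\<in>?walls. crossed (left_point e (t u)) (right_point e (t v)) S)"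
  proof (intro eventually_ball_finite V ballI)
    fix u v assume uv: "u \<in> V" "v \<in> V"
    show "\<forall>\<^sub>F e in at_right 0. {u, v} \<notin> E \<and> side u \<and> \<not> side v \<longrightarrow>
      (\<exists>S\<in>?walls. crossed (left_point e (t u)) (right_point e (t v)) S)"
    proof (cases "{u, v} \<notin> E \<and> side u \<and> \<not> side v")
      case True
      then have "w < t v - m * t u \<or> w < t u - m * t v \<or> t v - m * t u < - w \<and> t u - m * t v < - w"
        using non_across[OF uv] unfolding w_def by linarith
      moreover have "t u < H" "t v < H"
        using below_H[of "t u"] below_H[of "t v"] YI[OF uv(1)] YI[OF uv(2)] True by auto
      moreover have "4 \<le> t u" "4 \<le> t v" using t uv by auto
      ultimately obtain S where S: "S \<in> ?walls" "crossed (left_point 0 (t u)) (right_point 0 (t v)) S"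
        using blocked_low[of "t u" "t v"] blocked_high[of "t u" "t v"] blocked_mid[of "t u" "t v"] by force
      show ?thesis using eventually_wall_crossed[OF S(2)] by eventually_elim (use S(1) in blast)
    next
      case False
      then show ?thesis by (intro always_eventually allI) blast
    qed
  qed
  have "\<exists>e. (0 < e \<and> e < d) \<and> (\<forall>a\<in>Y True \<union> Y False. \<forall>b\<in>Y True \<union> Y False. e * ((a - b)\<^sup>2 + 1) < 1) \<and>
      (\<forall>y\<in>Y True \<union> Y False. \<forall>z\<in>Y True \<union> Y False. 0 < 1 + e * z\<^sup>2 + e * (y * (- 2 * z) - y\<^sup>2)) \<and>
      (\<forall>u\<in>V. \<forall>v\<in>V. \<forall>S\<in>?walls. {u, v} \<in> E \<and> side u \<and> \<not> side v \<longrightarrow>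
        separated {left_point e (t u), right_point e (t v)} S) \<and>
      (\<forall>u\<in>V. \<forall>v\<in>V. {u, v} \<notin> E \<and> side u \<and> \<not> side v \<longrightarrow>
        (\<exists>S\<in>?walls. crossed (left_point e (t u)) (right_point e (t v)) S))"
    by (rule eventually_happens'[OF _ eventually_conj[OF e1 eventually_conj[OF e2 eventually_conj[OF e3
            eventually_conj[OF e4 e5]]]]]) simp
  then obtain e where e: "(0 < e \<and> e < d) \<and> (\<forall>a\<in>Y True \<union> Y False. \<forall>b\<in>Y True \<union> Y False. e * ((a - b)\<^sup>2 + 1) < 1) \<and>
      (\<forall>y\<in>Y True \<union> Y False. \<forall>z\<in>Y True \<union> Y False. 0 < 1 + e * z\<^sup>2 + e * (y * (- 2 * z) - y\<^sup>2)) \<and>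
      (\<forall>u\<in>V. \<forall>v\<in>V. \<forall>S\<in>?walls. {u, v} \<in> E \<and> side u \<and> \<not> side v \<longrightarrow>
        separated {left_point e (t u), right_point e (t v)} S) \<and>
      (\<forall>u\<in>V. \<forall>v\<in>V. {u, v} \<notin> E \<and> side u \<and> \<not> side v \<longrightarrow>
        (\<exists>S\<in>?walls. crossed (left_point e (t u)) (right_point e (t v)) S))"
    by (rule exE)
  note e0 = conjunct1[OF e] and f1 = conjunct2[OF e]
  note esmall = conjunct1[OF f1] and f2 = conjunct2[OF f1]
  note eahead = conjunct1[OF f2] and f3 = conjunct2[OF f2]
  note esep = conjunct1[OF f3] and ecross = conjunct2[OF f3]
  have chain: "convex_chain (Y s) e" for s
  proof
    show "2 \<le> \<bar>a - b\<bar>" if "a \<in> Y s" "b \<in> Y s" "a \<noteq> b" for a b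
      using that spaced unfolding Y_def by auto
    show "0 < y" if "y \<in> Y s" for y using Y4[OF that] by simp
    show "e * ((a - b)\<^sup>2 + 1) < 1" if "a \<in> Y s" "b \<in> Y s" for a b
      using esmall that by (cases s) auto
  qed (use finY e0 in auto)
  interpret five_obstacles m d w H e "Y True" "Y False" "R True" "R False"
    using e0 eahead by (intro five_obstacles.intro gates_axioms chain five_obstacles_axioms.intro) blast+
  define P where "P v = (if side v then left_point e (t v) else right_point e (t v))" for v
  have R_iff: "R s (t u) (t v) \<longleftrightarrow> {u, v} \<in> E" if "u \<in> V" "v \<in> V" "side u = s" "side v = s" for u v s
    using that inj unfolding R_def by metis
  have cons: "consecutive (Y s) (t u) (t v)"
    if uv: "u \<in> V" "v \<in> V" "side u = s" "side v = s" "t u < t v" "{u, v} \<in> E" for u v s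
    unfolding consecutive_def
  proof (intro conjI ballI notI)
    fix x assume x: "x \<in> Y s" "t u < x \<and> x < t v"
    obtain x' where "x' \<in> V" "side x' = s" "x = t x'" using x(1) by (auto simp: Y_def)
    then show False using same[of u v x'] uv x by auto
  qed (use uv YI in auto)
  have obst_cases: "S \<in> ?walls \<or> S = chain_obstacle e (Y True) (R True) \<or>
    S = reflect ` chain_obstacle e (Y False) (R False)" if "S \<in> obstacles" for S
    using that by (auto simp: obstacles_def)
  have walls_obst: "S \<in> obstacles" if "S \<in> ?walls" for S using that by (auto simp: obstacles_def)
  have edge: "separated {P u, P v} S"
    if uv: "u \<in> V" "v \<in> V" "{u, v} \<in> E" "S \<in> obstacles" 
      "side u = side v \<and> t u < t v \<or> side u \<and> \<not> side v" for u v S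
    using uv(5)
  proof
    assume s: "side u = side v \<and> t u < t v"
    show ?thesis
    proof (cases "side u")
      case True
      have "R True (t u) (t v)" using R_iff[OF uv(1,2)] True s uv(3) by auto
      moreover have "consecutive (Y True) (t u) (t v)" using cons[OF uv(1,2)] True s uv(3) by auto
      ultimately show ?thesis using left_edge uv(4) True s by (simp add: P_def)
    next
      case False
      have "R False (t u) (t v)" using R_iff[OF uv(1,2)] False s uv(3) by auto
      moreover have "consecutive (Y False) (t u) (t v)" using cons[OF uv(1,2)] False s uv(3) by auto
      ultimately show ?thesis using right_edge uv(4) False s by (simp add: P_def)
    qed
  next
    assume s: "side u \<and> \<not> side v"
    have y: "t u \<in> Y True" "t v \<in> Y False" using s YI uv by auto
    have "separated {left_point e (t u), right_point e (t v)} S"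
      using obst_cases[OF uv(4)]
    proof (elim disjE)
      assume "S \<in> ?walls"
      then show ?thesis using esep uv s by blast
    qed (use left_chain_ahead[OF y] right_chain_ahead[OF y] in simp_all)
    then show ?thesis using s by (simp add: P_def)
  qed
  have non_edge: "\<exists>S\<in>obstacles. crossed (P u) (P v) S"
    if uv: "u \<in> V" "v \<in> V" "{u, v} \<notin> E" "side u = side v \<and> t u < t v \<or> side u \<and> \<not> side v" for u v
    using uv(4)
  proof
    assume s: "side u = side v \<and> t u < t v"
    show ?thesis
    proof (cases "side u")
      case True
      have "\<not> R True (t u) (t v)" using R_iff[OF uv(1,2)] True s uv(3) by auto
      moreover have "t u \<in> Y True" "t v \<in> Y True" using YI uv True s by auto
      ultimately show ?thesis using left_non_edge[of "t u" "t v"] True s by (simp add: P_def)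
    next
      case False
      have "\<not> R False (t u) (t v)" using R_iff[OF uv(1,2)] False s uv(3) by auto
      moreover have "t u \<in> Y False" "t v \<in> Y False" using YI uv False s by auto
      ultimately show ?thesis using right_non_edge[of "t u" "t v"] False s by (simp add: P_def)
    qed
  next
    assume s: "side u \<and> \<not> side v"
    then obtain S where "S \<in> ?walls" "crossed (left_point e (t u)) (right_point e (t v)) S"
      using ecross uv by blast
    then show ?thesis using s walls_obst by (auto simp: P_def)
  qed
  have order: "(side u = side v \<and> t u < t v \<or> side u \<and> \<not> side v) \<or>
      (side v = side u \<and> t v < t u \<or> side v \<and> \<not> side u)" if "u \<in> V" "v \<in> V" "u \<noteq> v" for u v
    using inj[OF that(1,2)] that(3) by (metis linorder_neqE)
  have "\<exists>p Obs. convex_obstacle_representation V E p Obs \<and> pairwise disjnt Obs \<and> card Obs \<le> card obstacles"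
  proof (rule representation_from_strict_incidences[OF V, of P])
    have "Re (left_point e y) \<noteq> Re (right_point e z)" for y z
      using Re_left_point[of y] Re_left_point[of z] by (simp add: right_point_def)
    then have ne: "left_point e y \<noteq> right_point e z" for y z by metis
    have im: "Im (left_point e y) = y" "Im (right_point e y) = - y" for y
      by (simp_all add: right_point_def left_point_def)
    show "inj_on P V"
    proof (rule inj_onI)
      fix u v assume uv: "u \<in> V" "v \<in> V" "P u = P v"
      have s: "side u = side v" using uv(3) ne[of "t u" "t v"] ne[of "t v" "t u"]
        by (auto simp: P_def split: if_splits)
      moreover have "t u = t v" using arg_cong[OF uv(3), of Im] s by (auto simp: P_def im split: if_splits)
      ultimately show "u = v" using inj uv by blast
    qed
    show "separated {P u, P v} S"
      if uv: "u \<in> V" "v \<in> V" "u \<noteq> v" "{u, v} \<in> E" "S \<in> obstacles" for u v S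
      using order[OF uv(1-3)]
    proof
      assume "side v = side u \<and> t v < t u \<or> side v \<and> \<not> side u"
      then have "separated {P v, P u} S" using edge[OF uv(2,1) _ uv(5)] uv(4) by (simp add: insert_commute)
      then show ?thesis by (simp add: insert_commute)
    qed (rule edge[OF uv(1,2,4,5)])
    show "\<exists>S\<in>obstacles. crossed (P u) (P v) S"
      if uv: "u \<in> V" "v \<in> V" "u \<noteq> v" "{u, v} \<notin> E" for u v
      using order[OF uv(1-3)]
    proof
      assume "side v = side u \<and> t v < t u \<or> side v \<and> \<not> side u"
      then have "\<exists>S\<in>obstacles. crossed (P v) (P u) S"
        using non_edge[OF uv(2,1)] uv(4) by (simp add: insert_commute)
      then show ?thesis using crossed_commute by blast
    qed (rule non_edge[OF uv(1,2,4)])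
  qed (use finite_obstacles obstacle_size obstacles_separated in auto)
  then show ?thesis using finite_obstacles(2) le_trans by blast
qed

section \<open>Outerplanar graphs\<close>

context noncrossing_path_graph
begin

lemma ex_representation:
  "\<exists>p Obs. convex_obstacle_representation {..N} {{i, j} |i j. adj i j} p Obs \<and>
     pairwise disjnt Obs \<and> card Obs \<le> 5"
proof (rule two_gate_representation[where t = "\<lambda>v. real_of_int (coord v)" and m = "real_of_int M"
      and side = side])
  have edge: "adj u v" if "{u, v} \<in> {{i, j} |i j. adj i j}" for u v
    using that adj_sym by (auto simp: doubleton_eq_iff)
  show "10 \<le> real_of_int M" using M_ge by simp
  show "4 \<le> real_of_int (coord v)" if "v \<in> {..N}" for v
    using coord_ge[of v] that by simp
  show "2 \<le> \<bar>real_of_int (coord u) - real_of_int (coord v)\<bar>"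
    if "u \<in> {..N}" "v \<in> {..N}" "u \<noteq> v" "side u = side v" for u v
    using coord_less_iff(2)[of u v] that by simp
  show False
    if "u \<in> {..N}" "v \<in> {..N}" "x \<in> {..N}" "{u, v} \<in> {{i, j} |i j. adj i j}" "side u = side v"
      "side x = side u" "real_of_int (coord u) < real_of_int (coord x)"
      "real_of_int (coord x) < real_of_int (coord v)" for u v x
    using coord_edge_consecutive[OF edge[OF that(4)] that(5)] that by simp
  fix u v assume uv: "u \<in> {..N}" "v \<in> {..N}" "side u" "\<not> side v"
  have r: "real_of_int (coord v) - real_of_int M * real_of_int (coord u) = real_of_int (coord v - M * coord u)"
    "real_of_int (coord u) - real_of_int M * real_of_int (coord v) = real_of_int (coord u - M * coord v)"
    by simp_all
  show "\<bar>real_of_int (coord v) - real_of_int M * real_of_int (coord u)\<bar> \<le> real_of_int M \<and>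
      real_of_int (coord u) - real_of_int M * real_of_int (coord v) \<le> - (real_of_int M + 1) \<or>
      \<bar>real_of_int (coord u) - real_of_int M * real_of_int (coord v)\<bar> \<le> real_of_int M \<and>
      real_of_int (coord v) - real_of_int M * real_of_int (coord u) \<le> - (real_of_int M + 1)"
    if "{u, v} \<in> {{i, j} |i j. adj i j}"
    unfolding r using coord_edge_across[OF edge[OF that]] uv by linarith
  show "real_of_int M + 1 \<le> real_of_int (coord v) - real_of_int M * real_of_int (coord u) \<or>
      real_of_int M + 1 \<le> real_of_int (coord u) - real_of_int M * real_of_int (coord v) \<or>
      real_of_int (coord v) - real_of_int M * real_of_int (coord u) \<le> - (real_of_int M + 1) \<and>
      real_of_int (coord u) - real_of_int M * real_of_int (coord v) \<le> - (real_of_int M + 1)"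
    if "{u, v} \<notin> {{i, j} |i j. adj i j}"
  proof -
    have "\<not> adj u v" using that by auto
    then have "M + 1 \<le> coord v - M * coord u \<or> M + 1 \<le> coord u - M * coord v \<or>
        coord v - M * coord u \<le> - (M + 1) \<and> coord u - M * coord v \<le> - (M + 1)"
      using coord_non_edge_across[of u v] uv by simp
    then show ?thesis unfolding r by linarith
  qed
qed simp

end

lemma subseq_nth4:
  assumes "i < j" "j < k" "k < l" "l < length xs"
  shows "subseq [xs ! i, xs ! j, xs ! k, xs ! l] xs"
proof -
  have "subseq [i, j, k, l] [0..<length xs]"
    using assms by (intro sorted_subset_imp_subseq) (auto simp: strict_sorted_iff)
  then have "subseq (map ((!) xs) [i, j, k, l]) (map ((!) xs) [0..<length xs])"
    by (rule subseq_map)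
  then show ?thesis by (simp add: map_nth)
qed

text \<open>The vertices of the order get the even numbers; the odd ones subdivide an additional
  Hamiltonian path, which makes the graph connected without joining old vertices.\<close>

lemma crossing_free_representation:
  fixes V :: "'a set"
  assumes graph: "simple_graph V E" and xs: "distinct xs" "set xs = V" "crossing_free E xs" and ne: "V \<noteq> {}"
  shows "\<exists>p Obs. convex_obstacle_representation V E p Obs \<and> pairwise disjnt Obs \<and> card Obs \<le> 5"
proof -
  define N where "N = 2 * (length xs - 1)"
  define adj where "adj i j \<longleftrightarrow> i \<le> N \<and> j \<le> N \<and>
    (j = Suc i \<or> i = Suc j \<or> even i \<and> even j \<and> {xs ! (i div 2), xs ! (j div 2)} \<in> E)" for i j
  have len: "0 < length xs" using xs(2) ne by auto
  have loop: "{x, x} \<notin> E" for x using graph by (auto simp: simple_graph_def)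
  interpret noncrossing_path_graph N adj
  proof
    show "adj j i" if "adj i j" for i j using that by (auto simp: adj_def insert_commute)
    show "\<not> adj i i" for i using loop by (auto simp: adj_def)
    show "\<not> adj b e" if o: "a < b" "b < c" "c < e" and ac: "adj a c" for a b c e
    proof
      assume be: "adj b e"
      \<comment> \<open>Path edges join successive numbers, so an edge passing over another vertex
        joins two even numbers and comes from the original graph.\<close>
      have ev: "even a" "even b" "even c" "even e"
        and E: "{xs ! (a div 2), xs ! (c div 2)} \<in> E" "{xs ! (b div 2), xs ! (e div 2)} \<in> E"
        using o ac be by (auto simp: adj_def)
      have "e \<le> 2 * (length xs - 1)" using be by (simp add: adj_def N_def)
      then have "e div 2 < length xs" using len by presburger
      moreover have "a div 2 < b div 2" "b div 2 < c div 2" "c div 2 < e div 2"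
        using o ev by (auto elim!: evenE)
      ultimately have "subseq [xs ! (a div 2), xs ! (b div 2), xs ! (c div 2), xs ! (e div 2)] xs"
        by (intro subseq_nth4)
      then show False using xs(3) E unfolding crossing_free_def by blast
    qed
  qed (auto simp: adj_def)
  define F where "F = {{i, j} |i j. adj i j}"
  obtain p Obs where rep: "convex_obstacle_representation {..N} F p Obs"
    and dis: "pairwise disjnt Obs" "card Obs \<le> 5" using ex_representation unfolding F_def by blast
  define idx where "idx v = inv_into {..<length xs} ((!) xs) v" for v
  have idx: "idx v < length xs" "xs ! idx v = v" if "v \<in> V" for v
  proof -
    have m: "v \<in> (!) xs ` {..<length xs}" using that xs(2) by (auto simp: in_set_conv_nth)
    then show "idx v < length xs" "xs ! idx v = v"
      using inv_into_into[OF m] f_inv_into_f[OF m] by (simp_all add: idx_def)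
  qed
  have idxN: "2 * idx v \<in> {..N}" if "v \<in> V" for v using idx(1)[OF that] by (simp add: N_def)
  have inj: "inj_on (\<lambda>v. 2 * idx v) V" using idx(2) by (intro inj_onI) (metis mult_cancel1 zero_neq_numeral)
  have adj_iff: "adj (2 * idx u) (2 * idx v) \<longleftrightarrow> {u, v} \<in> E" if "u \<in> V" "v \<in> V" for u v
  proof -
    have "2 * idx v \<noteq> Suc (2 * idx u)" "2 * idx u \<noteq> Suc (2 * idx v)" by presburger+
    then show ?thesis using idxN[OF that(1)] idxN[OF that(2)] idx(2)[OF that(1)] idx(2)[OF that(2)]
      by (simp add: adj_def)
  qed
  have mem: "{i, j} \<in> F \<longleftrightarrow> adj i j" for i j
    using adj_sym by (auto simp: F_def doubleton_eq_iff)
  have general: "general_position (p ` {..N} \<union> \<Union> (polygon_vertices ` Obs))" and inj_p: "inj_on p {..N}"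
    using rep by (simp_all add: convex_obstacle_representation_def)
  have vis: "{i, j} \<in> F \<longleftrightarrow> (\<forall>P\<in>Obs. closed_segment (p i) (p j) \<inter> P = {})"
    if "i \<in> {..N}" "j \<in> {..N}" "i \<noteq> j" for i j
    using rep that unfolding convex_obstacle_representation_def by blast
  \<comment> \<open>Deleting the subdividing vertices preserves general position and the visibility
    of the remaining pairs, so the obstacles can be kept.\<close>
  have "convex_obstacle_representation V E (\<lambda>v. p (2 * idx v)) Obs"
    unfolding convex_obstacle_representation_def
  proof (intro conjI ballI impI)
    show "inj_on (\<lambda>v. p (2 * idx v)) V"
    proof (rule inj_onI)
      fix u v assume "u \<in> V" "v \<in> V" "p (2 * idx u) = p (2 * idx v)"
      then show "u = v" using inj_onD[OF inj_p _ idxN idxN] inj_onD[OF inj] by blast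
    qed
    have "(\<lambda>v. p (2 * idx v)) ` V \<subseteq> p ` {..N}" using idxN by auto
    then show "general_position ((\<lambda>v. p (2 * idx v)) ` V \<union> \<Union> (polygon_vertices ` Obs))"
      using general by (meson Un_mono general_position_def order_refl order_trans)
    fix u v assume uv: "u \<in> V" "v \<in> V" "u \<noteq> v"
    have "2 * idx u \<noteq> 2 * idx v" using inj uv by (auto simp: inj_on_def)
    then have "adj (2 * idx u) (2 * idx v) \<longleftrightarrow>
        (\<forall>P\<in>Obs. closed_segment (p (2 * idx u)) (p (2 * idx v)) \<inter> P = {})"
      using vis[OF idxN[OF uv(1)] idxN[OF uv(2)]] by (simp only: mem simp_thms)
    then show "({u, v} \<in> E) = (\<forall>P\<in>Obs. closed_segment (p (2 * idx u)) (p (2 * idx v)) \<inter> P = {})"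
      using adj_iff[OF uv(1,2)] by simp
  qed (use rep in \<open>auto simp: convex_obstacle_representation_def\<close>)
  then show ?thesis using dis by blast
qed

theorem theorem1:
  fixes V :: "'a set" and E :: "'a set set"
  assumes "simple_graph V E"
    and "outerplanar V E"
  shows "convex_obstacle_number V E \<le> 5 \<and> disjoint_convex_obstacle_number V E \<le> 5"
proof -
  have "\<exists>p Obs. convex_obstacle_representation V E p Obs \<and> pairwise disjnt Obs \<and> card Obs \<le> 5"
  proof (cases "V = {}")
    \<comment> \<open>The breadth-first layers need a root, so the empty graph is treated
      apart.\<close>
    case True
    then have "convex_obstacle_representation V E (\<lambda>_. 0) {}"
      by (auto simp: convex_obstacle_representation_def general_position_def)
    then show ?thesis by (intro exI[of _ "\<lambda>_. 0"] exI[of _ "{}"]) simp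
  next
    case False
    obtain p c where "plane_drawing V E p c" "p ` V \<subseteq> frontier (outside (drawing_image V E p c))"
      using assms(2) by (auto simp: outerplanar_def)
    then interpret outerplane_drawing V E p c
      using assms(1) by unfold_locales
    obtain xs where "distinct xs" "set xs = V" "crossing_free E xs"
      using ex_crossing_free_order by blast
    then show ?thesis using crossing_free_representation assms(1) False by blast
  qed
  then obtain p Obs where rep: "convex_obstacle_representation V E p Obs" "pairwise disjnt Obs"
    and "card Obs \<le> 5" by blast
  then have "enat (card Obs) \<le> 5" by (metis enat_ord_simps(1) numeral_eq_enat)
  moreover have "convex_obstacle_number V E \<le> enat (card Obs)"
    unfolding convex_obstacle_number_def using rep by (intro Inf_lower) auto
  moreover have "disjoint_convex_obstacle_number V E \<le> enat (card Obs)"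
    unfolding disjoint_convex_obstacle_number_def using rep by (intro Inf_lower) auto
  ultimately show ?thesis by (meson order_trans)
qed

end
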